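(* The class of maximal 3-chops of 3-connected graphs endorses 4-tangles. That is: let $G$ be a 3-connected graph, let $\tau$ be a non-cubic 4-tangle in $G$, and let $N_1,N_2$ be maximal 3-chops of $G$; for $i=1,2$ let $\sigma_i$ be the splitting star of $N_i$ with $\sigma_i\subseteq\tau$. Then the torsos of $\sigma_1$ and $\sigma_2$ are internally 4-connected and isomorphic to each other.
   Context: All graphs are finite and simple. A separation of $G$ is an unordered pair $\{A,B\}$ with $A\cup B=V(G)$ and no edge between $A\setminus B$ and $B\setminus A$; its order is $|A\cap B|$; a 3-separation has order exactly 3; it is proper if $A\setminus B\ne\emptyset\ne B\setminus A$. For oriented separations, $(A,B)\le(C,D)$ iff $A\subseteq C$ and $B\supseteq D$. Two separations are nested if some orientations are $\le$-comparable. A star is a set $\sigma$ of oriented separations with $(A,B)\le(D,C)$ for distinct $(A,B),(C,D)\in\sigma$; bag $\bigcap_{(A,B)\in\sigma}B$ ($V(G)$ if empty); torso: subgraph induced on the bag with each $A\cap B$, $(A,B)\in\sigma$, made into a clique. A splitting star of a set $S$ of separations is a star of orientations of elements of $S$ such that every $\{C,D\}\in S$ has an orientation $\le$ some element of the star. A proper 3-separation $\{A,B\}$ is claw-free if both $G[A]$ and $G[B]$ contain a cycle. A set of proper 3-separations is claw-freeable if it can be enumerated $s_0,\dots,s_n$ so that each $s_i$ is claw-free or shares at least two separator vertices with some $s_j$, $j<i$. A 3-chop is a claw-freeable nested set of proper 3-separations; maximal means not properly contained in another 3-chop of $G$. A $k$-tangle is a set $\tau$ of oriented separations of order $<k$ containing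 exactly one orientation of each separation of order $<k$ and containing no three $(A_i,B_i)$ with $G[A_1]\cup G[A_2]\cup G[A_3]=G$. A set $X$ of four vertices is cubic in $G$ if the set of neighbourhoods of the components of $G-X$ is exactly the set of 3-element subsets of $X$. A 4-tangle $\tau$ in a 3-connected graph is cubic if it contains a star of 3-separations whose bag is a cubic vertex set in $G$; otherwise it is non-cubic. Internally 4-connected: 3-connected, more than four vertices, and every proper 3-separation $\{A,B\}$ has independent separator and $|A\setminus B|=1$ or $|B\setminus A|=1$. *)

theory Defs
  imports Main
begin

definition graph :: "'a set \<Rightarrow> ('a \<Rightarrow> 'a \<Rightarrow> bool) \<Rightarrow> bool" where
  "graph V E \<longleftrightarrow> finite V \<and> (\<forall>x y. E x y \<longrightarrow> x \<in> V \<and> y \<in> V \<and> x \<noteq> y \<and> E y x)"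

definition restr :: "('a \<Rightarrow> 'a \<Rightarrow> bool) \<Rightarrow> 'a set \<Rightarrow> 'a \<Rightarrow> 'a \<Rightarrow> bool" where
  "restr E W = (\<lambda>u v. E u v \<and> u \<in> W \<and> v \<in> W)"

definition connected_set :: "('a \<Rightarrow> 'a \<Rightarrow> bool) \<Rightarrow> 'a set \<Rightarrow> bool" where
  "connected_set E W \<longleftrightarrow> W \<noteq> {} \<and> (\<forall>x\<in>W. \<forall>y\<in>W. (restr E W)\<^sup>*\<^sup>* x y)"

definition components :: "('a \<Rightarrow> 'a \<Rightarrow> bool) \<Rightarrow> 'a set \<Rightarrow> 'a set set" where
  "components E W = {C. \<exists>x\<in>W. C = {y\<in>W. (restr E W)\<^sup>*\<^sup>* x y}}"

definition k_connected :: "'a set \<Rightarrow> ('a \<Rightarrow> 'a \<Rightarrow> bool) \<Rightarrow> nat \<Rightarrow> bool" where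
  "k_connected V E k \<longleftrightarrow> graph V E \<and> card V > k \<and>
     (\<forall>X. X \<subseteq> V \<and> card X < k \<longrightarrow> connected_set E (V - X))"

definition is_sep :: "'a set \<Rightarrow> ('a \<Rightarrow> 'a \<Rightarrow> bool) \<Rightarrow> 'a set \<Rightarrow> 'a set \<Rightarrow> bool" where
  "is_sep V E A B \<longleftrightarrow> A \<union> B = V \<and> (\<forall>x\<in>A - B. \<forall>y\<in>B - A. \<not> E x y)"

(* unordered separations {A,B} are represented as sets of vertex sets *)
definition usep :: "'a set \<Rightarrow> ('a \<Rightarrow> 'a \<Rightarrow> bool) \<Rightarrow> 'a set set \<Rightarrow> bool" where
  "usep V E s \<longleftrightarrow> (\<exists>A B. s = {A, B} \<and> is_sep V E A B)"

definition orientations :: "'a set set \<Rightarrow> ('a set \<times> 'a set) set" where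
  "orientations s = {(A, B). s = {A, B}}"

definition separator :: "'a set set \<Rightarrow> 'a set" where
  "separator s = \<Inter> s"

definition proper_sep :: "'a set \<Rightarrow> 'a set \<Rightarrow> bool" where
  "proper_sep A B \<longleftrightarrow> A - B \<noteq> {} \<and> B - A \<noteq> {}"

definition proper3 :: "'a set \<Rightarrow> ('a \<Rightarrow> 'a \<Rightarrow> bool) \<Rightarrow> 'a set set \<Rightarrow> bool" where
  "proper3 V E s \<longleftrightarrow> (\<exists>A B. s = {A, B} \<and> is_sep V E A B \<and> card (A \<inter> B) = 3 \<and> proper_sep A B)"

definition has_cycle :: "('a \<Rightarrow> 'a \<Rightarrow> bool) \<Rightarrow> 'a set \<Rightarrow> bool" where
  "has_cycle E A \<longleftrightarrow> (\<exists>xs. length xs \<ge> 3 \<and> distinct xs \<and> set xs \<subseteq> A \<and>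
      (\<forall>i < length xs. E (xs ! i) (xs ! ((i + 1) mod length xs))))"

definition claw_free :: "'a set \<Rightarrow> ('a \<Rightarrow> 'a \<Rightarrow> bool) \<Rightarrow> 'a set set \<Rightarrow> bool" where
  "claw_free V E s \<longleftrightarrow> (\<exists>A B. s = {A, B} \<and> is_sep V E A B \<and> card (A \<inter> B) = 3 \<and> proper_sep A B
      \<and> has_cycle E A \<and> has_cycle E B)"

definition claw_freeable :: "'a set \<Rightarrow> ('a \<Rightarrow> 'a \<Rightarrow> bool) \<Rightarrow> 'a set set set \<Rightarrow> bool" where
  "claw_freeable V E S \<longleftrightarrow> (\<forall>s\<in>S. proper3 V E s) \<and>
     (\<exists>ss. distinct ss \<and> set ss = S \<and>
        (\<forall>i < length ss. claw_free V E (ss ! i) \<or>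
           (\<exists>j < i. card (separator (ss ! i) \<inter> separator (ss ! j)) \<ge> 2)))"

definition sep_le :: "('a set \<times> 'a set) \<Rightarrow> ('a set \<times> 'a set) \<Rightarrow> bool" where
  "sep_le p q \<longleftrightarrow> fst p \<subseteq> fst q \<and> snd q \<subseteq> snd p"

definition nested :: "'a set set \<Rightarrow> 'a set set \<Rightarrow> bool" where
  "nested s t \<longleftrightarrow> (\<exists>p\<in>orientations s. \<exists>q\<in>orientations t. sep_le p q \<or> sep_le q p)"

definition chop3 :: "'a set \<Rightarrow> ('a \<Rightarrow> 'a \<Rightarrow> bool) \<Rightarrow> 'a set set set \<Rightarrow> bool" where
  "chop3 V E N \<longleftrightarrow> (\<forall>s\<in>N. proper3 V E s) \<and> claw_freeable V E N \<and>
     (\<forall>s\<in>N. \<forall>t\<in>N. nested s t)"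

definition max_chop3 :: "'a set \<Rightarrow> ('a \<Rightarrow> 'a \<Rightarrow> bool) \<Rightarrow> 'a set set set \<Rightarrow> bool" where
  "max_chop3 V E N \<longleftrightarrow> chop3 V E N \<and> (\<nexists>N'. chop3 V E N' \<and> N \<subset> N')"

definition star :: "('a set \<times> 'a set) set \<Rightarrow> bool" where
  "star \<sigma> \<longleftrightarrow> (\<forall>A B C D. (A, B) \<in> \<sigma> \<and> (C, D) \<in> \<sigma> \<and> (A, B) \<noteq> (C, D) \<longrightarrow> sep_le (A, B) (D, C))"

definition bag :: "'a set \<Rightarrow> ('a set \<times> 'a set) set \<Rightarrow> 'a set" where
  "bag V \<sigma> = (if \<sigma> = {} then V else (\<Inter>p\<in>\<sigma>. snd p))"

definition torso :: "'a set \<Rightarrow> ('a \<Rightarrow> 'a \<Rightarrow> bool) \<Rightarrow> ('a set \<times> 'a set) set \<Rightarrow> 'a \<Rightarrow> 'a \<Rightarrow> bool" where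
  "torso V E \<sigma> = (\<lambda>x y. x \<in> bag V \<sigma> \<and> y \<in> bag V \<sigma> \<and> x \<noteq> y \<and>
      (E x y \<or> (\<exists>(A, B)\<in>\<sigma>. x \<in> A \<inter> B \<and> y \<in> A \<inter> B)))"

definition splitting_star :: "'a set set set \<Rightarrow> ('a set \<times> 'a set) set \<Rightarrow> bool" where
  "splitting_star S \<sigma> \<longleftrightarrow> star \<sigma> \<and> (\<forall>p\<in>\<sigma>. \<exists>s\<in>S. p \<in> orientations s) \<and>
     (\<forall>s\<in>S. \<exists>p\<in>orientations s. \<exists>q\<in>\<sigma>. sep_le p q)"

definition tangle :: "'a set \<Rightarrow> ('a \<Rightarrow> 'a \<Rightarrow> bool) \<Rightarrow> nat \<Rightarrow> ('a set \<times> 'a set) set \<Rightarrow> bool" where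
  "tangle V E k \<tau> \<longleftrightarrow>
     (\<forall>(A, B)\<in>\<tau>. is_sep V E A B \<and> card (A \<inter> B) < k) \<and>
     (\<forall>A B. is_sep V E A B \<and> card (A \<inter> B) < k \<longrightarrow>
        ((A, B) \<in> \<tau> \<or> (B, A) \<in> \<tau>) \<and> ((A, B) \<in> \<tau> \<and> (B, A) \<in> \<tau> \<longrightarrow> A = B)) \<and>
     \<not> (\<exists>A1 B1 A2 B2 A3 B3. (A1, B1) \<in> \<tau> \<and> (A2, B2) \<in> \<tau> \<and> (A3, B3) \<in> \<tau> \<and>
          A1 \<union> A2 \<union> A3 = V \<and>
          (\<forall>x y. E x y \<longrightarrow> (x \<in> A1 \<and> y \<in> A1) \<or> (x \<in> A2 \<and> y \<in> A2) \<or> (x \<in> A3 \<and> y \<in> A3)))"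

definition nbh :: "'a set \<Rightarrow> ('a \<Rightarrow> 'a \<Rightarrow> bool) \<Rightarrow> 'a set \<Rightarrow> 'a set" where
  "nbh V E C = {v \<in> V - C. \<exists>u\<in>C. E u v}"

definition cubic_set :: "'a set \<Rightarrow> ('a \<Rightarrow> 'a \<Rightarrow> bool) \<Rightarrow> 'a set \<Rightarrow> bool" where
  "cubic_set V E X \<longleftrightarrow> X \<subseteq> V \<and> card X = 4 \<and>
     nbh V E ` components E (V - X) = {Y. Y \<subseteq> X \<and> card Y = 3}"

definition cubic_tangle :: "'a set \<Rightarrow> ('a \<Rightarrow> 'a \<Rightarrow> bool) \<Rightarrow> ('a set \<times> 'a set) set \<Rightarrow> bool" where
  "cubic_tangle V E \<tau> \<longleftrightarrow> (\<exists>\<sigma>\<subseteq>\<tau>. star \<sigma> \<and> (\<forall>(A, B)\<in>\<sigma>. card (A \<inter> B) = 3) \<and>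
      cubic_set V E (bag V \<sigma>))"

definition int4_connected :: "'a set \<Rightarrow> ('a \<Rightarrow> 'a \<Rightarrow> bool) \<Rightarrow> bool" where
  "int4_connected V E \<longleftrightarrow> k_connected V E 3 \<and> card V > 4 \<and>
     (\<forall>A B. is_sep V E A B \<and> card (A \<inter> B) = 3 \<and> proper_sep A B \<longrightarrow>
        (\<forall>x\<in>A \<inter> B. \<forall>y\<in>A \<inter> B. \<not> E x y) \<and> (card (A - B) = 1 \<or> card (B - A) = 1))"

definition graph_iso :: "'a set \<Rightarrow> ('a \<Rightarrow> 'a \<Rightarrow> bool) \<Rightarrow> 'b set \<Rightarrow> ('b \<Rightarrow> 'b \<Rightarrow> bool) \<Rightarrow> bool" where
  "graph_iso V1 E1 V2 E2 \<longleftrightarrow> (\<exists>f. bij_betw f V1 V2 \<and> (\<forall>x\<in>V1. \<forall>y\<in>V1. E1 x y \<longleftrightarrow> E2 (f x) (f y)))"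

end

theory Submission
  imports Defs
begin

text \<open>A torso of a splitting star is reached from \<open>G\<close> by successively chopping off small sides of
  3-separations that contain a cycle, replacing each of them by a triangle on its separator. Indeed,
  once an earlier separator is a triangle, a side whose separator shares two vertices with it
  contains a cycle as well, so a claw-freeing enumeration is a sequence of such steps, and maximality
  of the 3-chop means that no further step is possible. Chopping terminates and, by uncrossing, it
  is locally confluent up to isomorphism: of two crossing small sides, either the union of the two can
  be chopped off afterwards in both cases, or they overlap in a single edge \<open>st\<close>, and then the two
  results differ by exchanging \<open>s\<close> and \<open>t\<close>. Hence the normal form is unique up to isomorphism, as in
  Newman's lemma.\<close>

text \<open>A chop is made at the side that the tangle calls small and asks for a cycle on that side
  alone, so every torso has to inherit an orientation, and confluence has to match these
  orientations as well as the graphs. The obstacle is at the end: \<open>profile4\<close> survives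
  chopping, but it does not forbid every cover by three small sides, and such a cover is what
  excludes a big side consisting of one vertex of degree three. That exclusion must go back to the
  tangle of \<open>G\<close>; \<open>represents\<close> keeps the link between the two through all
  chops. Besides the crossing sides there are small sides pointing towards each other, where the
  chops commute. A second side may also have shrunk to its separator; then no chop is made, which is
  why joins are stated with \<open>chops_to\<close> and not with a single step. The tangle being
  non-cubic enters only in the proof that the bag has more than four vertices.\<close>

section \<open>Graphs, separations and connectivity\<close>

lemma graphD:
  assumes "graph V E"
  shows "finite V" "E x y \<Longrightarrow> x \<in> V" "E x y \<Longrightarrow> y \<in> V" "E x y \<Longrightarrow> x \<noteq> y" "E x y \<Longrightarrow> E y x"
  using assms unfolding graph_def by blast+

lemma is_sep_edge:
  assumes "graph V E" "is_sep V E A B" "E x y"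
  shows "x \<in> A \<and> y \<in> A \<or> x \<in> B \<and> y \<in> B"
  using assms unfolding graph_def is_sep_def by blast

lemma is_sepI:
  assumes "graph V E" "A \<union> B = V"
    and "\<And>x y. E x y \<Longrightarrow> x \<in> A \<and> y \<in> A \<or> x \<in> B \<and> y \<in> B"
  shows "is_sep V E A B"
  using assms unfolding graph_def is_sep_def by blast

lemma is_sep_sym: "graph V E \<Longrightarrow> is_sep V E A B \<Longrightarrow> is_sep V E B A"
  unfolding graph_def is_sep_def by blast

lemma is_sep_Un: "is_sep V E A B \<Longrightarrow> A \<union> B = V"
  unfolding is_sep_def by blast

lemma is_sep_subset: "is_sep V E A B \<Longrightarrow> A \<subseteq> V \<and> B \<subseteq> V"
  unfolding is_sep_def by blast

lemma is_sep_corner: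
  assumes "graph V E" "is_sep V E A B" "is_sep V E C D"
  shows "is_sep V E (A \<union> C) (B \<inter> D)" "is_sep V E (A \<inter> C) (B \<union> D)"
  using assms unfolding graph_def is_sep_def by blast+

lemma is_sep_trivial: "X \<subseteq> V \<Longrightarrow> is_sep V E X V" "X \<subseteq> V \<Longrightarrow> is_sep V E V X"
  unfolding is_sep_def by blast+

lemma k_connectedD:
  assumes k: "k_connected V E k" and s: "is_sep V E A B" and c: "card (A \<inter> B) < k"
  shows "A \<subseteq> B \<or> B \<subseteq> A"
proof (rule ccontr)
  assume "\<not> (A \<subseteq> B \<or> B \<subseteq> A)"
  then obtain a b where ab: "a \<in> A - B" "b \<in> B - A" by blast
  have V: "A \<union> B = V" using s by (rule is_sep_Un)
  have "connected_set E (V - A \<inter> B)"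
    using k c V unfolding k_connected_def by blast
  then have "(restr E (V - A \<inter> B))\<^sup>*\<^sup>* a b"
    using ab V unfolding connected_set_def by blast
  then have "b \<in> A - B"
  proof induction
    case base
    show ?case using ab by simp
  next
    case (step y z)
    then show ?case using s unfolding restr_def is_sep_def by blast
  qed
  then show False using ab by simp
qed

lemma k_connectedI:
  assumes g: "graph V E" and V: "card V > k"
    and sep: "\<And>A B. is_sep V E A B \<Longrightarrow> card (A \<inter> B) < k \<Longrightarrow> A \<subseteq> B \<or> B \<subseteq> A"
  shows "k_connected V E k"
proof -
  have "connected_set E (V - X)" if X: "X \<subseteq> V" "card X < k" for X
  proof -
    have "V - X \<noteq> {}"
      using X V by (metis Diff_eq_empty_iff dual_order.strict_trans less_irrefl subset_antisym)
    moreover have "(restr E (V - X))\<^sup>*\<^sup>* x y" if xy: "x \<in> V - X" "y \<in> V - X" for x y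
    proof -
      \<comment> \<open>\<open>R\<close> is the component of \<open>x\<close> in
        \<open>V - X\<close>; the separation cutting it off has separator exactly
        \<open>X\<close>.\<close>
      define R where "R = {z \<in> V - X. (restr E (V - X))\<^sup>*\<^sup>* x z}"
      have xR: "x \<in> R" using xy by (simp add: R_def)
      have RV: "R \<subseteq> V - X" by (auto simp: R_def)
      have step: "v \<in> R" if "u \<in> R" "v \<in> V - X" "E u v" for u v
      proof -
        have "restr E (V - X) u v" using that RV by (auto simp: restr_def)
        then show ?thesis using that unfolding R_def
          by (auto intro: rtranclp.rtrancl_into_rtrancl)
      qed
      have "is_sep V E (R \<union> X) (V - R)"
        unfolding is_sep_def using X RV step by blast
      moreover have "(R \<union> X) \<inter> (V - R) = X" using X RV by blast
      ultimately have "R \<union> X \<subseteq> V - R \<or> V - R \<subseteq> R \<union> X" using sep X by metis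
      then have "y \<in> R" using xR xy by blast
      then show ?thesis by (simp add: R_def)
    qed
    ultimately show ?thesis unfolding connected_set_def by blast
  qed
  then show ?thesis using g V unfolding k_connected_def by blast
qed

lemma k_connected_graph: "k_connected V E k \<Longrightarrow> graph V E"
  unfolding k_connected_def by blast

lemma k_connected_card: "k_connected V E k \<Longrightarrow> k < card V"
  unfolding k_connected_def by blast

section \<open>Cycles and claws\<close>

lemma has_cycle_mono:
  assumes "has_cycle E A" "A \<subseteq> A'" "\<And>x y. x \<in> A \<Longrightarrow> y \<in> A \<Longrightarrow> E x y \<Longrightarrow> F x y"
  shows "has_cycle F A'"
proof -
  obtain xs where xs: "length xs \<ge> 3" "distinct xs" "set xs \<subseteq> A"
    "\<forall>i < length xs. E (xs ! i) (xs ! ((i + 1) mod length xs))"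
    using assms(1) unfolding has_cycle_def by blast
  have "F (xs ! i) (xs ! ((i + 1) mod length xs))" if "i < length xs" for i
  proof -
    have "(i + 1) mod length xs < length xs" using that by (intro mod_less_divisor) auto
    then show ?thesis using xs that assms(3) nth_mem by blast
  qed
  then show ?thesis unfolding has_cycle_def using xs assms(2) by blast
qed

lemma triangle_has_cycle:
  assumes "E x y" "E y z" "E z x" "x \<noteq> y" "y \<noteq> z" "z \<noteq> x" "{x, y, z} \<subseteq> A"
  shows "has_cycle E A"
proof -
  have "E ([x, y, z] ! i) ([x, y, z] ! ((i + 1) mod length [x, y, z]))"
    if "i < length [x, y, z]" for i
  proof -
    have "i = 0 \<or> i = 1 \<or> i = 2" using that by auto
    then show ?thesis using assms(1-3) by auto
  qed
  moreover have "length [x, y, z] \<ge> 3" "distinct [x, y, z]" "set [x, y, z] \<subseteq> A"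
    using assms by auto
  ultimately show ?thesis unfolding has_cycle_def by blast
qed

lemma clique_has_cycle:
  assumes "card T = 3" "T \<subseteq> A" "\<And>x y. x \<in> T \<Longrightarrow> y \<in> T \<Longrightarrow> x \<noteq> y \<Longrightarrow> E x y"
  shows "has_cycle E A"
proof -
  obtain x y z where T: "T = {x, y, z}" "x \<noteq> y" "y \<noteq> z" "z \<noteq> x"
    using assms(1) by (auto simp: card_3_iff)
  show ?thesis by (rule triangle_has_cycle[of _ x y z]) (use T assms in auto)
qed

lemma has_cycle_neighbours:
  assumes xs: "length xs \<ge> 3" "distinct xs"
    "\<forall>i < length xs. E (xs ! i) (xs ! ((i + 1) mod length xs))"
    and sym: "\<And>x y. E x y \<Longrightarrow> E y x" and x: "x \<in> set xs"
  shows "\<exists>y\<in>set xs. \<exists>z\<in>set xs. y \<noteq> z \<and> E x y \<and> E x z"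
proof -
  let ?n = "length xs"
  obtain i where i: "i < ?n" "xs ! i = x" using x by (auto simp: in_set_conv_nth)
  define j where "j = (i + 1) mod ?n"
  define k where "k = (if i = 0 then ?n - 1 else i - 1)"
  have j: "j = (if i + 1 = ?n then 0 else i + 1)" using i by (auto simp: j_def)
  \<comment> \<open>Successor and predecessor on the cycle differ because its length is at least
    three.\<close>
  have jn: "j < ?n" "k < ?n" "j \<noteq> k" using i xs(1) unfolding k_def j by (auto split: if_splits)
  have "(k + 1) mod ?n = i" using i xs(1) by (auto simp: k_def)
  then have "E (xs ! k) x" using xs(3) jn i by metis
  moreover have "E x (xs ! j)" using xs(3) i unfolding j_def by metis
  moreover have "xs ! j \<noteq> xs ! k" using jn xs(2) by (simp add: nth_eq_iff_index_eq)
  ultimately show ?thesis using jn sym by (meson nth_mem)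
qed

text \<open>A vertex on a cycle has two neighbours there, so \<open>t\<close> lies on none in
  \<open>A\<close>.\<close>

lemma has_cycle_remove:
  assumes c: "has_cycle E A" and sym: "\<And>x y. E x y \<Longrightarrow> E y x"
    and t: "\<And>y. y \<in> A \<Longrightarrow> E t y \<Longrightarrow> y = s"
  shows "has_cycle E (A - {t})"
proof -
  obtain xs where xs: "length xs \<ge> 3" "distinct xs" "set xs \<subseteq> A"
    "\<forall>i < length xs. E (xs ! i) (xs ! ((i + 1) mod length xs))"
    using c unfolding has_cycle_def by blast
  have "t \<notin> set xs"
    using has_cycle_neighbours[OF xs(1,2,4) sym] t xs(3) by blast
  then have "set xs \<subseteq> A - {t}" using xs by blast
  then show ?thesis unfolding has_cycle_def using xs by blast
qed

text \<open>The cycle uses all three vertices. If \<open>x\<close> and \<open>y\<close> were not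
  adjacent, the two cycle neighbours of \<open>x\<close> would make four vertices in
  \<open>A\<close>.\<close>

lemma has_cycle_card3:
  assumes c: "has_cycle E A" and A: "card A = 3" and sym: "\<And>x y. E x y \<Longrightarrow> E y x"
    and irr: "\<And>x. \<not> E x x" and x: "x \<in> A" "y \<in> A" "x \<noteq> y"
  shows "E x y"
proof -
  obtain xs where xs: "length xs \<ge> 3" "distinct xs" "set xs \<subseteq> A"
    "\<forall>i < length xs. E (xs ! i) (xs ! ((i + 1) mod length xs))"
    using c unfolding has_cycle_def by blast
  have f: "finite A" using A by (metis card.infinite zero_neq_numeral)
  have "card (set xs) = length xs" using xs(2) by (rule distinct_card)
  then have "set xs = A" using xs A f by (metis card_seteq)
  then obtain u v where uv: "u \<in> A" "v \<in> A" "u \<noteq> v" "E x u" "E x v"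
    using has_cycle_neighbours[OF xs(1,2,4) sym] x by metis
  show ?thesis
  proof (rule ccontr)
    assume n: "\<not> E x y"
    then have uy: "u \<noteq> y" "v \<noteq> y" using uv by auto
    have "u \<noteq> x" "v \<noteq> x" using uv irr by auto
    then have "card {x, y, u, v} = 4" using uy uv x by simp
    moreover have "{x, y, u, v} \<subseteq> A" using uv x by simp
    ultimately show False using card_mono[OF f, of "{x, y, u, v}"] A by simp
  qed
qed

text \<open>On a longest path all neighbours of the first vertex lie on the path, and a neighbour
  other than the second vertex closes a cycle.\<close>

lemma min_degree_two_has_cycle:
  assumes fin: "finite W" and ne: "W \<noteq> {}" and sym: "\<And>x y. E x y \<Longrightarrow> E y x"
    and irr: "\<And>x. \<not> E x x"
    and deg: "\<And>x. x \<in> W \<Longrightarrow> 2 \<le> card {y \<in> W. E x y}"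
  shows "has_cycle E W"
proof -
  define P where "P = (\<lambda>xs. distinct xs \<and> xs \<noteq> [] \<and> set xs \<subseteq> W \<and>
    (\<forall>i. Suc i < length xs \<longrightarrow> E (xs ! i) (xs ! Suc i)))"
  obtain w where "w \<in> W" using ne by blast
  then have "P [w]" by (simp add: P_def)
  moreover have "\<forall>xs. P xs \<longrightarrow> length xs < Suc (card W)"
    unfolding P_def using fin by (metis card_mono distinct_card le_imp_less_Suc)
  ultimately obtain xs where xs: "P xs" "\<And>ys. P ys \<Longrightarrow> length ys \<le> length xs"
    using ex_has_greatest_nat[of P "[w]" length "Suc (card W)"] by (metis less_imp_le)
  define x where "x = hd xs"
  have x: "x \<in> W" "xs ! 0 = x" using xs(1) unfolding P_def x_def by (auto simp: hd_conv_nth)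
  have nb: "y \<in> set xs" if y: "y \<in> W" "E x y" for y
  proof (rule ccontr)
    assume "y \<notin> set xs"
    then have "P (y # xs)" using xs(1) y sym x(2) unfolding P_def
      by (auto simp: nth_Cons split: nat.splits)
    then show False using xs(2) by fastforce
  qed
  \<comment> \<open>For a path with one vertex \<open>xs ! 1\<close> is unspecified. This does no
    harm: \<open>y\<close> would then have index \<open>0\<close> and equal
    \<open>x\<close>.\<close>
  have "\<exists>y\<in>{y \<in> W. E x y}. y \<noteq> xs ! 1"
  proof (rule ccontr)
    assume "\<not> ?thesis"
    then have "{y \<in> W. E x y} \<subseteq> {xs ! 1}" by blast
    then have "card {y \<in> W. E x y} \<le> 1" using card_mono[of "{xs ! 1}"] by fastforce
    then show False using deg[OF x(1)] by simp
  qed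
  then obtain y where y: "y \<in> W" "E x y" "y \<noteq> xs ! 1" by blast
  then obtain k where k: "k < length xs" "xs ! k = y" using nb by (metis in_set_conv_nth)
  have k2: "k \<ge> 2"
  proof (rule ccontr)
    assume "\<not> k \<ge> 2"
    then have "k = 0 \<or> k = 1" by linarith
    then show False using y k x irr by auto
  qed
  let ?ys = "take (Suc k) xs"
  have l: "length ?ys = Suc k" using k by simp
  have "E (?ys ! i) (?ys ! ((i + 1) mod length ?ys))" if i: "i < length ?ys" for i
  proof (cases "i = k")
    case True
    then show ?thesis using l k x y sym by simp
  next
    case False
    then have "i < k" using i l by simp
    then show ?thesis using l k xs(1) unfolding P_def by simp
  qed
  moreover have "distinct ?ys" "set ?ys \<subseteq> W"
    using xs(1) unfolding P_def by (auto dest: in_set_takeD)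
  ultimately show ?thesis unfolding has_cycle_def using l k2
    by (intro exI[of _ ?ys]) auto
qed

text \<open>The bound of \<open>card W - 1\<close> on the edges of a forest, as a degree sum so that
  no edge set is needed. Deleting a vertex of degree at most one lowers the sum by twice its
  degree.\<close>

lemma forest_degree_sum:
  assumes "finite W" "W \<noteq> {}" and sym: "\<And>x y. E x y \<Longrightarrow> E y x"
    and irr: "\<And>x. \<not> E x x" and "\<not> has_cycle E W"
  shows "(\<Sum>x\<in>W. card {y \<in> W. E x y}) + 2 \<le> 2 * card W"
  using assms(1,2,5)
proof (induction "card W" arbitrary: W rule: less_induct)
  case less
  obtain x where x: "x \<in> W" "card {y \<in> W. E x y} < 2"
    using min_degree_two_has_cycle[of W E] less.prems sym irr by (metis not_less)
  let ?W = "W - {x}"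
  have cW: "card W = Suc (card ?W)" using x less.prems by (metis card_Suc_Diff1)
  show ?case
  proof (cases "?W = {}")
    case True
    then have "W = {x}" using x by blast
    then show ?thesis using irr by simp
  next
    case False
    have "\<not> has_cycle E ?W" using less.prems(3) has_cycle_mono[of E ?W W E] by blast
    then have IH: "(\<Sum>z\<in>?W. card {y \<in> ?W. E z y}) + 2 \<le> 2 * card ?W"
      using less.hyps[of ?W] cW False less.prems by simp
    have "card {y \<in> W. E z y} = card {y \<in> ?W. E z y} + (if E x z then 1 else 0)"
      if "z \<in> ?W" for z
    proof (cases "E x z")
      case True
      then have "{y \<in> W. E z y} = insert x {y \<in> ?W. E z y}" using sym x by auto
      then show ?thesis using True less.prems(1) by simp
    next
      case False
      then have "{y \<in> W. E z y} = {y \<in> ?W. E z y}" using sym by blast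
      then show ?thesis using False by simp
    qed
    then have "(\<Sum>z\<in>?W. card {y \<in> W. E z y})
        = (\<Sum>z\<in>?W. card {y \<in> ?W. E z y}) + (\<Sum>z\<in>?W. if E x z then 1 else 0)"
      by (simp add: sum.distrib)
    also have "(\<Sum>z\<in>?W. if E x z then 1 else 0) = card {z \<in> ?W. E x z}"
      using sum.inter_filter[of ?W "\<lambda>_. 1::nat" "E x"] less.prems(1) by simp
    also have "{z \<in> ?W. E x z} = {y \<in> W. E x y}" using irr by blast
    finally have "(\<Sum>z\<in>?W. card {y \<in> W. E z y})
        = (\<Sum>z\<in>?W. card {y \<in> ?W. E z y}) + card {y \<in> W. E x y}" .
    moreover have "(\<Sum>z\<in>W. card {y \<in> W. E z y})
        = card {y \<in> W. E x y} + (\<Sum>z\<in>?W. card {y \<in> W. E z y})"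
      using less.prems(1) x(1) by (rule sum.remove)
    ultimately show ?thesis using IH x(2) cW by linarith
  qed
qed

text \<open>Inner vertices of an acyclic side have degree at least three and separator vertices have
  degree at least one in it, so counting the edges of a forest leaves room for one inner vertex.\<close>

lemma acyclic_side_claw:
  assumes k: "k_connected V E 3" and s: "is_sep V E A B" and c: "card (A \<inter> B) = 3"
    and p: "A - B \<noteq> {}" "B - A \<noteq> {}" and nc: "\<not> has_cycle E A"
  obtains v where "A - B = {v}" "\<And>x. x \<in> A \<inter> B \<Longrightarrow> E v x"
    "\<And>x y. x \<in> A \<inter> B \<Longrightarrow> y \<in> A \<inter> B \<Longrightarrow> \<not> E x y"
proof -
  have g: "graph V E" and V3: "3 < card V"
    using k by (auto intro: k_connected_graph k_connected_card)
  note gD = graphD[OF g]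
  have AV: "A \<union> B = V" using s by (rule is_sep_Un)
  then have fA: "finite A" using gD(1) by auto
  have irr: "\<not> E x x" for x using gD(4) by blast
  \<comment> \<open>Fewer than three neighbours would separate \<open>v\<close> from a remaining
    vertex, as \<open>V\<close> has more than three.\<close>
  have deg3: "3 \<le> card {y \<in> A. E v y}" if v: "v \<in> A - B" for v
  proof (rule ccontr)
    let ?N = "{y \<in> A. E v y}"
    assume n: "\<not> 3 \<le> card ?N"
    have N: "E v y \<longleftrightarrow> y \<in> ?N" for y using is_sep_edge[OF g s] v by blast
    have "is_sep V E (insert v ?N) (V - {v})"
      unfolding is_sep_def using N AV v by blast
    moreover have "insert v ?N \<inter> (V - {v}) = ?N" using AV irr by auto
    ultimately have "insert v ?N \<subseteq> V - {v} \<or> V - {v} \<subseteq> insert v ?N"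
      using k_connectedD[OF k] n by (metis not_le)
    then have "V \<subseteq> insert v ?N" by blast
    then have "card V \<le> card (insert v ?N)" using fA by (intro card_mono) auto
    also have "\<dots> \<le> Suc (card ?N)" by (rule card_insert_le_m1) auto
    finally show False using V3 n by linarith
  qed
  \<comment> \<open>A separator vertex without neighbours in \<open>A\<close> could be dropped from
    \<open>A\<close>, leaving a separator of two vertices.\<close>
  have deg1: "1 \<le> card {y \<in> A. E x y}" if x: "x \<in> A \<inter> B" for x
  proof (rule ccontr)
    assume "\<not> ?thesis"
    then have "{y \<in> A. E x y} = {}" using fA by (simp add: not_le)
    then have N: "\<not> E x y" if "y \<in> A" for y using that by blast
    have "is_sep V E (A - {x}) B"
      using s N gD(5) x unfolding is_sep_def by blast
    moreover have "card ((A - {x}) \<inter> B) < 3"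
    proof -
      have "(A - {x}) \<inter> B = (A \<inter> B) - {x}" by blast
      then show ?thesis using c x by simp
    qed
    ultimately show False using k_connectedD[OF k] p x by blast
  qed
  have "(\<Sum>x\<in>A. card {y \<in> A. E x y}) + 2 \<le> 2 * card A"
    by (rule forest_degree_sum) (use fA p nc gD irr in auto)
  moreover have "(\<Sum>x\<in>A. card {y \<in> A. E x y})
      = (\<Sum>x\<in>A - B. card {y \<in> A. E x y}) + (\<Sum>x\<in>A \<inter> B. card {y \<in> A. E x y})"
    using sum.Int_Diff[OF fA, of "\<lambda>x. card {y \<in> A. E x y}" B] by (simp add: add.commute)
  moreover have "(\<Sum>x\<in>A - B. card {y \<in> A. E x y}) \<ge> 3 * card (A - B)"
    using sum_bounded_below[of "A - B" 3 "\<lambda>x. card {y \<in> A. E x y}"] deg3 by simp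
  moreover have "(\<Sum>x\<in>A \<inter> B. card {y \<in> A. E x y}) \<ge> card (A \<inter> B)"
    using sum_bounded_below[of "A \<inter> B" 1 "\<lambda>x. card {y \<in> A. E x y}"] deg1 by simp
  moreover have "card A = card (A - B) + card (A \<inter> B)"
    using card_Int_Diff[OF fA, of B] by simp
  \<comment> \<open>With \<open>n\<close> inner vertices the bounds read
    \<open>3 * n + 3 + 2 \<le> 2 * (n + 3)\<close>.\<close>
  ultimately have "card (A - B) \<le> 1" using c by linarith
  then obtain v where v: "A - B = {v}"
  proof -
    have "card (A - B) > 0" using p(1) fA by (simp add: card_gt_0_iff)
    then have "card (A - B) = 1" using \<open>card (A - B) \<le> 1\<close> by linarith
    then show ?thesis using that by (rule card_1_singletonE)
  qed
  have Ev: "E v x" if x: "x \<in> A \<inter> B" for x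
  proof -
    have "{y \<in> A. E v y} \<subseteq> A \<inter> B" using v irr[of v] by auto
    then have "{y \<in> A. E v y} = A \<inter> B"
      using deg3[of v] v c fA by (intro card_seteq) auto
    then show ?thesis using x by blast
  qed
  have "\<not> E x y" if xy: "x \<in> A \<inter> B" "y \<in> A \<inter> B" for x y
  proof
    assume e: "E x y"
    have "has_cycle E A"
      by (rule triangle_has_cycle[of E v x y]) (use e xy Ev gD v in auto)
    then show False using nc by blast
  qed
  then show thesis using that v Ev by blast
qed

section \<open>Profiles of order four and their restriction to torsos\<close>

text \<open>A 4-tangle need not induce a 4-tangle on the torso of a separation it orients, since the three
  edges of the new triangle can be covered by three different small sides (this is the cubic case).
  The following weakening of tangles does survive.\<close>

definition profile4 :: "'a set \<Rightarrow> ('a \<Rightarrow> 'a \<Rightarrow> bool) \<Rightarrow> ('a set \<times> 'a set) set \<Rightarrow> bool" where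
  "profile4 V E \<tau> \<longleftrightarrow>
     (\<forall>A B. (A, B) \<in> \<tau> \<longrightarrow> is_sep V E A B \<and> card (A \<inter> B) < 4) \<and>
     (\<forall>A B. is_sep V E A B \<and> card (A \<inter> B) < 4 \<longrightarrow> (A, B) \<in> \<tau> \<or> (B, A) \<in> \<tau>) \<and>
     (\<forall>A B C D. (A, B) \<in> \<tau> \<and> (C, D) \<in> \<tau> \<longrightarrow> (B \<inter> D, A \<union> C) \<notin> \<tau>) \<and>
     (\<forall>X. (V, X) \<notin> \<tau>)"

text \<open>The torso of the single separation \<open>{A, B}\<close>. Both ends lie in
  \<open>B\<close>, so membership in \<open>A\<close> already means membership in the
  separator.\<close>

definition chop :: "('a \<Rightarrow> 'a \<Rightarrow> bool) \<Rightarrow> 'a set \<Rightarrow> 'a set \<Rightarrow> 'a \<Rightarrow> 'a \<Rightarrow> bool" where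
  "chop E A B = (\<lambda>x y. x \<in> B \<and> y \<in> B \<and> x \<noteq> y \<and> (E x y \<or> x \<in> A \<and> y \<in> A))"

text \<open>The clique on the old separator lies in \<open>X\<close> or in \<open>Y\<close>;
  \<open>A\<close> is restored on that side and \<open>\<tau>\<close> decides. If the clique lies in
  both, either lift may be the witness, and \<open>induced_lift1\<close> and
  \<open>induced_lift2\<close> show that they agree.\<close>

definition induced :: "('a \<Rightarrow> 'a \<Rightarrow> bool) \<Rightarrow> ('a set \<times> 'a set) set \<Rightarrow> 'a set \<Rightarrow> 'a set \<Rightarrow> ('a set \<times> 'a set) set"
  where "induced E \<tau> A B = {(X, Y). is_sep B (chop E A B) X Y \<and> card (X \<inter> Y) < 4 \<and>
     (A \<inter> B \<subseteq> X \<and> (X \<union> A, Y) \<in> \<tau> \<or> A \<inter> B \<subseteq> Y \<and> (X, Y \<union> A) \<in> \<tau>)}"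

section \<open>Calculus of profiles\<close>

lemma profile4D:
  assumes "profile4 V E \<tau>"
  shows "(A, B) \<in> \<tau> \<Longrightarrow> is_sep V E A B" "(A, B) \<in> \<tau> \<Longrightarrow> card (A \<inter> B) < 4"
    "is_sep V E A B \<Longrightarrow> card (A \<inter> B) < 4 \<Longrightarrow> (A, B) \<in> \<tau> \<or> (B, A) \<in> \<tau>"
    "(A, B) \<in> \<tau> \<Longrightarrow> (C, D) \<in> \<tau> \<Longrightarrow> (B \<inter> D, A \<union> C) \<notin> \<tau>"
    "(V, X) \<notin> \<tau>"
  using assms unfolding profile4_def by blast+

lemma profile4_antisym:
  assumes "profile4 V E \<tau>" "(A, B) \<in> \<tau>"
  shows "(B, A) \<notin> \<tau>"
  using profile4D(4)[OF assms(1,2,2)] by simp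

lemma profile4_small:
  assumes "profile4 V E \<tau>" "X \<subseteq> V" "card X < 4"
  shows "(X, V) \<in> \<tau>"
  using profile4D(3)[OF assms(1) is_sep_trivial(1)[OF assms(2)]] assms profile4D(5)[OF assms(1)]
  by (metis inf.absorb1)

lemma profile4_union:
  assumes p: "profile4 V E \<tau>" and g: "graph V E" and t: "(A, B) \<in> \<tau>" "(C, D) \<in> \<tau>"
    and c: "card ((A \<union> C) \<inter> (B \<inter> D)) < 4"
  shows "(A \<union> C, B \<inter> D) \<in> \<tau>"
  using profile4D(3)[OF p is_sep_corner(1)[OF g profile4D(1)[OF p t(1)] profile4D(1)[OF p t(2)]] c]
    profile4D(4)[OF p t] by blast

text \<open>If the small sides cover \<open>V\<close>, the separator of their union is just
  \<open>B \<inter> D\<close>; its order is below four, so \<open>V\<close> itself would be a small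
  side.\<close>

lemma profile4_no_cover:
  assumes p: "profile4 V E \<tau>" and g: "graph V E" and t: "(A, B) \<in> \<tau>" "(C, D) \<in> \<tau>"
    and c: "card (B \<inter> D) < 4"
  shows "A \<union> C \<noteq> V"
proof
  assume V: "A \<union> C = V"
  have "B \<inter> D \<subseteq> V" using is_sep_subset[OF profile4D(1)[OF p t(1)]] by blast
  then have "(A \<union> C) \<inter> (B \<inter> D) = B \<inter> D" using V by blast
  then have "(A \<union> C, B \<inter> D) \<in> \<tau>" using profile4_union[OF p g t] c by simp
  then show False using V profile4D(5)[OF p] by simp
qed

text \<open>Carries an orientation over to a separation that need not be comparable: a small side
  \<open>Q'\<close> would cover \<open>V\<close> together with \<open>P\<close>.\<close>

lemma profile4_switch:
  assumes p: "profile4 V E \<tau>" and g: "graph V E" and t: "(P, Q) \<in> \<tau>"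
    and s: "is_sep V E P' Q'" "card (P' \<inter> Q') < 4" and u: "P \<union> Q' = V" and c: "card (Q \<inter> P') < 4"
  shows "(P', Q') \<in> \<tau>"
  using profile4D(3)[OF p s] profile4_no_cover[OF p g t _ c] u by blast

lemma profile4_down:
  assumes p: "profile4 V E \<tau>" and g: "graph V E" and t: "(P, Q) \<in> \<tau>"
    and s: "is_sep V E P' Q'" "card (P' \<inter> Q') < 4" and le: "P' \<subseteq> P" "Q \<subseteq> Q'"
  shows "(P', Q') \<in> \<tau>"
proof (rule profile4_switch[OF p g t s])
  have sep: "is_sep V E P Q" by (rule profile4D(1)[OF p t])
  then show "P \<union> Q' = V" using le is_sep_subset[OF s(1)] unfolding is_sep_def by blast
  have "finite (P' \<inter> Q')" using is_sep_subset[OF s(1)] graphD(1)[OF g] by (meson finite_Int finite_subset)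
  moreover have "Q \<inter> P' \<subseteq> P' \<inter> Q'" using le by blast
  ultimately show "card (Q \<inter> P') < 4" using card_mono s(2) by (meson le_less_trans)
qed

text \<open>A profile cannot be enlarged, since it already orients every separation of order below
  four. Thus \<open>chop_supset\<close> and \<open>chop_nested_commute\<close> compare two induced
  profiles by one inclusion.\<close>

lemma profile4_eqI:
  assumes p: "profile4 V E \<tau>" "profile4 V E \<tau>'" and le: "\<tau> \<subseteq> \<tau>'"
  shows "\<tau> = \<tau>'"
proof -
  have "(X, Y) \<in> \<tau>" if xy: "(X, Y) \<in> \<tau>'" for X Y
    using profile4D(3)[OF p(1) profile4D(1,2)[OF p(2) xy]] profile4_antisym[OF p(2) xy] le by blast
  then show ?thesis using le by auto
qed

lemma profile4_big_side:
  assumes "profile4 V E \<tau>" "(A, B) \<in> \<tau>"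
  shows "B - A \<noteq> {}"
proof
  assume "B - A = {}"
  then have "A = V" using is_sep_Un[OF profile4D(1)[OF assms]] by blast
  then show False using assms profile4D(5) by metis
qed

section \<open>The torso of one separation and its profile\<close>

lemma graph_chop:
  assumes "graph V E" "B \<subseteq> V"
  shows "graph B (chop E A B)"
  using assms finite_subset unfolding graph_def chop_def by blast

lemma chop_clique:
  assumes "is_sep B (chop E A B) X Y"
  shows "A \<inter> B \<subseteq> X \<or> A \<inter> B \<subseteq> Y"
proof (rule ccontr)
  assume "\<not> ?thesis"
  then obtain x y where "x \<in> A \<inter> B" "x \<notin> X" "y \<in> A \<inter> B" "y \<notin> Y" by blast
  moreover from this have "chop E A B y x" using assms unfolding chop_def is_sep_def by blast
  ultimately show False using assms unfolding is_sep_def by blast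
qed

lemma chop_lift:
  assumes s: "is_sep V E A B" and t: "is_sep B (chop E A B) X Y" and c: "A \<inter> B \<subseteq> X"
  shows "is_sep V E (X \<union> A) Y" "(X \<union> A) \<inter> Y = X \<inter> Y"
  using assms unfolding is_sep_def chop_def by blast+

lemma chop_lift':
  assumes g: "graph V E" and s: "is_sep V E A B" and t: "is_sep B (chop E A B) X Y"
    and c: "A \<inter> B \<subseteq> Y"
  shows "is_sep V E X (Y \<union> A)" "X \<inter> (Y \<union> A) = X \<inter> Y"
proof -
  have "is_sep B (chop E A B) Y X"
    by (rule is_sep_sym[OF graph_chop[OF g] t]) (use is_sep_subset[OF s] in blast)
  from chop_lift[OF s this c] show "is_sep V E X (Y \<union> A)" "X \<inter> (Y \<union> A) = X \<inter> Y"
    using is_sep_sym[OF g] by blast+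
qed

text \<open>Any separation of the torso has the new clique on one side; restoring \<open>A\<close>
  there gives a separation of \<open>V\<close> with the same separator.\<close>

lemma k_connected_chop:
  assumes k: "k_connected V E 3" and s: "is_sep V E A B" and c: "card (A \<inter> B) = 3"
    and p: "B - A \<noteq> {}"
  shows "k_connected B (chop E A B) 3"
proof (rule k_connectedI)
  have g: "graph V E" by (rule k_connected_graph[OF k])
  have BV: "B \<subseteq> V" using is_sep_subset[OF s] by blast
  then have fB: "finite B" using graphD(1)[OF g] finite_subset by blast
  show "graph B (chop E A B)" by (rule graph_chop[OF g BV])
  have "A \<inter> B \<subset> B" using p by blast
  then show "3 < card B" using psubset_card_mono[OF fB] c by metis
  fix X Y assume xy: "is_sep B (chop E A B) X Y" "card (X \<inter> Y) < 3"
  from chop_clique[OF xy(1)] show "X \<subseteq> Y \<or> Y \<subseteq> X"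
  proof
    assume "A \<inter> B \<subseteq> X"
    from chop_lift[OF s xy(1) this] k_connectedD[OF k] xy(2)
    have "X \<union> A \<subseteq> Y \<or> Y \<subseteq> X \<union> A" by metis
    then show ?thesis using \<open>A \<inter> B \<subseteq> X\<close> is_sep_subset[OF xy(1)] by blast
  next
    assume "A \<inter> B \<subseteq> Y"
    from chop_lift'[OF g s xy(1) this] k_connectedD[OF k] xy(2)
    have "X \<subseteq> Y \<union> A \<or> Y \<union> A \<subseteq> X" by metis
    then show ?thesis using \<open>A \<inter> B \<subseteq> Y\<close> is_sep_subset[OF xy(1)] by blast
  qed
qed

lemma induced_sep: "(X, Y) \<in> induced E \<tau> A B \<Longrightarrow> is_sep B (chop E A B) X Y"
  and induced_card: "(X, Y) \<in> induced E \<tau> A B \<Longrightarrow> card (X \<inter> Y) < 4"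
  unfolding induced_def by blast+

lemma inducedI:
  assumes "is_sep B (chop E A B) X Y" "card (X \<inter> Y) < 4"
    and "A \<inter> B \<subseteq> X \<Longrightarrow> (X \<union> A, Y) \<in> \<tau>" "A \<inter> B \<subseteq> Y \<Longrightarrow> (X, Y \<union> A) \<in> \<tau>"
  shows "(X, Y) \<in> induced E \<tau> A B"
  using chop_clique[OF assms(1)] assms unfolding induced_def by blast

lemma inducedI1:
  assumes "is_sep B (chop E A B) X Y" "card (X \<inter> Y) < 4" "A \<inter> B \<subseteq> X" "(X \<union> A, Y) \<in> \<tau>"
  shows "(X, Y) \<in> induced E \<tau> A B"
  using assms unfolding induced_def by blast

lemma inducedI2:
  assumes "is_sep B (chop E A B) X Y" "card (X \<inter> Y) < 4" "A \<inter> B \<subseteq> Y" "(X, Y \<union> A) \<in> \<tau>"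
  shows "(X, Y) \<in> induced E \<tau> A B"
  using assms unfolding induced_def by blast

text \<open>If \<open>Y\<close> contains the separator too, membership may come from the lift with
  \<open>A\<close> on the other side. The reverse of the wanted lift would then violate consistency
  with \<open>(A, B)\<close>.\<close>

lemma induced_lift1:
  assumes p: "profile4 V E \<tau>" and g: "graph V E" and t: "(A, B) \<in> \<tau>"
    and i: "(X, Y) \<in> induced E \<tau> A B" and c: "A \<inter> B \<subseteq> X"
  shows "(X \<union> A, Y) \<in> \<tau>"
proof (rule ccontr)
  assume n: "(X \<union> A, Y) \<notin> \<tau>"
  have s: "is_sep V E A B" by (rule profile4D(1)[OF p t])
  have xy: "A \<inter> B \<subseteq> Y" "(X, Y \<union> A) \<in> \<tau>" using i n c unfolding induced_def by blast+
  have "(Y, X \<union> A) \<in> \<tau>"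
    using profile4D(3)[OF p] chop_lift[OF s induced_sep[OF i] c] induced_card[OF i] n by metis
  moreover have "(B \<inter> (Y \<union> A), A \<union> X) \<notin> \<tau>" by (rule profile4D(4)[OF p t xy(2)])
  moreover have "B \<inter> (Y \<union> A) = Y" using xy(1) is_sep_subset[OF induced_sep[OF i]] by blast
  ultimately show False by (metis Un_commute)
qed

text \<open>In the ambiguous case the given lift and the reverse of the wanted one would be two
  small sides covering \<open>V\<close>.\<close>

lemma induced_lift2:
  assumes p: "profile4 V E \<tau>" and g: "graph V E" and t: "(A, B) \<in> \<tau>"
    and i: "(X, Y) \<in> induced E \<tau> A B" and c: "A \<inter> B \<subseteq> Y"
  shows "(X, Y \<union> A) \<in> \<tau>"
proof (rule ccontr)
  assume n: "(X, Y \<union> A) \<notin> \<tau>"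
  have s: "is_sep V E A B" by (rule profile4D(1)[OF p t])
  have xy: "A \<inter> B \<subseteq> X" "(X \<union> A, Y) \<in> \<tau>" using i n c unfolding induced_def by blast+
  have "(Y \<union> A, X) \<in> \<tau>"
    using profile4D(3)[OF p] chop_lift'[OF g s induced_sep[OF i] c] induced_card[OF i] n by metis
  moreover have "X \<union> A \<union> (Y \<union> A) = V"
    using is_sep_Un[OF induced_sep[OF i]] is_sep_Un[OF s] by blast
  moreover have "card (Y \<inter> X) < 4" using induced_card[OF i] by (simp add: Int_commute)
  ultimately show False using profile4_no_cover[OF p g xy(2)] by blast
qed

text \<open>The three separations in the consistency axiom are lifted according to the position of
  the clique. The cases check that the lifts again form a triple forbidden for
  \<open>\<tau>\<close>.\<close>

lemma profile4_induced:
  assumes p: "profile4 V E \<tau>" and g: "graph V E" and t: "(A, B) \<in> \<tau>"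
  shows "profile4 B (chop E A B) (induced E \<tau> A B)"
proof -
  let ?F = "chop E A B" and ?\<rho> = "induced E \<tau> A B"
  have s: "is_sep V E A B" by (rule profile4D(1)[OF p t])
  note V = is_sep_Un[OF s]
  note L1 = induced_lift1[OF p g t] and L2 = induced_lift2[OF p g t]
  have gF: "graph B ?F" using graph_chop[OF g] is_sep_subset[OF s] by blast
  have orient: "(X, Y) \<in> ?\<rho> \<or> (Y, X) \<in> ?\<rho>" if xy: "is_sep B ?F X Y" "card (X \<inter> Y) < 4" for X Y
  proof -
    have yx: "is_sep B ?F Y X" "card (Y \<inter> X) < 4"
      using is_sep_sym[OF gF xy(1)] xy(2) by (simp_all add: Int_commute)
    from chop_clique[OF xy(1)] show ?thesis
    proof
      assume c: "A \<inter> B \<subseteq> X"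
      have "(X \<union> A, Y) \<in> \<tau> \<or> (Y, X \<union> A) \<in> \<tau>"
        using profile4D(3)[OF p] chop_lift[OF s xy(1) c] xy(2) by metis
      then show ?thesis using inducedI1[OF xy c] inducedI2[OF yx c] by blast
    next
      assume c: "A \<inter> B \<subseteq> Y"
      have "(X, Y \<union> A) \<in> \<tau> \<or> (Y \<union> A, X) \<in> \<tau>"
        using profile4D(3)[OF p] chop_lift'[OF g s xy(1) c] xy(2) by metis
      then show ?thesis using inducedI2[OF xy c] inducedI1[OF yx c] by blast
    qed
  qed
  have consistent: "(Y1 \<inter> Y2, X1 \<union> X2) \<notin> ?\<rho>" if xy: "(X1, Y1) \<in> ?\<rho>" "(X2, Y2) \<in> ?\<rho>" for X1 Y1 X2 Y2
  proof
    assume u: "(Y1 \<inter> Y2, X1 \<union> X2) \<in> ?\<rho>"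
    have sub: "X1 \<subseteq> B" "Y1 \<subseteq> B" "X2 \<subseteq> B" "Y2 \<subseteq> B"
      using is_sep_subset[OF induced_sep[OF xy(1)]] is_sep_subset[OF induced_sep[OF xy(2)]] by auto
    note C1 = chop_clique[OF induced_sep[OF xy(1)]] and C2 = chop_clique[OF induced_sep[OF xy(2)]]
    show False
    proof (cases "A \<inter> B \<subseteq> X1 \<or> A \<inter> B \<subseteq> X2")
      case False
      then have c: "A \<inter> B \<subseteq> Y1" "A \<inter> B \<subseteq> Y2" using C1 C2 by auto
      have "((Y1 \<inter> Y2) \<union> A, X1 \<union> X2) \<in> \<tau>" using L1[OF u] c by blast
      moreover have "((Y1 \<union> A) \<inter> (Y2 \<union> A), X1 \<union> X2) \<notin> \<tau>"
        by (rule profile4D(4)[OF p L2[OF xy(1) c(1)] L2[OF xy(2) c(2)]])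
      moreover have "(Y1 \<union> A) \<inter> (Y2 \<union> A) = (Y1 \<inter> Y2) \<union> A" by blast
      ultimately show False by simp
    next
      case True
      \<comment> \<open>From here on the clique lies in the union, so the third separation lifts
        with \<open>A\<close> on its big side.\<close>
      then have u': "(Y1 \<inter> Y2, X1 \<union> X2 \<union> A) \<in> \<tau>" using L2[OF u] by blast
      consider "A \<inter> B \<subseteq> X1" "A \<inter> B \<subseteq> X2" | "A \<inter> B \<subseteq> X1" "A \<inter> B \<subseteq> Y2"
        | "A \<inter> B \<subseteq> Y1" "A \<inter> B \<subseteq> X2" using True C1 C2 by blast
      then show False
      proof cases
        case 1
        have "(Y1 \<inter> Y2, X1 \<union> A \<union> (X2 \<union> A)) \<notin> \<tau>"
          by (rule profile4D(4)[OF p L1[OF xy(1) 1(1)] L1[OF xy(2) 1(2)]])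
        moreover have "X1 \<union> A \<union> (X2 \<union> A) = X1 \<union> X2 \<union> A" by blast
        ultimately show False using u' by simp
      next
        case 2
        have "(Y1 \<inter> (Y2 \<union> A), X1 \<union> A \<union> X2) \<notin> \<tau>"
          by (rule profile4D(4)[OF p L1[OF xy(1) 2(1)] L2[OF xy(2) 2(2)]])
        moreover have "X1 \<union> A \<union> X2 = X1 \<union> X2 \<union> A" by blast
        moreover have "Y1 \<inter> (Y2 \<union> A) = Y1 \<inter> Y2" using 2 sub by blast
        ultimately show False using u' by simp
      next
        case 3
        have "((Y1 \<union> A) \<inter> Y2, X1 \<union> (X2 \<union> A)) \<notin> \<tau>"
          by (rule profile4D(4)[OF p L2[OF xy(1) 3(1)] L1[OF xy(2) 3(2)]])
        moreover have "X1 \<union> (X2 \<union> A) = X1 \<union> X2 \<union> A" by blast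
        moreover have "(Y1 \<union> A) \<inter> Y2 = Y1 \<inter> Y2" using 3 sub by blast
        ultimately show False using u' by simp
      qed
    qed
  qed
  have "(B, X) \<notin> ?\<rho>" for X
  proof
    assume x: "(B, X) \<in> ?\<rho>"
    have "(B \<union> A, X) \<in> \<tau>" by (rule L1[OF x]) blast
    then show False using profile4D(5)[OF p] V by (metis Un_commute)
  qed
  then show ?thesis
    unfolding profile4_def using induced_sep induced_card orient consistent by blast
qed

lemma chop_trivial:
  assumes g: "graph V E" and A: "A \<subseteq> V" and c: "\<And>x y. x \<in> A \<Longrightarrow> y \<in> A \<Longrightarrow> x \<noteq> y \<Longrightarrow> E x y"
  shows "chop E A V = E"
proof (intro ext)
  show "chop E A V x y = E x y" for x y
    unfolding chop_def using c[of x y] graphD(2-4)[OF g, of x y] by blast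
qed

text \<open>A degenerate chop, with nothing inside and the triangle already present. It serves the
  edge crossing whose second side has shrunk to its separator.\<close>

lemma induced_trivial:
  assumes p: "profile4 V E \<tau>" and g: "graph V E" and A: "A \<subseteq> V"
    and c: "\<And>x y. x \<in> A \<Longrightarrow> y \<in> A \<Longrightarrow> x \<noteq> y \<Longrightarrow> E x y"
  shows "induced E \<tau> A V = \<tau>"
proof -
  have E: "chop E A V = E" by (rule chop_trivial[OF g A c])
  have "(X, Y) \<in> induced E \<tau> A V \<longleftrightarrow> (X, Y) \<in> \<tau>" for X Y
  proof
    assume "(X, Y) \<in> induced E \<tau> A V"
    then show "(X, Y) \<in> \<tau>"
      unfolding induced_def using A by (auto simp: Int_absorb2 Un_absorb2)
  next
    assume t: "(X, Y) \<in> \<tau>"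
    show "(X, Y) \<in> induced E \<tau> A V"
      by (rule inducedI)
        (use t A E profile4D(1,2)[OF p t] in \<open>auto simp: Int_absorb2 Un_absorb2\<close>)
  qed
  then show ?thesis by auto
qed

section \<open>Chopping to a normal form\<close>

text \<open>The condition \<open>A - B \<noteq> {}\<close> makes each chop remove a vertex, so
  \<open>card V\<close> is a termination measure. That \<open>B - A\<close> is non-empty follows
  from the profile.\<close>

definition choppable :: "('a \<Rightarrow> 'a \<Rightarrow> bool) \<Rightarrow> ('a set \<times> 'a set) set \<Rightarrow> 'a set \<Rightarrow> 'a set \<Rightarrow> bool" where
  "choppable E \<tau> A B \<longleftrightarrow> (A, B) \<in> \<tau> \<and> card (A \<inter> B) = 3 \<and> A - B \<noteq> {} \<and> has_cycle E A"

text \<open>Chops are prepended, so that the first steps of two reductions can be compared and the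
  induction continues in the smaller torso.\<close>

inductive chops_to :: "'a set \<Rightarrow> ('a \<Rightarrow> 'a \<Rightarrow> bool) \<Rightarrow> ('a set \<times> 'a set) set
    \<Rightarrow> 'a set \<Rightarrow> ('a \<Rightarrow> 'a \<Rightarrow> bool) \<Rightarrow> ('a set \<times> 'a set) set \<Rightarrow> bool" where
  refl: "chops_to V E \<tau> V E \<tau>"
| step: "choppable E \<tau> A B \<Longrightarrow> chops_to B (chop E A B) (induced E \<tau> A B) W F \<rho>
    \<Longrightarrow> chops_to V E \<tau> W F \<rho>"

definition normal :: "('a \<Rightarrow> 'a \<Rightarrow> bool) \<Rightarrow> ('a set \<times> 'a set) set \<Rightarrow> bool" where
  "normal E \<tau> \<longleftrightarrow> (\<nexists>A B. choppable E \<tau> A B)"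

lemma choppable_state:
  assumes "k_connected V E 3" "profile4 V E \<tau>" "choppable E \<tau> A B"
  shows "k_connected B (chop E A B) 3" "profile4 B (chop E A B) (induced E \<tau> A B)"
    "card B < card V"
proof -
  have t: "(A, B) \<in> \<tau>" "card (A \<inter> B) = 3" "A - B \<noteq> {}" using assms(3) unfolding choppable_def by auto
  have g: "graph V E" by (rule k_connected_graph[OF assms(1)])
  have s: "is_sep V E A B" by (rule profile4D(1)[OF assms(2) t(1)])
  show "k_connected B (chop E A B) 3"
    by (rule k_connected_chop[OF assms(1) s t(2) profile4_big_side[OF assms(2) t(1)]])
  show "profile4 B (chop E A B) (induced E \<tau> A B)" by (rule profile4_induced[OF assms(2) g t(1)])
  have "B \<subset> V" using is_sep_Un[OF s] t(3) by blast
  then show "card B < card V" using graphD(1)[OF g] by (rule psubset_card_mono[rotated])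
qed

lemma chops_to_state:
  assumes "chops_to V E \<tau> W F \<rho>" "k_connected V E 3" "profile4 V E \<tau>"
  shows "k_connected W F 3 \<and> profile4 W F \<rho>"
  using assms by (induction rule: chops_to.induct) (blast dest: choppable_state)+

lemma chops_to_trans:
  assumes "chops_to V E \<tau> W F \<rho>" "chops_to W F \<rho> W' F' \<rho>'"
  shows "chops_to V E \<tau> W' F' \<rho>'"
  using assms by (induction rule: chops_to.induct) (blast intro: chops_to.step)+

lemma chops_to_normal_exists:
  assumes "k_connected V E 3" "profile4 V E \<tau>"
  shows "\<exists>W F \<rho>. chops_to V E \<tau> W F \<rho> \<and> normal F \<rho>"
  using assms
proof (induction "card V" arbitrary: V E \<tau> rule: less_induct)
  case less
  show ?case
  proof (cases "normal E \<tau>")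
    case True
    then show ?thesis using chops_to.refl by blast
  next
    case False
    then obtain A B where c: "choppable E \<tau> A B" unfolding normal_def by blast
    note st = choppable_state[OF less.prems c]
    from less.hyps[OF st(3,1,2)] show ?thesis using chops_to.step[OF c] by blast
  qed
qed

lemma graph_iso_refl: "graph_iso V E V E"
  unfolding graph_iso_def by (intro exI[of _ id]) auto

lemma graph_iso_trans:
  assumes "graph_iso V E W F" "graph_iso W F X H"
  shows "graph_iso V E X H"
proof -
  obtain f where f: "bij_betw f V W" "\<forall>x\<in>V. \<forall>y\<in>V. E x y \<longleftrightarrow> F (f x) (f y)"
    using assms(1) unfolding graph_iso_def by blast
  obtain g where g: "bij_betw g W X" "\<forall>x\<in>W. \<forall>y\<in>W. F x y \<longleftrightarrow> H (g x) (g y)"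
    using assms(2) unfolding graph_iso_def by blast
  have "bij_betw (g \<circ> f) V X" by (rule bij_betw_trans[OF f(1) g(1)])
  moreover have "E x y \<longleftrightarrow> H ((g \<circ> f) x) ((g \<circ> f) y)" if "x \<in> V" "y \<in> V" for x y
    using that f g bij_betw_apply[OF f(1)] by simp
  ultimately show ?thesis unfolding graph_iso_def by blast
qed

subsection \<open>Relabelling along an involution\<close>

text \<open>This pulls back along \<open>\<pi>\<close>. For an involution pulling back and pushing
  forward coincide, so no inverse is carried along; the instance used is the exchange of two
  vertices.\<close>

definition relabel :: "('a \<Rightarrow> 'a) \<Rightarrow> ('a \<Rightarrow> 'a \<Rightarrow> bool) \<Rightarrow> 'a \<Rightarrow> 'a \<Rightarrow> bool" where
  "relabel \<pi> E = (\<lambda>x y. E (\<pi> x) (\<pi> y))"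

definition relabel_seps :: "('a \<Rightarrow> 'a) \<Rightarrow> ('a set \<times> 'a set) set \<Rightarrow> ('a set \<times> 'a set) set" where
  "relabel_seps \<pi> \<tau> = {(X, Y). (\<pi> ` X, \<pi> ` Y) \<in> \<tau>}"

context
  fixes \<pi> :: "'a \<Rightarrow> 'a"
  assumes inv: "\<And>x. \<pi> (\<pi> x) = x"
begin

lemma relabel_inj: "inj \<pi>"
  using inv by (metis injI)

lemma relabel_inj_on: "inj_on \<pi> X"
  using relabel_inj by (meson inj_on_subset subset_UNIV)

lemma relabel_image: "\<pi> ` \<pi> ` X = X"
  using inv by (simp add: image_image)

lemma relabel_mem: "x \<in> \<pi> ` X \<longleftrightarrow> \<pi> x \<in> X"
  using inv by (metis image_eqI imageE)

lemma is_sep_relabel: "is_sep (\<pi> ` V) (relabel \<pi> E) X Y \<longleftrightarrow> is_sep V E (\<pi> ` X) (\<pi> ` Y)"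
proof -
  have "X \<union> Y = \<pi> ` V \<longleftrightarrow> \<pi> ` X \<union> \<pi> ` Y = V"
    by (metis image_Un relabel_image)
  moreover have "(\<forall>x\<in>X - Y. \<forall>y\<in>Y - X. \<not> E (\<pi> x) (\<pi> y))
      \<longleftrightarrow> (\<forall>x\<in>\<pi> ` X - \<pi> ` Y. \<forall>y\<in>\<pi> ` Y - \<pi> ` X. \<not> E x y)"
    using relabel_mem inv by (auto simp: Ball_def) metis+
  ultimately show ?thesis unfolding is_sep_def relabel_def by blast
qed

lemma has_cycle_relabel:
  assumes "has_cycle E (\<pi> ` X)"
  shows "has_cycle (relabel \<pi> E) X"
proof -
  obtain xs where xs: "length xs \<ge> 3" "distinct xs" "set xs \<subseteq> \<pi> ` X"
    "\<forall>i < length xs. E (xs ! i) (xs ! ((i + 1) mod length xs))"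
    using assms unfolding has_cycle_def by blast
  let ?ys = "map \<pi> xs"
  have "distinct ?ys" using xs(2) relabel_inj_on by (simp add: distinct_map)
  moreover have "set ?ys \<subseteq> X" using xs(3) relabel_mem by auto
  moreover have "relabel \<pi> E (?ys ! i) (?ys ! ((i + 1) mod length ?ys))" if i: "i < length ?ys" for i
  proof -
    have "(i + 1) mod length xs < length xs" using i by (intro mod_less_divisor) auto
    then show ?thesis using xs(4) i inv unfolding relabel_def by simp
  qed
  ultimately show ?thesis unfolding has_cycle_def using xs(1)
    by (intro exI[of _ ?ys]) auto
qed

lemma card_relabel: "card (\<pi> ` X) = card X"
  using relabel_inj_on by (simp add: card_image)

lemma choppable_relabel:
  assumes "choppable E \<tau> (\<pi> ` A) (\<pi> ` B)"
  shows "choppable (relabel \<pi> E) (relabel_seps \<pi> \<tau>) A B"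
proof -
  have "card (A \<inter> B) = card (\<pi> ` A \<inter> \<pi> ` B)"
    using card_relabel relabel_inj by (metis image_Int)
  moreover have "\<pi> ` A - \<pi> ` B = \<pi> ` (A - B)" using relabel_inj by (simp add: image_set_diff)
  ultimately show ?thesis
    using assms has_cycle_relabel unfolding choppable_def relabel_seps_def by auto
qed

lemma chop_relabel: "chop (relabel \<pi> E) A B = relabel \<pi> (chop E (\<pi> ` A) (\<pi> ` B))"
  unfolding chop_def relabel_def using relabel_mem inv by (intro ext) metis

lemma induced_relabel:
  "induced (relabel \<pi> E) (relabel_seps \<pi> \<tau>) A B = relabel_seps \<pi> (induced E \<tau> (\<pi> ` A) (\<pi> ` B))"
proof -
  have "is_sep B (chop (relabel \<pi> E) A B) X Y
      \<longleftrightarrow> is_sep (\<pi> ` B) (chop E (\<pi> ` A) (\<pi> ` B)) (\<pi> ` X) (\<pi> ` Y)" for X Y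
    using is_sep_relabel[of "\<pi> ` B"] by (simp add: chop_relabel relabel_image)
  moreover have "card (X \<inter> Y) = card (\<pi> ` X \<inter> \<pi> ` Y)" for X Y
    using card_relabel relabel_inj by (metis image_Int)
  moreover have "A \<inter> B \<subseteq> X \<longleftrightarrow> \<pi> ` A \<inter> \<pi> ` B \<subseteq> \<pi> ` X" for X
    using relabel_inj by (metis image_Int inj_image_subset_iff)
  ultimately show ?thesis
    unfolding induced_def relabel_seps_def by (auto simp: image_Un)
qed

lemma relabel_relabel: "relabel \<pi> (relabel \<pi> E) = E" "relabel_seps \<pi> (relabel_seps \<pi> \<tau>) = \<tau>"
  unfolding relabel_def relabel_seps_def by (auto simp: inv relabel_image)

lemma normal_relabel: "normal E \<tau> \<Longrightarrow> normal (relabel \<pi> E) (relabel_seps \<pi> \<tau>)"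
  using choppable_relabel[of "relabel \<pi> E" "relabel_seps \<pi> \<tau>"]
  unfolding normal_def by (metis relabel_relabel relabel_image)

lemma chops_to_relabel:
  assumes "chops_to V E \<tau> W F \<rho>"
  shows "chops_to (\<pi> ` V) (relabel \<pi> E) (relabel_seps \<pi> \<tau>) (\<pi> ` W) (relabel \<pi> F) (relabel_seps \<pi> \<rho>)"
  using assms
proof (induction rule: chops_to.induct)
  case (refl V E \<tau>)
  show ?case by (rule chops_to.refl)
next
  case (step E \<tau> A B W F \<rho> V)
  show ?case
  proof (rule chops_to.step)
    show "choppable (relabel \<pi> E) (relabel_seps \<pi> \<tau>) (\<pi> ` A) (\<pi> ` B)"
      by (rule choppable_relabel) (simp add: relabel_image step.hyps)
    show "chops_to (\<pi> ` B) (chop (relabel \<pi> E) (\<pi> ` A) (\<pi> ` B))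
        (induced (relabel \<pi> E) (relabel_seps \<pi> \<tau>) (\<pi> ` A) (\<pi> ` B))
        (\<pi> ` W) (relabel \<pi> F) (relabel_seps \<pi> \<rho>)"
      using step.IH by (simp add: chop_relabel induced_relabel relabel_image)
  qed
qed

lemma graph_iso_relabel: "graph_iso W F (\<pi> ` W) (relabel \<pi> F)"
  unfolding graph_iso_def
proof (intro exI[of _ \<pi>] conjI ballI)
  show "bij_betw \<pi> W (\<pi> ` W)" using relabel_inj_on by (simp add: bij_betw_def)
qed (simp add: relabel_def inv)

end

subsection \<open>Chopping twice\<close>

text \<open>After chopping off \<open>A\<close>, the rest of a larger small side \<open>C\<close>
  can be chopped off too, and the result does not depend on \<open>A\<close>. This joins two
  crossing chops through their union.\<close>

lemma chop_supset:
  assumes k: "k_connected V E 3" and p: "profile4 V E \<tau>" and r: "choppable E \<tau> A B"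
    and t: "(C, D) \<in> \<tau>" "card (C \<inter> D) = 3" and le: "A \<subseteq> C" "D \<subseteq> B"
  shows "chops_to B (chop E A B) (induced E \<tau> A B) D (chop E C D) (induced E \<tau> C D)"
proof -
  let ?E = "chop E A B" and ?\<tau> = "induced E \<tau> A B" and ?C = "C \<inter> B"
  have g: "graph V E" by (rule k_connected_graph[OF k])
  have r': "(A, B) \<in> \<tau>" "card (A \<inter> B) = 3" using r unfolding choppable_def by auto
  have s: "is_sep V E A B" "is_sep V E C D" using profile4D(1)[OF p] r' t by auto
  note V = is_sep_Un[OF s(1)] is_sep_Un[OF s(2)]
  have fin: "finite V" by (rule graphD(1)[OF g])
  have chop_eq: "chop ?E ?C D = chop E C D"
    unfolding chop_def using le by (intro ext) blast
  have C_eq: "?C \<union> A = C" "?C \<inter> D = C \<inter> D" using V le by blast+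
  have sepC: "is_sep B ?E ?C D"
    using s le unfolding is_sep_def chop_def by blast
  have C_in: "(?C, D) \<in> ?\<tau>"
    by (rule inducedI1) (use sepC C_eq t le in auto)
  have p': "profile4 B ?E ?\<tau>" and k': "k_connected B ?E 3" using choppable_state[OF k p r] by auto
  have g': "graph B ?E" by (rule k_connected_graph[OF k'])
  have "induced E \<tau> C D \<subseteq> induced ?E ?\<tau> ?C D"
  proof clarify
    fix X Y assume xy: "(X, Y) \<in> induced E \<tau> C D"
    have sXY: "is_sep D (chop ?E ?C D) X Y" using induced_sep[OF xy] chop_eq by simp
    have XYD: "X \<subseteq> D" "Y \<subseteq> D" using is_sep_subset[OF sXY] by auto
    show "(X, Y) \<in> induced ?E ?\<tau> ?C D"
    proof (rule inducedI[OF sXY induced_card[OF xy]])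
      assume c: "?C \<inter> D \<subseteq> X"
      have "(X \<union> C, Y) \<in> \<tau>" by (rule induced_lift1[OF p g t(1) xy]) (use c C_eq in auto)
      moreover have "X \<union> ?C \<union> A = X \<union> C" using C_eq by blast
      ultimately show "(X \<union> ?C, Y) \<in> ?\<tau>"
        using chop_lift[OF sepC sXY c] induced_card[OF xy] le by (intro inducedI1) auto
    next
      assume c: "?C \<inter> D \<subseteq> Y"
      have "(X, Y \<union> C) \<in> \<tau>" by (rule induced_lift2[OF p g t(1) xy]) (use c C_eq in auto)
      moreover have "Y \<union> ?C \<union> A = Y \<union> C" using C_eq by blast
      ultimately show "(X, Y \<union> ?C) \<in> ?\<tau>"
        using chop_lift'[OF g' sepC sXY c] induced_card[OF xy] le by (intro inducedI2) auto
    qed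
  qed
  moreover have "profile4 D (chop E C D) (induced E \<tau> C D)" by (rule profile4_induced[OF p g t(1)])
  moreover have "profile4 D (chop E C D) (induced ?E ?\<tau> ?C D)"
    using profile4_induced[OF p' g' C_in] chop_eq by simp
  ultimately have induced_eq: "induced ?E ?\<tau> ?C D = induced E \<tau> C D"
    using profile4_eqI by metis
  show ?thesis
  proof (cases "?C - D = {}")
    case True
    \<comment> \<open>Nothing of \<open>C\<close> is left beyond the new separator. Comparing the
      two separators of size three shows that both separations are the same, so no second step is
      made.\<close>
    have "A \<inter> B \<subseteq> C \<inter> D" using True le by blast
    then have "A \<inter> B = C \<inter> D" using r' t fin V by (intro card_subset_eq) (auto intro: finite_subset)
    then have "A = C" "B = D" using True V le by blast+
    then show ?thesis using chops_to.refl by metis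
  next
    case False
    \<comment> \<open>The triangle created by the first chop is the required cycle.\<close>
    have "has_cycle ?E ?C"
      by (rule clique_has_cycle[of "A \<inter> B"]) (use r' le in \<open>auto simp: chop_def\<close>)
    then have "choppable ?E ?\<tau> ?C D" unfolding choppable_def using C_in C_eq t False by simp
    then show ?thesis using chops_to.step chops_to.refl chop_eq induced_eq by metis
  qed
qed

text \<open>The triangles of two successive chops take their sides of \<open>{X, Y}\<close>
  independently, which gives four lifts to \<open>V\<close>.\<close>

lemma induced_lift_twice:
  assumes p: "profile4 V E \<tau>" and g: "graph V E" and t: "(A, B) \<in> \<tau>"
    and u: "(C, Q) \<in> induced E \<tau> A B" and x: "(X, Y) \<in> induced (chop E A B) (induced E \<tau> A B) C Q"
  shows "C \<inter> Q \<subseteq> X \<Longrightarrow> A \<inter> B \<subseteq> X \<Longrightarrow> (X \<union> C \<union> A, Y) \<in> \<tau>"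
    "C \<inter> Q \<subseteq> X \<Longrightarrow> A \<inter> B \<subseteq> Y \<Longrightarrow> (X \<union> C, Y \<union> A) \<in> \<tau>"
    "C \<inter> Q \<subseteq> Y \<Longrightarrow> A \<inter> B \<subseteq> X \<Longrightarrow> (X \<union> A, Y \<union> C) \<in> \<tau>"
    "C \<inter> Q \<subseteq> Y \<Longrightarrow> A \<inter> B \<subseteq> Y \<Longrightarrow> (X, Y \<union> C \<union> A) \<in> \<tau>"
proof -
  have p': "profile4 B (chop E A B) (induced E \<tau> A B)" by (rule profile4_induced[OF p g t])
  have g': "graph B (chop E A B)"
    using graph_chop[OF g] is_sep_subset[OF profile4D(1)[OF p t]] by blast
  note L = induced_lift1[OF p' g' u x] induced_lift2[OF p' g' u x]
  note M = induced_lift1[OF p g t] induced_lift2[OF p g t]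
  show "C \<inter> Q \<subseteq> X \<Longrightarrow> A \<inter> B \<subseteq> X \<Longrightarrow> (X \<union> C \<union> A, Y) \<in> \<tau>" using M(1)[OF L(1)] by blast
  show "C \<inter> Q \<subseteq> X \<Longrightarrow> A \<inter> B \<subseteq> Y \<Longrightarrow> (X \<union> C, Y \<union> A) \<in> \<tau>" using M(2)[OF L(1)] by blast
  show "C \<inter> Q \<subseteq> Y \<Longrightarrow> A \<inter> B \<subseteq> X \<Longrightarrow> (X \<union> A, Y \<union> C) \<in> \<tau>" using M(1)[OF L(2)] by blast
  show "C \<inter> Q \<subseteq> Y \<Longrightarrow> A \<inter> B \<subseteq> Y \<Longrightarrow> (X, Y \<union> C \<union> A) \<in> \<tau>" using M(2)[OF L(2)] by blast
qed

text \<open>A converse to \<open>induced_lift_twice\<close>. By \<open>S\<close> the first triangle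
  survives inside \<open>Q\<close>, so it still lies on one side of \<open>{X, Y}\<close>; the
  hypothesis \<open>h\<close> collects the four placements.\<close>

lemma induced_twiceI:
  assumes p: "profile4 V E \<tau>" and g: "graph V E" and t: "(A, B) \<in> \<tau>"
    and u: "(C, Q) \<in> induced E \<tau> A B" and S: "A \<inter> B \<subseteq> Q"
    and s: "is_sep Q (chop (chop E A B) C Q) X Y" "card (X \<inter> Y) < 4"
    and h: "\<And>P R. is_sep V E P R \<Longrightarrow> card (P \<inter> R) < 4 \<Longrightarrow>
       C \<inter> Q \<subseteq> X \<and> A \<inter> B \<subseteq> X \<and> P = X \<union> C \<union> A \<and> R = Y \<or>
       C \<inter> Q \<subseteq> X \<and> A \<inter> B \<subseteq> Y \<and> P = X \<union> C \<and> R = Y \<union> A \<or>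
       C \<inter> Q \<subseteq> Y \<and> A \<inter> B \<subseteq> X \<and> P = X \<union> A \<and> R = Y \<union> C \<or>
       C \<inter> Q \<subseteq> Y \<and> A \<inter> B \<subseteq> Y \<and> P = X \<and> R = Y \<union> C \<union> A \<Longrightarrow> (P, R) \<in> \<tau>"
  shows "(X, Y) \<in> induced (chop E A B) (induced E \<tau> A B) C Q"
proof -
  have sAB: "is_sep V E A B" by (rule profile4D(1)[OF p t])
  have g': "graph B (chop E A B)" using graph_chop[OF g] is_sep_subset[OF sAB] by blast
  have sC: "is_sep B (chop E A B) C Q" by (rule induced_sep[OF u])
  have XY: "X \<subseteq> Q" "Y \<subseteq> Q" using is_sep_subset[OF s(1)] by auto
  show ?thesis
  proof (rule inducedI[OF s])
    assume c: "C \<inter> Q \<subseteq> X"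
    note l = chop_lift[OF sC s(1) c]
    show "(X \<union> C, Y) \<in> induced E \<tau> A B"
    proof (rule inducedI)
      show "is_sep B (chop E A B) (X \<union> C) Y" "card ((X \<union> C) \<inter> Y) < 4" using l s(2) by auto
      assume "A \<inter> B \<subseteq> X \<union> C"
      then have "A \<inter> B \<subseteq> X" using S c by blast
      then show "(X \<union> C \<union> A, Y) \<in> \<tau>"
        using h chop_lift[OF sAB l(1)] l(2) s(2) c \<open>A \<inter> B \<subseteq> X \<union> C\<close> by metis
    next
      assume "A \<inter> B \<subseteq> Y"
      then show "(X \<union> C, Y \<union> A) \<in> \<tau>" using h chop_lift'[OF g sAB l(1)] l(2) s(2) c by metis
    qed
  next
    assume c: "C \<inter> Q \<subseteq> Y"
    note l = chop_lift'[OF g' sC s(1) c]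
    show "(X, Y \<union> C) \<in> induced E \<tau> A B"
    proof (rule inducedI)
      show "is_sep B (chop E A B) X (Y \<union> C)" "card (X \<inter> (Y \<union> C)) < 4" using l s(2) by auto
      assume "A \<inter> B \<subseteq> Y \<union> C"
      then have "A \<inter> B \<subseteq> Y" using S c by blast
      then show "(X, Y \<union> C \<union> A) \<in> \<tau>"
        using h chop_lift'[OF g sAB l(1)] l(2) s(2) c \<open>A \<inter> B \<subseteq> Y \<union> C\<close> by metis
    next
      assume "A \<inter> B \<subseteq> X"
      then show "(X \<union> A, Y \<union> C) \<in> \<tau>" using h chop_lift[OF sAB l(1)] l(2) s(2) c by metis
    qed
  qed
qed

text \<open>Since \<open>C \<subseteq> B\<close>, the first chop deletes nothing from
  \<open>C\<close> and at most adds edges; cycle and separator persist.\<close>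

lemma chop_nested_choppable:
  assumes p: "profile4 V E \<tau>" and g: "graph V E"
    and r: "choppable E \<tau> A B" "choppable E \<tau> C D" and le: "A \<subseteq> D" "C \<subseteq> B"
  shows "choppable (chop E A B) (induced E \<tau> A B) C (B \<inter> D)"
proof -
  have t: "(A, B) \<in> \<tau>" "(C, D) \<in> \<tau>" "card (C \<inter> D) = 3" "C - D \<noteq> {}" "has_cycle E C"
    using r unfolding choppable_def by auto
  have s: "is_sep V E A B" "is_sep V E C D" using profile4D(1)[OF p] t by auto
  note V = is_sep_Un[OF s(1)] is_sep_Un[OF s(2)]
  have c: "C \<inter> (B \<inter> D) = C \<inter> D" using le by blast
  have "is_sep B (chop E A B) C (B \<inter> D)"
    using s le unfolding is_sep_def chop_def by blast
  moreover have "B \<inter> D \<union> A = D" using V le by blast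
  ultimately have "(C, B \<inter> D) \<in> induced E \<tau> A B"
    using t c le by (intro inducedI2) auto
  moreover have "has_cycle (chop E A B) C"
    by (rule has_cycle_mono[OF t(5)]) (use le graphD[OF g] in \<open>auto simp: chop_def\<close>)
  ultimately show ?thesis unfolding choppable_def using t c by auto
qed

text \<open>Either order leaves \<open>B \<inter> D\<close> and adds the same two triangles; the
  lifts to \<open>\<tau>\<close> differ only in the order in which \<open>A\<close> and
  \<open>C\<close> are restored.\<close>

lemma chop_nested_commute:
  assumes p: "profile4 V E \<tau>" and g: "graph V E"
    and r: "choppable E \<tau> A B" "choppable E \<tau> C D" and le: "A \<subseteq> D" "C \<subseteq> B"
  shows "chop (chop E A B) C (B \<inter> D) = chop (chop E C D) A (D \<inter> B)" (is "?F = ?F'")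
    and "induced (chop E A B) (induced E \<tau> A B) C (B \<inter> D)
       = induced (chop E C D) (induced E \<tau> C D) A (D \<inter> B)" (is "?\<rho> = ?\<rho>'")
proof -
  show F: "?F = ?F'" unfolding chop_def by (intro ext) blast
  have t: "(A, B) \<in> \<tau>" "(C, D) \<in> \<tau>" using r unfolding choppable_def by auto
  have u: "(C, B \<inter> D) \<in> induced E \<tau> A B" "(A, D \<inter> B) \<in> induced E \<tau> C D"
    using chop_nested_choppable[OF p g r le] chop_nested_choppable[OF p g r(2,1) le(2,1)]
    unfolding choppable_def by auto
  have g': "graph B (chop E A B)" "graph D (chop E C D)"
    using graph_chop[OF g] is_sep_subset[OF profile4D(1)[OF p t(1)]]
      is_sep_subset[OF profile4D(1)[OF p t(2)]] by auto
  have sub: "?\<rho> \<subseteq> ?\<rho>'"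
  proof clarify
    fix X Y assume x: "(X, Y) \<in> ?\<rho>"
    note L = induced_lift_twice[OF p g t(1) u(1) x]
    have c: "C \<inter> (B \<inter> D) = C \<inter> D" "A \<inter> (D \<inter> B) = A \<inter> B" using le by blast+
    have ac: "X \<union> C \<union> A = X \<union> A \<union> C" "Y \<union> C \<union> A = Y \<union> A \<union> C" by blast+
    show "(X, Y) \<in> ?\<rho>'"
    proof (rule induced_twiceI[OF p g t(2) u(2)])
      show "C \<inter> D \<subseteq> D \<inter> B" using le by blast
      show "is_sep (D \<inter> B) (chop (chop E C D) A (D \<inter> B)) X Y"
        using induced_sep[OF x] F by (simp add: Int_commute)
      show "card (X \<inter> Y) < 4" by (rule induced_card[OF x])
    qed (use L c ac in metis)
  qed
  have "profile4 (B \<inter> D) ?F ?\<rho>" by (rule profile4_induced[OF profile4_induced[OF p g t(1)] g'(1) u(1)])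
  moreover have "profile4 (D \<inter> B) ?F' ?\<rho>'"
    by (rule profile4_induced[OF profile4_induced[OF p g t(2)] g'(2) u(2)])
  ultimately show "?\<rho> = ?\<rho>'" using sub F profile4_eqI by (metis Int_commute)
qed

subsection \<open>Crossing in a single edge\<close>

text \<open>The vertex \<open>s\<close> lies on the separator of \<open>{A, B}\<close> and strictly
  inside \<open>C\<close>, while \<open>t\<close> lies on that of \<open>{C, D}\<close> and strictly
  inside \<open>A\<close>. Chopping off \<open>A\<close> keeps \<open>s\<close> and deletes
  \<open>t\<close>; chopping off \<open>C\<close> does the opposite.\<close>

definition edge_crossing :: "'a set \<Rightarrow> 'a set \<Rightarrow> 'a set \<Rightarrow> 'a set \<Rightarrow> 'a \<Rightarrow> 'a \<Rightarrow> bool" where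
  "edge_crossing A B C D s t \<longleftrightarrow> A \<inter> C = {s, t} \<and> s \<in> B \<and> s \<notin> D \<and> t \<in> D \<and> t \<notin> B"

lemma edge_crossing_sym: "edge_crossing A B C D s t \<Longrightarrow> edge_crossing C D A B t s"
  unfolding edge_crossing_def by blast

definition swap :: "'a \<Rightarrow> 'a \<Rightarrow> 'a \<Rightarrow> 'a" where
  "swap s t x = (if x = s then t else if x = t then s else x)"

lemma swap_swap: "swap s t (swap s t x) = x"
  unfolding swap_def by simp

lemma swap_commute: "swap s t = swap t s"
  unfolding swap_def by auto

text \<open>After chopping off \<open>A\<close> the separator of \<open>{C, D}\<close> has lost
  \<open>t\<close>. Putting \<open>s\<close> in its place gives the separation to chop next.\<close>

lemma edge_crossing_induced:
  assumes p: "profile4 V E \<tau>" and g: "graph V E" and t: "(A, B) \<in> \<tau>" "(C, D) \<in> \<tau>"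
    and x: "edge_crossing A B C D s t" and c: "card (C \<inter> D) = 3"
  shows "(C - {t}, insert s (B \<inter> D)) \<in> induced E \<tau> A B"
    and "card ((C - {t}) \<inter> insert s (B \<inter> D)) = 3"
proof -
  have s: "is_sep V E A B" "is_sep V E C D" using profile4D(1)[OF p] t by auto
  note V = is_sep_Un[OF s(1)] is_sep_Un[OF s(2)]
  note X = x[unfolded edge_crossing_def]
  have fin: "finite V" by (rule graphD(1)[OF g])
  have fC: "finite C" "finite D" using is_sep_subset[OF s(2)] fin finite_subset by blast+
  have e: "(C - {t}) \<inter> insert s D = insert s (C \<inter> D - {t})" using X by blast
  have e': "(C - {t}) \<inter> insert s (B \<inter> D) = insert s (C \<inter> D - {t})" using X V by blast
  have "card (insert s (C \<inter> D - {t})) = 3"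
    using X c fC by (subst card_insert_disjoint) auto
  then show c3: "card ((C - {t}) \<inter> insert s (B \<inter> D)) = 3" using e' by simp
  \<comment> \<open>An edge across the new cut would have to end in \<open>t\<close>. Edges at
    \<open>t\<close> stay in \<open>A\<close>, which meets \<open>C\<close> only in \<open>s\<close>
    and \<open>t\<close>.\<close>
  have sC: "is_sep V E (C - {t}) (insert s D)"
    unfolding is_sep_def
  proof (intro conjI ballI notI)
    show "(C - {t}) \<union> insert s D = V" using V X by blast
    fix u v assume u: "u \<in> C - {t} - insert s D" and v: "v \<in> insert s D - (C - {t})" and uv: "E u v"
    have "v = t" using u v uv s(2) X unfolding is_sep_def by blast
    moreover have "u \<notin> A" using u X by blast
    ultimately show False using uv X is_sep_edge[OF g s(1) uv] by blast
  qed
  have C_in: "(C - {t}, insert s D) \<in> \<tau>"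
  proof (rule profile4_switch[OF p g t(2) sC])
    show "card ((C - {t}) \<inter> insert s D) < 4" using c3 e e' by simp
    show "C \<union> insert s D = V" using V X by blast
    have "D \<inter> (C - {t}) \<subseteq> C \<inter> D" by blast
    then have "card (D \<inter> (C - {t})) \<le> 3" using c fC card_mono[of "C \<inter> D"] by (metis finite_Int)
    then show "card (D \<inter> (C - {t})) < 4" by simp
  qed
  show "(C - {t}, insert s (B \<inter> D)) \<in> induced E \<tau> A B"
  proof (rule inducedI2)
    show "is_sep B (chop E A B) (C - {t}) (insert s (B \<inter> D))"
      unfolding is_sep_def
    proof (intro conjI ballI notI)
      have "C - {t} \<subseteq> B"
      proof
        fix y assume y: "y \<in> C - {t}"
        then have "y \<in> A \<union> B" using V by blast
        then show "y \<in> B" using X y by auto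
      qed
      moreover have "B \<subseteq> C \<union> D" using V by blast
      ultimately show "C - {t} \<union> insert s (B \<inter> D) = B" using X by blast
      fix u v assume u: "u \<in> C - {t} - insert s (B \<inter> D)" and v: "v \<in> insert s (B \<inter> D) - (C - {t})"
        and uv: "chop E A B u v"
      have "u \<in> B" "u \<notin> A" using uv u X unfolding chop_def by blast+
      then have "E u v" using uv unfolding chop_def by blast
      moreover have "u \<in> C - {t} - insert s D" "v \<in> insert s D - (C - {t})"
        using u v \<open>u \<in> B\<close> by blast+
      ultimately show False using sC unfolding is_sep_def by blast
    qed
    show "card ((C - {t}) \<inter> insert s (B \<inter> D)) < 4" using c3 by simp
    show "A \<inter> B \<subseteq> insert s (B \<inter> D)" using X V by blast
    have "insert s (B \<inter> D) \<union> A = insert s D" using X V by blast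
    then show "(C - {t}, insert s (B \<inter> D) \<union> A) \<in> \<tau>" using C_in by simp
  qed
qed

lemma edge_crossing_chops:
  assumes k: "k_connected V E 3" and p: "profile4 V E \<tau>"
    and r: "choppable E \<tau> A B" "choppable E \<tau> C D" and x: "edge_crossing A B C D s t"
  shows "chops_to B (chop E A B) (induced E \<tau> A B) (insert s (B \<inter> D))
      (chop (chop E A B) (C - {t}) (insert s (B \<inter> D)))
      (induced (chop E A B) (induced E \<tau> A B) (C - {t}) (insert s (B \<inter> D)))"
proof -
  let ?C = "C - {t}" and ?Q = "insert s (B \<inter> D)"
  have g: "graph V E" by (rule k_connected_graph[OF k])
  have t: "(A, B) \<in> \<tau>" "(C, D) \<in> \<tau>" "card (C \<inter> D) = 3" "has_cycle E C"
    using r unfolding choppable_def by auto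
  have s: "is_sep V E A B" "is_sep V E C D" using profile4D(1)[OF p] t by auto
  note V = is_sep_Un[OF s(1)] is_sep_Un[OF s(2)]
  note X = x[unfolded edge_crossing_def]
  note u = edge_crossing_induced[OF p g t(1,2) x t(3)]
  have p': "profile4 B (chop E A B) (induced E \<tau> A B)" and g': "graph B (chop E A B)"
    using choppable_state[OF k p r(1)] k_connected_graph by auto
  have CB: "?C \<subseteq> B" using is_sep_subset[OF induced_sep[OF u(1)]] by blast
  \<comment> \<open>All neighbours of \<open>t\<close> lie in \<open>A\<close>, so \<open>s\<close>
    is its only possible neighbour in \<open>C\<close>.\<close>
  have "has_cycle E ?C"
  proof (rule has_cycle_remove[OF t(4)])
    show "E a b \<Longrightarrow> E b a" for a b by (rule graphD(5)[OF g])
    fix y assume "y \<in> C" "E t y"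
    then have "y \<in> A \<inter> C" "y \<noteq> t" using is_sep_edge[OF g s(1), of t y] X graphD(4)[OF g] by blast+
    then show "y = s" using X by blast
  qed
  then have cyc: "has_cycle (chop E A B) ?C"
    by (rule has_cycle_mono) (use CB graphD[OF g] in \<open>auto simp: chop_def\<close>)
  show ?thesis
  proof (cases "?C - ?Q = {}")
    case False
    then have "choppable (chop E A B) (induced E \<tau> A B) ?C ?Q"
      unfolding choppable_def using u cyc by blast
    then show ?thesis using chops_to.step chops_to.refl by blast
  next
    case True
    \<comment> \<open>Only the three separator vertices remain of the side. Its cycle makes them a
      triangle already, so there is nothing to chop.\<close>
    have QB: "?Q = B" using True is_sep_Un[OF induced_sep[OF u(1)]] by blast
    have c3: "card ?C = 3" using u(2) True by (metis Diff_eq_empty_iff inf.absorb1)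
    have cl: "chop E A B a b" if "a \<in> ?C" "b \<in> ?C" "a \<noteq> b" for a b
      using has_cycle_card3[OF cyc c3] graphD(4,5)[OF g'] that by blast
    have "chop (chop E A B) ?C B = chop E A B" by (rule chop_trivial[OF g' CB]) (rule cl)
    moreover have "induced (chop E A B) (induced E \<tau> A B) ?C B = induced E \<tau> A B"
      by (rule induced_trivial[OF p' g' CB]) (rule cl)
    ultimately show ?thesis unfolding QB using chops_to.refl by metis
  qed
qed

text \<open>Edges of \<open>G\<close> at \<open>s\<close> stay in \<open>C\<close> and those at
  \<open>t\<close> stay in \<open>A\<close>. Hence whichever of the two survives is joined to
  exactly the vertices of \<open>B \<inter> D\<close> that lie in
  \<open>A \<union> C\<close>.\<close>

lemma edge_crossing_chop_eq:
  assumes g: "graph V E" and s: "is_sep V E A B" "is_sep V E C D"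
    and x: "edge_crossing A B C D s t"
  shows "chop (chop E C D) (A - {s}) (insert t (D \<inter> B))
      = relabel (swap s t) (chop (chop E A B) (C - {t}) (insert s (B \<inter> D)))"
proof (intro ext)
  note X = x[unfolded edge_crossing_def]
  note V = is_sep_Un[OF s(1)] is_sep_Un[OF s(2)]
  have es: "E s y \<Longrightarrow> y \<in> C" "E y s \<Longrightarrow> y \<in> C" for y
    using is_sep_edge[OF g s(2)] X by blast+
  have et: "E t y \<Longrightarrow> y \<in> A" "E y t \<Longrightarrow> y \<in> A" for y
    using is_sep_edge[OF g s(1)] X by blast+
  have F1: "chop (chop E A B) (C - {t}) (insert s (B \<inter> D)) x y \<longleftrightarrow>
      x \<in> insert s (B \<inter> D) \<and> y \<in> insert s (B \<inter> D) \<and> x \<noteq> y \<and>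
      (E x y \<or> x \<in> A \<and> y \<in> A \<or> x \<in> C \<and> y \<in> C)" for x y
    unfolding chop_def using X by blast
  have F2: "chop (chop E C D) (A - {s}) (insert t (D \<inter> B)) x y \<longleftrightarrow>
      x \<in> insert t (B \<inter> D) \<and> y \<in> insert t (B \<inter> D) \<and> x \<noteq> y \<and>
      (E x y \<or> x \<in> A \<and> y \<in> A \<or> x \<in> C \<and> y \<in> C)" for x y
    unfolding chop_def using X by blast
  have st: "s \<noteq> t" "s \<in> A" "s \<in> C" "t \<in> A" "t \<in> C" "s \<notin> D" "t \<notin> B" using X by blast+
  show "chop (chop E C D) (A - {s}) (insert t (D \<inter> B)) x y
      = relabel (swap s t) (chop (chop E A B) (C - {t}) (insert s (B \<inter> D))) x y" for x y
    unfolding relabel_def F1 F2 swap_def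
    using st es[of x] es[of y] et[of x] et[of y] by (cases "x = t"; cases "y = t"; cases "x = s"; cases "y = s") auto
qed

text \<open>Both double lifts to \<open>V\<close> agree up to the position of \<open>s\<close> and
  \<open>t\<close>. In each placement of the two triangles one rule for profiles absorbs this
  difference; the opposite direction is the same lemma with the two sides interchanged.\<close>

lemma edge_crossing_relabel_subset:
  assumes p: "profile4 V E \<tau>" and g: "graph V E" and t: "(A, B) \<in> \<tau>" "(C, D) \<in> \<tau>"
    and c: "card (A \<inter> B) = 3" "card (C \<inter> D) = 3" and x: "edge_crossing A B C D s t"
    and xy: "(X, Y) \<in> induced (chop E A B) (induced E \<tau> A B) (C - {t}) (insert s (B \<inter> D))"
  shows "(swap s t ` X, swap s t ` Y)
    \<in> induced (chop E C D) (induced E \<tau> C D) (A - {s}) (insert t (D \<inter> B))"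
proof -
  let ?\<pi> = "swap s t" and ?F = "chop (chop E A B) (C - {t}) (insert s (B \<inter> D))"
  note inv = swap_swap[of s t]
  note X = x[unfolded edge_crossing_def]
  have s: "is_sep V E A B" "is_sep V E C D" using profile4D(1)[OF p] t by auto
  have AV: "A \<subseteq> V" "B \<subseteq> V" "C \<subseteq> V" "D \<subseteq> V" using is_sep_subset[OF s(1)] is_sep_subset[OF s(2)] by auto
  note V = is_sep_Un[OF s(1)] is_sep_Un[OF s(2)]
  note u1 = edge_crossing_induced(1)[OF p g t x c(2)]
  note u2 = edge_crossing_induced(1)[OF p g t(2,1) edge_crossing_sym[OF x] c(1)]
  note L = induced_lift_twice[OF p g t(1) u1 xy]
  have XYQ: "X \<union> Y = insert s (B \<inter> D)" using is_sep_Un[OF induced_sep[OF xy]] .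
  have st: "s \<noteq> t" "s \<in> A" "s \<in> B" "s \<in> C" "t \<in> A" "t \<in> C" "t \<in> D" "s \<notin> D" "t \<notin> B"
    using X by blast+
  have "t \<notin> X \<union> Y" using XYQ st by simp
  then have tn: "t \<notin> X" "t \<notin> Y" by auto
  have im: "?\<pi> ` Z = (if s \<in> Z then insert t (Z - {s}) else Z)" if "t \<notin> Z" for Z
    using that st(1) by (auto simp: swap_def image_iff)
  have "y \<in> D \<or> y = s" if "y \<in> A \<inter> B" for y
  proof -
    have "y \<in> D \<or> y \<in> A \<inter> C" using that AV V by blast
    then show ?thesis using that X by auto
  qed
  then have S: "A \<inter> B = insert s (A \<inter> B \<inter> D)" using st by blast
  have "y \<in> B \<or> y = t" if "y \<in> C \<inter> D" for y
  proof -
    have "y \<in> B \<or> y \<in> A \<inter> C" using that AV V by blast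
    then show ?thesis using that X by auto
  qed
  then have T: "C \<inter> D = insert t (B \<inter> C \<inter> D)" using st by blast
  have T1: "(C - {t}) \<inter> insert s (B \<inter> D) = insert s (B \<inter> C \<inter> D)" using X by blast
  have S1: "(A - {s}) \<inter> insert t (D \<inter> B) = insert t (A \<inter> B \<inter> D)" using X by blast
  \<comment> \<open>By the preceding equations the triangles of the two routes are
    \<open>insert s W\<close> and \<open>insert t W\<close> for the same \<open>W\<close>, so they
    correspond under the swap.\<close>
  have pull: "insert s W \<subseteq> Z" if "insert t W \<subseteq> ?\<pi> ` Z" "s \<notin> W" "t \<notin> W" for W Z
  proof
    fix y assume y: "y \<in> insert s W"
    then have "?\<pi> y \<in> insert t W" using that unfolding swap_def by auto
    then show "y \<in> Z" using that(1) relabel_mem[OF inv, of "?\<pi> y" Z] inv by auto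
  qed
  have nW: "s \<notin> B \<inter> C \<inter> D" "t \<notin> B \<inter> C \<inter> D" "s \<notin> A \<inter> B \<inter> D" "t \<notin> A \<inter> B \<inter> D" using st by auto
  have incl: "C \<inter> D \<subseteq> ?\<pi> ` Z \<Longrightarrow> (C - {t}) \<inter> insert s (B \<inter> D) \<subseteq> Z"
    "(A - {s}) \<inter> insert t (D \<inter> B) \<subseteq> ?\<pi> ` Z \<Longrightarrow> A \<inter> B \<subseteq> Z" for Z
    using pull[OF _ nW(1,2), of Z] pull[OF _ nW(3,4), of Z] unfolding T1 S1 S[symmetric] T[symmetric]
    by simp_all
  show ?thesis
  proof (rule induced_twiceI[OF p g t(2) u2])
    show "C \<inter> D \<subseteq> insert t (D \<inter> B)" using T by blast
    have "is_sep (?\<pi> ` insert s (B \<inter> D)) (relabel ?\<pi> ?F) (?\<pi> ` X) (?\<pi> ` Y)"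
      unfolding is_sep_relabel[OF inv] relabel_image[OF inv] by (rule induced_sep[OF xy])
    moreover have "?\<pi> ` insert s (B \<inter> D) = insert t (D \<inter> B)"
      using im[of "insert s (B \<inter> D)"] st by auto
    ultimately show "is_sep (insert t (D \<inter> B)) (chop (chop E C D) (A - {s}) (insert t (D \<inter> B)))
        (?\<pi> ` X) (?\<pi> ` Y)"
      using edge_crossing_chop_eq[OF g s x] by simp
    show "card (?\<pi> ` X \<inter> ?\<pi> ` Y) < 4"
      using induced_card[OF xy] card_relabel[OF inv] image_Int[OF relabel_inj[OF inv]] by metis
    fix P R
    assume sPR: "is_sep V E P R" "card (P \<inter> R) < 4"
    assume "(A - {s}) \<inter> insert t (D \<inter> B) \<subseteq> ?\<pi> ` X \<and> C \<inter> D \<subseteq> ?\<pi> ` X \<and>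
          P = ?\<pi> ` X \<union> (A - {s}) \<union> C \<and> R = ?\<pi> ` Y \<or>
        (A - {s}) \<inter> insert t (D \<inter> B) \<subseteq> ?\<pi> ` X \<and> C \<inter> D \<subseteq> ?\<pi> ` Y \<and>
          P = ?\<pi> ` X \<union> (A - {s}) \<and> R = ?\<pi> ` Y \<union> C \<or>
        (A - {s}) \<inter> insert t (D \<inter> B) \<subseteq> ?\<pi> ` Y \<and> C \<inter> D \<subseteq> ?\<pi> ` X \<and>
          P = ?\<pi> ` X \<union> C \<and> R = ?\<pi> ` Y \<union> (A - {s}) \<or>
        (A - {s}) \<inter> insert t (D \<inter> B) \<subseteq> ?\<pi> ` Y \<and> C \<inter> D \<subseteq> ?\<pi> ` Y \<and>
          P = ?\<pi> ` X \<and> R = ?\<pi> ` Y \<union> (A - {s}) \<union> C"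
    then consider
      (1) "A \<inter> B \<subseteq> X" "(C - {t}) \<inter> insert s (B \<inter> D) \<subseteq> X"
          "P = ?\<pi> ` X \<union> (A - {s}) \<union> C" "R = ?\<pi> ` Y"
      | (2) "A \<inter> B \<subseteq> X" "(C - {t}) \<inter> insert s (B \<inter> D) \<subseteq> Y"
          "P = ?\<pi> ` X \<union> (A - {s})" "R = ?\<pi> ` Y \<union> C"
      | (3) "A \<inter> B \<subseteq> Y" "(C - {t}) \<inter> insert s (B \<inter> D) \<subseteq> X"
          "P = ?\<pi> ` X \<union> C" "R = ?\<pi> ` Y \<union> (A - {s})"
      | (4) "A \<inter> B \<subseteq> Y" "(C - {t}) \<inter> insert s (B \<inter> D) \<subseteq> Y"
          "P = ?\<pi> ` X" "R = ?\<pi> ` Y \<union> (A - {s}) \<union> C"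
      using incl[of X] incl[of Y] by metis
    then show "(P, R) \<in> \<tau>"
    proof cases
      case 1
      have t': "(X \<union> (C - {t}) \<union> A, Y) \<in> \<tau>" by (rule L(1)[OF 1(2,1)])
      have P: "P = X \<union> (C - {t}) \<union> A" unfolding 1(3) im[OF tn(1)] using st by auto
      show ?thesis
      proof (rule profile4_switch[OF p g t' sPR])
        show "card (Y \<inter> P) < 4" using profile4D(2)[OF p t'] P by (simp add: Int_commute)
        show "X \<union> (C - {t}) \<union> A \<union> R = V"
          using is_sep_Un[OF sPR(1)] P by simp
      qed
    next
      case 2
      have t': "(X \<union> A, Y \<union> (C - {t})) \<in> \<tau>" by (rule L(3)[OF 2(2,1)])
      show ?thesis
      proof (rule profile4_down[OF p g t' sPR])
        show "P \<subseteq> X \<union> A" unfolding 2(3) im[OF tn(1)] using st by auto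
        show "Y \<union> (C - {t}) \<subseteq> R" unfolding 2(4) im[OF tn(2)] using st by auto
      qed
    next
      case 3
      have t': "(X \<union> (C - {t}), Y \<union> A) \<in> \<tau>" by (rule L(2)[OF 3(2,1)])
      have P: "P = X \<union> (C - {t}) \<union> C" unfolding 3(3) im[OF tn(1)] using st by auto
      \<comment> \<open>The new lift adds \<open>t\<close> to the small side and takes
        \<open>s\<close> from the big one; merging with \<open>(C, D)\<close> does exactly
        this.\<close>
      have "s \<in> Y" using 3(1) st by blast
      then have R: "R = (Y \<union> A) \<inter> D" unfolding 3(4) im[OF tn(2)] using st XYQ X V by auto
      show ?thesis using profile4_union[OF p g t' t(2)] sPR(2) P R by simp
    next
      case 4
      have t': "(X, Y \<union> (C - {t}) \<union> A) \<in> \<tau>" by (rule L(4)[OF 4(2,1)])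
      have R: "R = Y \<union> (C - {t}) \<union> A" unfolding 4(4) im[OF tn(2)] using st by auto
      show ?thesis
      proof (rule profile4_switch[OF p g t' sPR])
        show "card ((Y \<union> (C - {t}) \<union> A) \<inter> P) < 4" using sPR(2) R by (simp add: Int_commute)
        show "X \<union> R = V" using is_sep_Un[OF profile4D(1)[OF p t']] R by simp
      qed
    qed
  qed
qed

lemma edge_crossing_relabel:
  assumes p: "profile4 V E \<tau>" and g: "graph V E" and t: "(A, B) \<in> \<tau>" "(C, D) \<in> \<tau>"
    and c: "card (A \<inter> B) = 3" "card (C \<inter> D) = 3" and x: "edge_crossing A B C D s t"
  shows "induced (chop E C D) (induced E \<tau> C D) (A - {s}) (insert t (D \<inter> B))
    = relabel_seps (swap s t) (induced (chop E A B) (induced E \<tau> A B) (C - {t}) (insert s (B \<inter> D)))"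
    (is "?\<rho>' = relabel_seps ?\<pi> ?\<rho>")
proof -
  have fwd: "(?\<pi> ` X, ?\<pi> ` Y) \<in> ?\<rho>'" if "(X, Y) \<in> ?\<rho>" for X Y
    by (rule edge_crossing_relabel_subset[OF p g t c x that])
  have bwd: "(?\<pi> ` X, ?\<pi> ` Y) \<in> ?\<rho>" if "(X, Y) \<in> ?\<rho>'" for X Y
    using edge_crossing_relabel_subset[OF p g t(2,1) c(2,1) edge_crossing_sym[OF x] that]
    by (simp add: swap_commute)
  have "(X, Y) \<in> ?\<rho>'" if "(?\<pi> ` X, ?\<pi> ` Y) \<in> ?\<rho>" for X Y
    using fwd[OF that] by (simp add: relabel_image[OF swap_swap])
  then show ?thesis using bwd unfolding relabel_seps_def by auto
qed

lemma edge_crossing_image: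
  assumes "edge_crossing A B C D s t"
  shows "swap s t ` insert s (B \<inter> D) = insert t (D \<inter> B)"
  using assms unfolding edge_crossing_def swap_def by (auto simp: image_iff)

subsection \<open>Uniqueness of the normal form\<close>

text \<open>Uncrossing: the two separators have six vertices counted with multiplicity, so a corner
  of order at least four forces the opposite corner to order at most two, and 3-connectivity empties
  its interior.\<close>

lemma crossing_cases:
  assumes k: "k_connected V E 3" and s: "is_sep V E A B" "is_sep V E C D"
    and c: "card (A \<inter> B) = 3" "card (C \<inter> D) = 3"
    and ne: "A - B \<noteq> {}" "C - D \<noteq> {}" "B - A \<noteq> {}" "D - C \<noteq> {}"
    and big: "card ((A \<union> C) \<inter> (B \<inter> D)) \<ge> 4"
  shows "(A \<subseteq> D \<and> C \<subseteq> B) \<or> (\<exists>s t. edge_crossing A B C D s t)"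
proof -
  have g: "graph V E" by (rule k_connected_graph[OF k])
  note V = is_sep_Un[OF s(1)] is_sep_Un[OF s(2)]
  have sub: "A \<subseteq> V" "B \<subseteq> V" "C \<subseteq> V" "D \<subseteq> V" using is_sep_subset[OF s(1)] is_sep_subset[OF s(2)] by auto
  have fin: "finite V" by (rule graphD(1)[OF g])
  have fins: "finite A" "finite B" "finite C" "finite D" using sub fin finite_subset by blast+
  \<comment> \<open>The centre \<open>M\<close> of the crossing and its four links: \<open>P\<close>
    and \<open>P'\<close> are the parts of \<open>A \<inter> B\<close> on the two sides of
    \<open>{C, D}\<close>, and \<open>Q\<close> and \<open>Q'\<close> the parts of
    \<open>C \<inter> D\<close> on the two sides of \<open>{A, B}\<close>.\<close>
  define M P P' Q Q' where "M = A \<inter> B \<inter> (C \<inter> D)" and "P = A \<inter> B \<inter> C - D"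
    and "P' = A \<inter> B \<inter> D - C" and "Q = A \<inter> C \<inter> D - B" and "Q' = B \<inter> C \<inter> D - A"
  note defs = M_def P_def P'_def Q_def Q'_def
  have f: "finite M" "finite P" "finite P'" "finite Q" "finite Q'" using fins unfolding defs by auto
  have S: "A \<inter> B = M \<union> P \<union> P'" "card (M \<union> P \<union> P') = card M + card P + card P'"
  proof -
    show "A \<inter> B = M \<union> P \<union> P'" unfolding defs using V sub by blast
    show "card (M \<union> P \<union> P') = card M + card P + card P'"
      using f by (subst card_Un_disjoint, force, force, force simp: defs)+ simp
  qed
  have T: "C \<inter> D = M \<union> Q \<union> Q'" "card (M \<union> Q \<union> Q') = card M + card Q + card Q'"
  proof -
    show "C \<inter> D = M \<union> Q \<union> Q'" unfolding defs using V sub by blast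
    show "card (M \<union> Q \<union> Q') = card M + card Q + card Q'"
      using f by (subst card_Un_disjoint, force, force, force simp: defs)+ simp
  qed
  have BD: "(A \<union> C) \<inter> (B \<inter> D) = M \<union> P' \<union> Q'" unfolding defs using V sub by blast
  have "card (M \<union> P' \<union> Q') \<le> card M + card P' + card Q'"
    using card_Un_le[of "M \<union> P'" Q'] card_Un_le[of M P'] by linarith
  then have small: "card M + card P + card Q \<le> 2" using S T c big BD by simp
  have AC: "(A \<inter> C) \<inter> (B \<union> D) = M \<union> P \<union> Q" unfolding defs by blast
  have "card (M \<union> P \<union> Q) \<le> card M + card P + card Q"
    using card_Un_le[of "M \<union> P" Q] card_Un_le[of M P] by linarith
  then have "card ((A \<inter> C) \<inter> (B \<union> D)) < 3" using small AC by simp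
  then have "A \<inter> C \<subseteq> B \<union> D \<or> B \<union> D \<subseteq> A \<inter> C"
    by (rule k_connectedD[OF k is_sep_corner(2)[OF g s]])
  then have ACe: "A \<inter> C \<subseteq> B \<union> D" using ne by blast
  \<comment> \<open>A larger link \<open>P0\<close> would force \<open>Q0\<close> to be empty. The
    corner \<open>A0 \<inter> D0\<close> would then have order below three, and together with the
    empty corner \<open>A0 \<inter> C0\<close> this leaves no vertex in \<open>A0 - B0\<close>.
    Fresh names allow both pairs of sides to be inserted.\<close>
  have corner: "card (P0 :: 'a set) \<le> card (Q0 :: 'a set)"
    if h: "is_sep V E A0 B0" "is_sep V E C0 D0" "A0 - B0 \<noteq> {}" "D0 - C0 \<noteq> {}" "C0 - D0 \<noteq> {}" "B0 - A0 \<noteq> {}"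
      "A0 \<inter> C0 \<subseteq> B0 \<union> D0"
      "P0 = A0 \<inter> B0 \<inter> C0 - D0" "Q0 = A0 \<inter> C0 \<inter> D0 - B0"
      "card (A0 \<inter> B0) = 3" "card P0 + card Q0 \<le> 2" for A0 B0 C0 D0 P0 Q0
  proof (rule ccontr)
    assume lt: "\<not> card P0 \<le> card Q0"
    then have "card Q0 = 0" using h(11) by linarith
    have sub0: "A0 \<subseteq> V" "B0 \<subseteq> V" "C0 \<subseteq> V" "D0 \<subseteq> V"
      using is_sep_subset[OF h(1)] is_sep_subset[OF h(2)] by auto
    have "finite A0" using sub0 fin finite_subset by blast
    then have Q0: "Q0 = {}" using \<open>card Q0 = 0\<close> h(9) by simp
    have fP: "finite P0" "P0 \<subseteq> A0 \<inter> B0" "finite (A0 \<inter> B0)" using \<open>finite A0\<close> h(8) by auto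
    have "(A0 \<inter> D0) \<inter> (B0 \<union> C0) = A0 \<inter> B0 - P0"
      using Q0 h(8,9) is_sep_Un[OF h(2)] sub0 by blast
    then have "card ((A0 \<inter> D0) \<inter> (B0 \<union> C0)) < 3"
      using card_Diff_subset[OF fP(1,2)] h(10) lt by simp
    then have "A0 \<inter> D0 \<subseteq> B0 \<union> C0 \<or> B0 \<union> C0 \<subseteq> A0 \<inter> D0"
      by (rule k_connectedD[OF k is_sep_corner(2)[OF g h(1) is_sep_sym[OF g h(2)]]])
    then have "A0 \<inter> D0 \<subseteq> B0 \<union> C0" using h(5) by blast
    then have "A0 - B0 \<subseteq> Q0" using h(7,9) is_sep_Un[OF h(2)] sub0 by blast
    then show False using Q0 h(3) by blast
  qed
  have "card P \<le> card Q"
    by (rule corner[OF s ne(1,4,2,3) ACe P_def Q_def c(1)]) (use small in simp)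
  moreover have "card Q \<le> card P"
    by (rule corner[OF s(2,1) ne(2,3,1,4)]) (use ACe c(2) small in \<open>auto simp: defs Int_ac\<close>)
  ultimately have PQ: "card P = card Q" by simp
  show ?thesis
  proof (cases "card P = 0")
    case True
    then have "P = {}" "Q = {}" using PQ f by auto
    then have "A \<inter> C \<subseteq> B \<inter> D" using ACe unfolding defs by blast
    then show ?thesis using V sub by blast
  next
    case False
    \<comment> \<open>Equal positive links with total at most two: one vertex in each and an empty
      centre.\<close>
    then have one: "card P = 1" "card Q = 1" "card M = 0" using PQ small by linarith+
    then obtain s t where st: "P = {s}" "Q = {t}" "M = {}" using f by (metis card_0_eq card_1_singletonE)
    have "A \<inter> C = M \<union> P \<union> Q" using AC ACe by blast
    then have "edge_crossing A B C D s t" unfolding edge_crossing_def using st unfolding defs by blast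
    then show ?thesis by blast
  qed
qed

text \<open>Isomorphism takes the place of equality in Newman's argument, so the states that join
  two first steps need only have isomorphic normal forms.\<close>

theorem chops_to_normal_unique:
  assumes "k_connected V E 3" "profile4 V E \<tau>"
    and "chops_to V E \<tau> W F \<rho>" "normal F \<rho>" "chops_to V E \<tau> W' F' \<rho>'" "normal F' \<rho>'"
  shows "graph_iso W F W' F'"
  using assms
proof (induction "card V" arbitrary: V E \<tau> W F \<rho> W' F' \<rho>' rule: less_induct)
  case less
  note k = less.prems(1) and p = less.prems(2) and n = less.prems(4,6)
  have g: "graph V E" by (rule k_connected_graph[OF k])
  \<comment> \<open>The induction hypothesis is used once below each first step; \<open>N\<close>
    compares the two joining states.\<close>
  have meet: "graph_iso W F W' F'"
    if r: "choppable E \<tau> A B" "choppable E \<tau> C D"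
      and c: "chops_to B (chop E A B) (induced E \<tau> A B) W F \<rho>"
        "chops_to D (chop E C D) (induced E \<tau> C D) W' F' \<rho>'"
      and j: "chops_to B (chop E A B) (induced E \<tau> A B) W1 F1 \<rho>1"
        "chops_to D (chop E C D) (induced E \<tau> C D) W2 F2 \<rho>2"
      and N: "\<And>W0 F0 \<rho>0. chops_to W1 F1 \<rho>1 W0 F0 \<rho>0 \<Longrightarrow> normal F0 \<rho>0 \<Longrightarrow>
         \<exists>W0' F0' \<rho>0'. chops_to W2 F2 \<rho>2 W0' F0' \<rho>0' \<and> normal F0' \<rho>0' \<and> graph_iso W0 F0 W0' F0'"
    for A B C D W1 F1 \<rho>1 W2 F2 \<rho>2
  proof -
    note st1 = choppable_state[OF k p r(1)] and st2 = choppable_state[OF k p r(2)]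
    have "k_connected W1 F1 3" "profile4 W1 F1 \<rho>1" using chops_to_state[OF j(1) st1(1,2)] by auto
    then obtain W0 F0 \<rho>0 where 0: "chops_to W1 F1 \<rho>1 W0 F0 \<rho>0" "normal F0 \<rho>0"
      using chops_to_normal_exists by blast
    then obtain W0' F0' \<rho>0' where 1: "chops_to W2 F2 \<rho>2 W0' F0' \<rho>0'" "normal F0' \<rho>0'"
      "graph_iso W0 F0 W0' F0'" using N by blast
    have "graph_iso W F W0 F0"
      by (rule less.hyps[OF st1(3,1,2) c(1) n(1) chops_to_trans[OF j(1) 0(1)] 0(2)])
    moreover have "graph_iso W0' F0' W' F'"
      by (rule less.hyps[OF st2(3,1,2) chops_to_trans[OF j(2) 1(1)] 1(2) c(2) n(2)])
    ultimately show ?thesis using 1(3) graph_iso_trans by blast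
  qed
  from less.prems(3) show ?case
  proof cases
    case refl
    from less.prems(5) show ?thesis
    proof cases
      case refl
      then show ?thesis using \<open>W = V\<close> \<open>F = E\<close> graph_iso_refl by simp
    next
      case (step A B)
      then show ?thesis using refl n(1) unfolding normal_def by blast
    qed
  next
    case (step A B)
    note ab = step
    from less.prems(5) show ?thesis
    proof cases
      case refl
      then show ?thesis using ab n(2) unfolding normal_def by blast
    next
      case (step C D)
      have t: "(A, B) \<in> \<tau>" "(C, D) \<in> \<tau>" "card (A \<inter> B) = 3" "card (C \<inter> D) = 3"
        "A - B \<noteq> {}" "C - D \<noteq> {}" using ab(1) step(1) unfolding choppable_def by auto
      have s: "is_sep V E A B" "is_sep V E C D" using profile4D(1)[OF p] t by auto
      have big: "B - A \<noteq> {}" "D - C \<noteq> {}" using profile4_big_side[OF p] t by auto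
      note meet' = meet[OF ab(1) step(1) ab(2) step(2)]
      show ?thesis
      proof (cases "card ((A \<union> C) \<inter> (B \<inter> D)) < 4")
        case True
        have u: "(A \<union> C, B \<inter> D) \<in> \<tau>" by (rule profile4_union[OF p g t(1,2) True])
        have "\<not> card ((A \<union> C) \<inter> (B \<inter> D)) < 3"
          using k_connectedD[OF k profile4D(1)[OF p u]] profile4_big_side[OF p u] t(5) by blast
        then have c3: "card ((A \<union> C) \<inter> (B \<inter> D)) = 3" using True by linarith
        show ?thesis
          by (rule meet'[OF chop_supset[OF k p ab(1) u c3] chop_supset[OF k p step(1) u c3]])
            (use graph_iso_refl in blast)+
      next
        case False
        then have "(A \<subseteq> D \<and> C \<subseteq> B) \<or> (\<exists>s t. edge_crossing A B C D s t)"
          using crossing_cases[OF k s t(3,4,5,6) big] by simp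
        then show ?thesis
        proof
          assume le: "A \<subseteq> D \<and> C \<subseteq> B"
          note eq = chop_nested_commute[OF p g ab(1) step(1)]
          have j: "chops_to B (chop E A B) (induced E \<tau> A B) (B \<inter> D) (chop (chop E A B) C (B \<inter> D))
              (induced (chop E A B) (induced E \<tau> A B) C (B \<inter> D))"
            using chop_nested_choppable[OF p g ab(1) step(1)] le
            by (intro chops_to.step[OF _ chops_to.refl]) auto
          have j': "chops_to D (chop E C D) (induced E \<tau> C D) (D \<inter> B) (chop (chop E C D) A (D \<inter> B))
              (induced (chop E C D) (induced E \<tau> C D) A (D \<inter> B))"
            using chop_nested_choppable[OF p g step(1) ab(1)] le
            by (intro chops_to.step[OF _ chops_to.refl]) auto
          show ?thesis
          proof (rule meet'[OF j j'])
            fix W0 F0 \<rho>0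
            assume "chops_to (B \<inter> D) (chop (chop E A B) C (B \<inter> D))
              (induced (chop E A B) (induced E \<tau> A B) C (B \<inter> D)) W0 F0 \<rho>0" "normal F0 \<rho>0"
            then show "\<exists>W0' F0' \<rho>0'. chops_to (D \<inter> B) (chop (chop E C D) A (D \<inter> B))
              (induced (chop E C D) (induced E \<tau> C D) A (D \<inter> B)) W0' F0' \<rho>0' \<and> normal F0' \<rho>0' \<and>
              graph_iso W0 F0 W0' F0'"
              using eq le graph_iso_refl by (metis Int_commute)
          qed
        next
          assume "\<exists>s t. edge_crossing A B C D s t"
          then obtain s t where x: "edge_crossing A B C D s t" by blast
          note x' = edge_crossing_sym[OF x]
          note R = edge_crossing_image[OF x] edge_crossing_chop_eq[OF g \<open>is_sep V E A B\<close> \<open>is_sep V E C D\<close> x]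
            edge_crossing_relabel[OF p g \<open>(A, B) \<in> \<tau>\<close> \<open>(C, D) \<in> \<tau>\<close> \<open>card (A \<inter> B) = 3\<close> \<open>card (C \<inter> D) = 3\<close> x]
          show ?thesis
          proof (rule meet'[OF edge_crossing_chops[OF k p ab(1) step(1) x]
                edge_crossing_chops[OF k p step(1) ab(1) x']])
            fix W0 F0 \<rho>0
            assume a: "chops_to (insert s (B \<inter> D)) (chop (chop E A B) (C - {t}) (insert s (B \<inter> D)))
              (induced (chop E A B) (induced E \<tau> A B) (C - {t}) (insert s (B \<inter> D))) W0 F0 \<rho>0"
              "normal F0 \<rho>0"
            show "\<exists>W0' F0' \<rho>0'. chops_to (insert t (D \<inter> B))
              (chop (chop E C D) (A - {s}) (insert t (D \<inter> B)))
              (induced (chop E C D) (induced E \<tau> C D) (A - {s}) (insert t (D \<inter> B))) W0' F0' \<rho>0' \<and>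
              normal F0' \<rho>0' \<and> graph_iso W0 F0 W0' F0'"
              unfolding R(2,3) unfolding R(1)[symmetric]
              using chops_to_relabel[OF swap_swap[of s t] a(1)] normal_relabel[OF swap_swap[of s t] a(2)]
                graph_iso_relabel[OF swap_swap[of s t]] by blast
          qed
        qed
      qed
    qed
  qed
qed

section \<open>Chopping along a nested family\<close>

text \<open>Prefixes of a claw-freeing enumeration need not be stars, so bag and torso are needed
  for any nested family.\<close>

definition family_bag :: "'a set \<Rightarrow> ('a set \<times> 'a set) set \<Rightarrow> 'a set" where
  "family_bag V S = {x \<in> V. \<forall>(A, B)\<in>S. x \<in> B}"

definition family_torso ::
    "'a set \<Rightarrow> ('a \<Rightarrow> 'a \<Rightarrow> bool) \<Rightarrow> ('a set \<times> 'a set) set \<Rightarrow> 'a \<Rightarrow> 'a \<Rightarrow> bool" where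
  "family_torso V E S = (\<lambda>x y. x \<in> family_bag V S \<and> y \<in> family_bag V S \<and> x \<noteq> y \<and>
     (E x y \<or> (\<exists>(A, B)\<in>S. x \<in> A \<and> y \<in> A)))"

text \<open>Nestedness without the case of two small sides pointing away from each other, which
  would cover \<open>V\<close>.\<close>

definition compatible :: "'a set \<times> 'a set \<Rightarrow> 'a set \<times> 'a set \<Rightarrow> bool" where
  "compatible p q \<longleftrightarrow> fst p \<subseteq> fst q \<and> snd q \<subseteq> snd p \<or> fst q \<subseteq> fst p \<and> snd p \<subseteq> snd q \<or>
     fst p \<subseteq> snd q \<and> fst q \<subseteq> snd p"

text \<open>Only separations nested with the whole family are claimed to restrict to the bag. This
  suffices for the next member of the enumeration and for the last step of
  \<open>normal_torso\<close>.\<close>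

definition represents :: "'a set \<Rightarrow> ('a set \<times> 'a set) set \<Rightarrow> ('a set \<times> 'a set) set
    \<Rightarrow> ('a set \<times> 'a set) set \<Rightarrow> bool" where
  "represents V \<tau> S \<rho> \<longleftrightarrow> (\<forall>A B. (A, B) \<in> \<tau> \<longrightarrow> (\<forall>q\<in>S. compatible (A, B) q) \<longrightarrow>
     (A \<inter> family_bag V S, B \<inter> family_bag V S) \<in> \<rho>)"

lemma family_bag_insert: "family_bag V (insert (C, D) S) = family_bag V S \<inter> D"
  unfolding family_bag_def by blast

lemma family_torso_insert:
  "family_torso V E (insert (C, D) S) = chop (family_torso V E S) (C \<inter> family_bag V S) (D \<inter> family_bag V S)"
  unfolding family_torso_def chop_def family_bag_insert by (intro ext) blast

text \<open>Among the members above \<open>(A, B)\<close> one with the largest first side is taken;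
  no other member can cut into its separator.\<close>

lemma family_max:
  assumes S: "finite S" "S \<subseteq> \<tau>" and p: "profile4 V E \<tau>" and g: "graph V E"
    and S3: "\<And>A B. (A, B) \<in> S \<Longrightarrow> card (A \<inter> B) = 3"
    and nest: "\<And>q r. q \<in> S \<Longrightarrow> r \<in> S \<Longrightarrow> compatible q r"
    and AB: "(A, B) \<in> S"
  obtains A' B' where "(A', B') \<in> S" "A \<subseteq> A'" "B' \<subseteq> B" "A' \<inter> B' \<subseteq> family_bag V S"
proof -
  define U where "U = {q \<in> S. A \<subseteq> fst q \<and> snd q \<subseteq> B}"
  have U: "finite U" "(A, B) \<in> U" using S AB unfolding U_def by auto
  let ?f = "\<lambda>r. card (fst r)"
  have "Max (?f ` U) \<in> ?f ` U" using U by (intro Max_in) auto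
  then obtain q where "q \<in> U" "Max (?f ` U) = ?f q" by blast
  then have q: "q \<in> U" "\<And>r. r \<in> U \<Longrightarrow> card (fst r) \<le> card (fst q)"
    using Max_ge[of "?f ` U"] U(1) by fastforce+
  obtain A1 B1 where q1: "q = (A1, B1)" by (cases q)
  have q2: "(A1, B1) \<in> S" "A \<subseteq> A1" "B1 \<subseteq> B" using q(1) unfolding q1 U_def by auto
  have s1: "is_sep V E A1 B1" using profile4D(1)[OF p] q2(1) S(2) by blast
  have "A1 \<inter> B1 \<subseteq> D" if cd: "(C, D) \<in> S" for C D
  proof -
    have s: "is_sep V E C D" using profile4D(1)[OF p] cd S(2) by blast
    have "compatible (A1, B1) (C, D)" by (rule nest[OF q2(1) cd])
    then consider "C \<subseteq> A1" "B1 \<subseteq> D" | "A1 \<subseteq> D" | "A1 \<subseteq> C" "D \<subseteq> B1"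
      unfolding compatible_def by auto
    then show ?thesis
    proof cases
      case 3
      \<comment> \<open>A member above the chosen one has the same first side by maximality, hence
        the same separator by its size.\<close>
      then have "(C, D) \<in> U" using q2 cd unfolding U_def by auto
      then have le: "card C \<le> card A1" using q(2) unfolding q1 by fastforce
      have "finite C" using is_sep_subset[OF s] graphD(1)[OF g] finite_subset by blast
      then have AC: "A1 = C" using 3(1) le by (metis card_seteq)
      have "A1 \<inter> D = A1 \<inter> B1"
      proof (rule card_subset_eq)
        show "finite (A1 \<inter> B1)" using \<open>finite C\<close> AC by simp
        show "A1 \<inter> D \<subseteq> A1 \<inter> B1" using 3 by blast
        show "card (A1 \<inter> D) = card (A1 \<inter> B1)" using S3[OF cd] S3[OF q2(1)] AC by simp
      qed
      then show ?thesis by blast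
    qed blast+
  qed
  then have "A1 \<inter> B1 \<subseteq> family_bag V S"
    using is_sep_subset[OF s1] unfolding family_bag_def by blast
  then show thesis using that q2 by blast
qed

text \<open>Either earlier chops have already removed the inside of \<open>C\<close>, and the state
  stays, or what is left of \<open>C\<close> contains a cycle and is chopped off.\<close>

lemma chop_family_insert:
  assumes k: "k_connected V E 3" and p: "profile4 V E \<tau>"
    and S: "finite S" "S \<subseteq> \<tau>"
    and S3: "\<And>A B. (A, B) \<in> S \<Longrightarrow> card (A \<inter> B) = 3"
    and S0: "\<And>A B. (A, B) \<in> S \<Longrightarrow> A - B \<noteq> {}"
    and nest: "\<And>q r. q \<in> S \<Longrightarrow> r \<in> S \<Longrightarrow> compatible q r"
    and reach: "chops_to V E \<tau> (family_bag V S) (family_torso V E S) \<rho>"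
    and rep: "represents V \<tau> S \<rho>"
    and CD: "(C, D) \<in> \<tau>" "card (C \<inter> D) = 3" "C - D \<noteq> {}" "\<And>q. q \<in> S \<Longrightarrow> compatible (C, D) q"
    and cyc: "has_cycle E C \<or> (\<exists>(A, B)\<in>S. 2 \<le> card ((C \<inter> D) \<inter> (A \<inter> B)))"
  shows "\<exists>\<rho>'. chops_to V E \<tau> (family_bag V (insert (C, D) S)) (family_torso V E (insert (C, D) S)) \<rho>'
    \<and> represents V \<tau> (insert (C, D) S) \<rho>'"
proof -
  let ?Z = "family_bag V S" and ?F = "family_torso V E S"
  have g: "graph V E" by (rule k_connected_graph[OF k])
  have sCD: "is_sep V E C D" by (rule profile4D(1)[OF p CD(1)])
  have sub: "C \<subseteq> V" "D \<subseteq> V" "C \<union> D = V" using is_sep_subset[OF sCD] is_sep_Un[OF sCD] by auto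
  have fC: "finite C" using sub(1) graphD(1)[OF g] finite_subset by blast
  have ZV: "?Z \<subseteq> V" unfolding family_bag_def by blast
  have kF: "k_connected ?Z ?F 3" and pF: "profile4 ?Z ?F \<rho>"
    using chops_to_state[OF reach k p] by auto
  have gF: "graph ?Z ?F" by (rule k_connected_graph[OF kF])
  have in\<rho>: "(C \<inter> ?Z, D \<inter> ?Z) \<in> \<rho>" using rep CD(1,4) unfolding represents_def by blast
  have cases: "C \<subseteq> A \<and> B \<subseteq> D \<or> A \<subseteq> C \<and> D \<subseteq> B \<or> C \<subseteq> B \<and> A \<subseteq> D" if "(A, B) \<in> S" for A B
    using CD(4)[OF that] unfolding compatible_def by auto
  \<comment> \<open>A member that does not point towards \<open>(C, D)\<close> either swallows
    \<open>C\<close> or lies below it; in the latter case a maximal member above it swallows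
    \<open>C\<close> or has left its triangle inside \<open>C\<close>.\<close>
  have clique: "\<exists>A B. (A, B) \<in> S \<and> (C \<subseteq> A \<and> B \<subseteq> D \<or> A \<inter> B \<subseteq> C \<inter> ?Z \<and> A \<subseteq> C)"
    if AB: "(A0, B0) \<in> S" "\<not> (C \<subseteq> B0 \<and> A0 \<subseteq> D)" for A0 B0
  proof -
    from cases[OF AB(1)] AB(2) consider "C \<subseteq> A0" "B0 \<subseteq> D" | "A0 \<subseteq> C" "D \<subseteq> B0" by blast
    then show ?thesis
    proof cases
      case 1
      then show ?thesis using AB(1) by blast
    next
      case 2
      obtain A B where m: "(A, B) \<in> S" "A0 \<subseteq> A" "B \<subseteq> B0" "A \<inter> B \<subseteq> ?Z"
        using family_max[OF S p g S3 nest AB(1)] by blast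
      from cases[OF m(1)] have "\<not> (C \<subseteq> B \<and> A \<subseteq> D)" using m 2 S0[OF AB(1)] by blast
      then show ?thesis using cases[OF m(1)] m by blast
    qed
  qed
  have not_all: "\<exists>A B. (A, B) \<in> S \<and> \<not> (C \<subseteq> B \<and> A \<subseteq> D)" if "\<not> C \<subseteq> ?Z"
  proof -
    obtain c where "c \<in> C" "c \<notin> ?Z" using \<open>\<not> C \<subseteq> ?Z\<close> by blast
    then obtain A B where "(A, B) \<in> S" "c \<notin> B" using sub(1) unfolding family_bag_def by blast
    then show ?thesis using \<open>c \<in> C\<close> by blast
  qed
  show ?thesis
  proof (cases "C \<inter> ?Z \<subseteq> D")
    case True
    have ZD: "?Z \<inter> D = ?Z" using True ZV sub by blast
    then have bag: "family_bag V (insert (C, D) S) = ?Z" by (simp add: family_bag_insert)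
    obtain A B where AB: "(A, B) \<in> S" "C \<subseteq> A \<and> B \<subseteq> D \<or> A \<inter> B \<subseteq> C \<inter> ?Z \<and> A \<subseteq> C"
      using not_all clique CD(3) True by blast
    \<comment> \<open>The remaining part of \<open>C\<close> must already be a clique of the torso:
      it lies in a swallowing member, or an earlier triangle fills the whole separator.\<close>
    have CA: "C \<inter> ?Z \<subseteq> A"
    proof (cases "C \<subseteq> A")
      case False
      then have le: "A \<inter> B \<subseteq> C \<inter> ?Z" using AB(2) by blast
      have "A \<inter> B = C \<inter> D"
      proof (rule card_subset_eq)
        show "finite (C \<inter> D)" using fC by simp
        show "A \<inter> B \<subseteq> C \<inter> D" using le True by blast
        show "card (A \<inter> B) = card (C \<inter> D)" using S3[OF AB(1)] CD(2) by simp
      qed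
      then show ?thesis using True by blast
    qed blast
    have "family_torso V E (insert (C, D) S) = ?F"
      unfolding family_torso_def bag using AB(1) CA by (intro ext) blast
    moreover have "represents V \<tau> (insert (C, D) S) \<rho>"
      using rep unfolding represents_def bag by blast
    ultimately show ?thesis using reach bag by auto
  next
    case False
    have noA: "\<not> (C \<subseteq> A \<and> B \<subseteq> D)" if "(A, B) \<in> S" for A B
      using False that unfolding family_bag_def by blast
    have TZ: "C \<inter> D \<subseteq> ?Z"
    proof -
      have "C \<inter> D \<subseteq> B" if "(A, B) \<in> S" for A B using cases[OF that] noA[OF that] by blast
      then show ?thesis using sub unfolding family_bag_def by blast
    qed
    then have sep: "(C \<inter> ?Z) \<inter> (D \<inter> ?Z) = C \<inter> D" by blast
    have "has_cycle ?F (C \<inter> ?Z)"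
    proof (cases "\<exists>A B. (A, B) \<in> S \<and> \<not> (C \<subseteq> B \<and> A \<subseteq> D)")
      case True
      then obtain A B where AB: "(A, B) \<in> S" "A \<inter> B \<subseteq> C \<inter> ?Z" using clique noA by blast
      show ?thesis
        by (rule clique_has_cycle[OF S3[OF AB(1)] AB(2)]) (use AB in \<open>auto simp: family_torso_def\<close>)
    next
      case all: False
      \<comment> \<open>Here \<open>C\<close> is still intact, so its own cycle survives if it has
        one.\<close>
      then have CZ: "C \<subseteq> ?Z" using not_all by blast
      show ?thesis
      proof (cases "has_cycle E C")
        case True
        show ?thesis
          by (rule has_cycle_mono[OF True])
            (use CZ graphD(4)[OF g] in \<open>auto simp: family_torso_def\<close>)
      next
        case nc: False
        then obtain A B where AB: "(A, B) \<in> S" "2 \<le> card ((C \<inter> D) \<inter> (A \<inter> B))" using cyc by blast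
        then obtain x y where xy: "x \<in> C \<inter> D \<inter> (A \<inter> B)" "y \<in> C \<inter> D \<inter> (A \<inter> B)" "x \<noteq> y"
          using fC by (metis One_nat_def Suc_1 card_le_Suc0_iff_eq finite_Int not_less_eq_eq)
        then have "?F x y" using AB(1) TZ unfolding family_torso_def by blast
        show ?thesis
        \<comment> \<open>An acyclic side would be a claw with independent separator, but the shared
          vertices \<open>x\<close> and \<open>y\<close> are joined by an earlier triangle.\<close>
        proof (rule ccontr)
          assume "\<not> ?thesis"
          then obtain v where "\<And>x y. x \<in> (C \<inter> ?Z) \<inter> (D \<inter> ?Z) \<Longrightarrow> y \<in> (C \<inter> ?Z) \<inter> (D \<inter> ?Z) \<Longrightarrow> \<not> ?F x y"
            using acyclic_side_claw[OF kF profile4D(1)[OF pF in\<rho>]] sep CD(2) False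
              profile4_big_side[OF pF in\<rho>] by (metis Diff_eq_empty_iff Int_lower2 le_inf_iff)
          then show False using \<open>?F x y\<close> xy TZ by blast
        qed
      qed
    qed
    moreover have "C \<inter> ?Z - D \<inter> ?Z \<noteq> {}" using False by blast
    ultimately have r: "choppable ?F \<rho> (C \<inter> ?Z) (D \<inter> ?Z)"
      unfolding choppable_def using in\<rho> sep CD(2) by simp
    let ?\<rho> = "induced ?F \<rho> (C \<inter> ?Z) (D \<inter> ?Z)"
    have bag: "family_bag V (insert (C, D) S) = D \<inter> ?Z" by (simp add: family_bag_insert Int_commute)
    have "chops_to V E \<tau> (family_bag V (insert (C, D) S)) (family_torso V E (insert (C, D) S)) ?\<rho>"
      unfolding bag family_torso_insert
      by (rule chops_to_trans[OF reach chops_to.step[OF r chops_to.refl]])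
    moreover have "represents V \<tau> (insert (C, D) S) ?\<rho>"
      unfolding represents_def bag
    proof (intro allI impI)
      fix A B
      assume AB: "(A, B) \<in> \<tau>" and c: "\<forall>q\<in>insert (C, D) S. compatible (A, B) q"
      have ABr: "(A \<inter> ?Z, B \<inter> ?Z) \<in> \<rho>" using rep AB c unfolding represents_def by blast
      have sAB: "is_sep V E A B" by (rule profile4D(1)[OF p AB])
      note VAB = is_sep_Un[OF sAB]
      note s\<rho> = profile4D(1)[OF pF ABr]
      have s: "is_sep (D \<inter> ?Z) (chop ?F (C \<inter> ?Z) (D \<inter> ?Z)) (A \<inter> (D \<inter> ?Z)) (B \<inter> (D \<inter> ?Z))"
        unfolding is_sep_def
      proof (intro conjI ballI notI)
        show "A \<inter> (D \<inter> ?Z) \<union> B \<inter> (D \<inter> ?Z) = D \<inter> ?Z" using VAB ZV by blast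
        fix x y assume x: "x \<in> A \<inter> (D \<inter> ?Z) - B \<inter> (D \<inter> ?Z)" and y: "y \<in> B \<inter> (D \<inter> ?Z) - A \<inter> (D \<inter> ?Z)"
          and xy: "chop ?F (C \<inter> ?Z) (D \<inter> ?Z) x y"
        have "\<not> ?F x y" using s\<rho> x y unfolding is_sep_def by blast
        then have "x \<in> C" "y \<in> C" using xy unfolding chop_def by blast+
        moreover have "compatible (A, B) (C, D)" using c by blast
        ultimately show False using x y unfolding compatible_def by auto
      qed
      have fAB: "finite (A \<inter> B)"
        using is_sep_subset[OF sAB] graphD(1)[OF g] by (meson finite_Int finite_subset)
      have "card ((A \<inter> (D \<inter> ?Z)) \<inter> (B \<inter> (D \<inter> ?Z))) \<le> card (A \<inter> B)"
        by (rule card_mono[OF fAB]) blast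
      then have card: "card ((A \<inter> (D \<inter> ?Z)) \<inter> (B \<inter> (D \<inter> ?Z))) < 4"
        using profile4D(2)[OF p AB] by simp
      have "compatible (A, B) (C, D)" using c by blast
      then consider "A \<subseteq> C" "D \<subseteq> B" | "C \<subseteq> A" "B \<subseteq> D" | "A \<subseteq> D" "C \<subseteq> B"
        unfolding compatible_def by auto
      then show "(A \<inter> (D \<inter> ?Z), B \<inter> (D \<inter> ?Z)) \<in> ?\<rho>"
      proof cases
        case 1
        \<comment> \<open>A member below \<open>(C, D)\<close> is cut down to fewer than four
          vertices, so its orientation is forced.\<close>
        then have "A \<inter> (D \<inter> ?Z) \<subseteq> A \<inter> B" by blast
        then have "card (A \<inter> (D \<inter> ?Z)) \<le> card (A \<inter> B)" by (rule card_mono[OF fAB])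
        then have "(A \<inter> (D \<inter> ?Z), ?Z) \<in> \<rho>"
          using profile4_small[OF pF, of "A \<inter> (D \<inter> ?Z)"] profile4D(2)[OF p AB] by auto
        moreover have "B \<inter> (D \<inter> ?Z) \<union> C \<inter> ?Z = ?Z" using 1 sub ZV by blast
        ultimately show ?thesis using 1 by (intro inducedI2[OF s card]) auto
      next
        case 2
        have "A \<inter> (D \<inter> ?Z) \<union> C \<inter> ?Z = A \<inter> ?Z" "B \<inter> (D \<inter> ?Z) = B \<inter> ?Z" using 2 sub ZV by blast+
        then show ?thesis using 2 ABr by (intro inducedI1[OF s card]) auto
      next
        case 3
        have "A \<inter> (D \<inter> ?Z) = A \<inter> ?Z" "B \<inter> (D \<inter> ?Z) \<union> C \<inter> ?Z = B \<inter> ?Z" using 3 sub ZV by blast+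
        then show ?thesis using 3 ABr by (intro inducedI2[OF s card]) auto
      qed
    qed
    ultimately show ?thesis by blast
  qed
qed

lemma chop_family:
  assumes k: "k_connected V E 3" and p: "profile4 V E \<tau>"
    and sub: "set qs \<subseteq> \<tau>"
    and S3: "\<And>A B. (A, B) \<in> set qs \<Longrightarrow> card (A \<inter> B) = 3"
    and S0: "\<And>A B. (A, B) \<in> set qs \<Longrightarrow> A - B \<noteq> {}"
    and nest: "\<And>q r. q \<in> set qs \<Longrightarrow> r \<in> set qs \<Longrightarrow> compatible q r"
    and enum: "\<And>i. i < length qs \<Longrightarrow> has_cycle E (fst (qs ! i)) \<or>
      (\<exists>j<i. 2 \<le> card ((fst (qs ! i) \<inter> snd (qs ! i)) \<inter> (fst (qs ! j) \<inter> snd (qs ! j))))"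
  shows "\<exists>\<rho>. chops_to V E \<tau> (family_bag V (set qs)) (family_torso V E (set qs)) \<rho>
    \<and> represents V \<tau> (set qs) \<rho>"
  using sub S3 S0 nest enum
proof (induction qs rule: rev_induct)
  case Nil
  have g: "graph V E" by (rule k_connected_graph[OF k])
  have bag: "family_bag V {} = V" by (simp add: family_bag_def)
  have tor: "family_torso V E {} = E"
  proof (intro ext)
    show "family_torso V E {} x y = E x y" for x y
      unfolding family_torso_def bag using graphD(2-4)[OF g, of x y] by blast
  qed
  have "represents V \<tau> {} \<tau>"
    unfolding represents_def bag using is_sep_subset[OF profile4D(1)[OF p]] by (simp add: Int_absorb2)
  then show ?case using chops_to.refl bag tor by auto
next
  case (snoc q qs)
  obtain C D where q: "q = (C, D)" by (cases q)
  have "has_cycle E (fst (qs ! i)) \<or>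
      (\<exists>j<i. 2 \<le> card ((fst (qs ! i) \<inter> snd (qs ! i)) \<inter> (fst (qs ! j) \<inter> snd (qs ! j))))"
    if "i < length qs" for i
    using snoc.prems(5)[of i] that by (auto simp: nth_append)
  then have "\<exists>\<rho>. chops_to V E \<tau> (family_bag V (set qs)) (family_torso V E (set qs)) \<rho>
    \<and> represents V \<tau> (set qs) \<rho>"
    using snoc.prems(1-4) by (intro snoc.IH) auto
  then obtain \<rho> where \<rho>: "chops_to V E \<tau> (family_bag V (set qs)) (family_torso V E (set qs)) \<rho>"
    "represents V \<tau> (set qs) \<rho>" by blast
  have cyc: "has_cycle E C \<or> (\<exists>(A, B)\<in>set qs. 2 \<le> card ((C \<inter> D) \<inter> (A \<inter> B)))"
  proof -
    have "has_cycle E C \<or> (\<exists>j<length qs. 2 \<le> card ((C \<inter> D) \<inter> (fst (qs ! j) \<inter> snd (qs ! j))))"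
      using snoc.prems(5)[of "length qs"] by (auto simp: nth_append q)
    then show ?thesis by (metis (mono_tags, lifting) case_prod_unfold nth_mem)
  qed
  have "insert (C, D) (set qs) = set (qs @ [q])" by (simp add: q)
  moreover have "\<exists>\<rho>'. chops_to V E \<tau> (family_bag V (insert (C, D) (set qs)))
      (family_torso V E (insert (C, D) (set qs))) \<rho>' \<and> represents V \<tau> (insert (C, D) (set qs)) \<rho>'"
    by (rule chop_family_insert[OF k p _ _ _ _ _ \<rho> _ _ _ _ cyc])
      (use snoc.prems(1-4) q in auto)
  ultimately show ?case by simp
qed

section \<open>The splitting star of a maximal 3-chop\<close>

lemma tangleD:
  assumes "tangle V E k \<tau>"
  shows "(A, B) \<in> \<tau> \<Longrightarrow> is_sep V E A B" "(A, B) \<in> \<tau> \<Longrightarrow> card (A \<inter> B) < k"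
    "is_sep V E A B \<Longrightarrow> card (A \<inter> B) < k \<Longrightarrow> (A, B) \<in> \<tau> \<or> (B, A) \<in> \<tau>"
proof -
  have "\<forall>(A, B)\<in>\<tau>. is_sep V E A B \<and> card (A \<inter> B) < k"
    using assms unfolding tangle_def by (rule conjunct1)
  then show "(A, B) \<in> \<tau> \<Longrightarrow> is_sep V E A B" "(A, B) \<in> \<tau> \<Longrightarrow> card (A \<inter> B) < k" by auto
  have "\<forall>A B. is_sep V E A B \<and> card (A \<inter> B) < k \<longrightarrow>
        ((A, B) \<in> \<tau> \<or> (B, A) \<in> \<tau>) \<and> ((A, B) \<in> \<tau> \<and> (B, A) \<in> \<tau> \<longrightarrow> A = B)"
    using assms unfolding tangle_def by (rule conjunct1[OF conjunct2])
  then show "is_sep V E A B \<Longrightarrow> card (A \<inter> B) < k \<Longrightarrow> (A, B) \<in> \<tau> \<or> (B, A) \<in> \<tau>" by auto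
qed

lemma tangle_no_cover:
  assumes "tangle V E k \<tau>" "(A1, B1) \<in> \<tau>" "(A2, B2) \<in> \<tau>" "(A3, B3) \<in> \<tau>"
    and "V \<subseteq> A1 \<union> A2 \<union> A3"
    and "\<And>x y. E x y \<Longrightarrow> x \<in> A1 \<and> y \<in> A1 \<or> x \<in> A2 \<and> y \<in> A2 \<or> x \<in> A3 \<and> y \<in> A3"
  shows False
proof -
  note s = tangleD(1)[OF assms(1)]
  have "A1 \<union> A2 \<union> A3 = V"
    using assms(5) is_sep_subset[OF s[OF assms(2)]] is_sep_subset[OF s[OF assms(3)]]
      is_sep_subset[OF s[OF assms(4)]] by blast
  moreover have "\<not> (\<exists>A1 B1 A2 B2 A3 B3. (A1, B1) \<in> \<tau> \<and> (A2, B2) \<in> \<tau> \<and> (A3, B3) \<in> \<tau> \<and>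
      A1 \<union> A2 \<union> A3 = V \<and>
      (\<forall>x y. E x y \<longrightarrow> (x \<in> A1 \<and> y \<in> A1) \<or> (x \<in> A2 \<and> y \<in> A2) \<or> (x \<in> A3 \<and> y \<in> A3)))"
    using assms(1) unfolding tangle_def by (rule conjunct2[OF conjunct2])
  ultimately show False using assms(2-4,6) by blast
qed

text \<open>A vertex or edge contained in neither \<open>A\<close> nor \<open>C\<close> lies in
  \<open>B \<inter> D\<close>, so an inconsistent triple would cover the graph.\<close>

lemma tangle_profile4:
  assumes t: "tangle V E 4 \<tau>" and g: "graph V E"
  shows "profile4 V E \<tau>"
proof -
  note s = tangleD(1,2)[OF t] and o = tangleD(3)[OF t]
  have c: "(B \<inter> D, A \<union> C) \<notin> \<tau>" if m: "(A, B) \<in> \<tau>" "(C, D) \<in> \<tau>" for A B C D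
  proof
    assume m': "(B \<inter> D, A \<union> C) \<in> \<tau>"
    have s1: "is_sep V E A B" "is_sep V E C D" by (rule s(1)[OF m(1)], rule s(1)[OF m(2)])
    show False
    proof (rule tangle_no_cover[OF t m m'])
      show "V \<subseteq> A \<union> C \<union> B \<inter> D" using s1 unfolding is_sep_def by blast
      fix x y assume "E x y"
      then show "x \<in> A \<and> y \<in> A \<or> x \<in> C \<and> y \<in> C \<or> x \<in> B \<inter> D \<and> y \<in> B \<inter> D"
        using is_sep_edge[OF g s1(1)] is_sep_edge[OF g s1(2)] by blast
    qed
  qed
  have "(V, X) \<notin> \<tau>" for X
  proof
    assume v: "(V, X) \<in> \<tau>"
    show False by (rule tangle_no_cover[OF t v v v]) (use graphD[OF g] in blast)+
  qed
  then show ?thesis unfolding profile4_def using s o c by blast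
qed

lemma nested_sym: "nested s t \<Longrightarrow> nested t s"
  unfolding nested_def by blast

lemma nested_refl: "nested {A, B} {A, B}"
  unfolding nested_def orientations_def sep_le_def by blast

locale chop_star =
  fixes V :: "'a set" and E :: "'a \<Rightarrow> 'a \<Rightarrow> bool" and \<tau> \<sigma> :: "('a set \<times> 'a set) set"
    and N :: "'a set set set"
  assumes k3: "k_connected V E 3" and tangle: "tangle V E 4 \<tau>" and max_chop: "max_chop3 V E N"
    and splitting: "splitting_star N \<sigma>" and star_tangle: "\<sigma> \<subseteq> \<tau>"
begin

section \<open>The 3-chop oriented by the tangle\<close>

lemma graph: "graph V E"
  by (rule k_connected_graph[OF k3])

lemma profile: "profile4 V E \<tau>"
  by (rule tangle_profile4[OF tangle graph])

text \<open>The enumeration runs through all of \<open>N\<close>, while \<open>\<sigma>\<close> has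
  only elements above all others. Bag and torso come out the same for both.\<close>

definition oriented :: "('a set \<times> 'a set) set" where
  "oriented = {(A, B) \<in> \<tau>. {A, B} \<in> N}"

abbreviation "Z \<equiv> bag V \<sigma>"
abbreviation "H \<equiv> torso V E \<sigma>"

lemma proper: "s \<in> N \<Longrightarrow> proper3 V E s"
  using max_chop unfolding max_chop3_def chop3_def by blast

text \<open>Excludes the one kind of nestedness that \<open>compatible\<close> omits.\<close>

lemma no_cover: "(A, B) \<in> \<tau> \<Longrightarrow> (C, D) \<in> \<tau> \<Longrightarrow> B \<subseteq> C \<Longrightarrow> D \<subseteq> A \<Longrightarrow> False"
proof -
  assume a: "(A, B) \<in> \<tau>" "(C, D) \<in> \<tau>" "B \<subseteq> C" "D \<subseteq> A"
  have s: "is_sep V E A B" "is_sep V E C D" using profile4D(1)[OF profile] a by blast+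
  have "finite (A \<inter> B)" using is_sep_subset[OF s(1)] graphD(1)[OF graph] by (meson finite_Int finite_subset)
  then have "card (B \<inter> D) \<le> card (A \<inter> B)" using a by (intro card_mono) auto
  then have "card (B \<inter> D) < 4" using profile4D(2)[OF profile a(1)] by simp
  moreover have "A \<union> C = V" using a is_sep_Un[OF s(1)] is_sep_Un[OF s(2)] by blast
  ultimately show False using profile4_no_cover[OF profile graph a(1,2)] by blast
qed

lemma oriented_props:
  assumes "(A, B) \<in> oriented"
  shows "(A, B) \<in> \<tau>" "is_sep V E A B" "card (A \<inter> B) = 3" "A - B \<noteq> {}" "B - A \<noteq> {}"
proof -
  show t: "(A, B) \<in> \<tau>" using assms unfolding oriented_def by blast
  show "is_sep V E A B" by (rule profile4D(1)[OF profile t])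
  obtain C D where "{A, B} = {C, D}" "card (C \<inter> D) = 3" "proper_sep C D"
  proof -
    have "{A, B} \<in> N" using assms unfolding oriented_def by blast
    from proper[OF this] show ?thesis unfolding proper3_def by (elim exE conjE) (rule that)
  qed
  then show "card (A \<inter> B) = 3" "A - B \<noteq> {}" "B - A \<noteq> {}"
    unfolding proper_sep_def by (auto simp: doubleton_eq_iff Int_commute)
qed

lemma oriented_exists:
  assumes "s \<in> N"
  obtains A B where "s = {A, B}" "(A, B) \<in> oriented"
proof -
  obtain C D where s: "s = {C, D}" "is_sep V E C D" "card (C \<inter> D) = 3"
    using proper[OF assms] unfolding proper3_def by blast
  then have "(C, D) \<in> \<tau> \<or> (D, C) \<in> \<tau>" using profile4D(3)[OF profile] by simp
  then show thesis using that s(1) assms unfolding oriented_def by (metis (mono_tags, lifting) case_prodI insert_commute mem_Collect_eq)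
qed

lemma oriented_le:
  assumes ab: "(A, B) \<in> oriented"
  obtains C D where "(C, D) \<in> \<sigma>" "A \<subseteq> C" "D \<subseteq> B"
proof -
  have "{A, B} \<in> N" using ab unfolding oriented_def by blast
  then obtain p q where pq: "p \<in> orientations {A, B}" "q \<in> \<sigma>" "sep_le p q"
    using splitting unfolding splitting_star_def by blast
  obtain C D where q: "q = (C, D)" by (cases q)
  have "p = (A, B) \<or> p = (B, A)" using pq(1) unfolding orientations_def by (auto simp: doubleton_eq_iff)
  then show thesis
  proof
    assume "p = (A, B)"
    then show thesis using that pq unfolding q sep_le_def by auto
  next
    assume "p = (B, A)"
    then show thesis
      using no_cover[of A B C D] pq star_tangle oriented_props(1)[OF ab] unfolding q sep_le_def by auto
  qed
qed

lemma star_oriented: "\<sigma> \<subseteq> oriented"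
proof clarify
  fix A B assume ab: "(A, B) \<in> \<sigma>"
  then obtain s where "s \<in> N" "(A, B) \<in> orientations s"
    using splitting unfolding splitting_star_def by blast
  then show "(A, B) \<in> oriented"
    using ab star_tangle unfolding oriented_def orientations_def by auto
qed

lemma star_far:
  "(A, B) \<in> \<sigma> \<Longrightarrow> (C, D) \<in> \<sigma> \<Longrightarrow> (A, B) \<noteq> (C, D) \<Longrightarrow> A \<subseteq> D \<and> C \<subseteq> B"
  using splitting unfolding splitting_star_def star_def sep_le_def by fastforce

lemmas star_props = oriented_props[OF subsetD[OF star_oriented]]

lemma bag_eq: "Z = {x \<in> V. \<forall>(A, B)\<in>\<sigma>. x \<in> B}"
proof -
  have BV: "B \<subseteq> V" if "(A, B) \<in> \<sigma>" for A B using is_sep_subset[OF star_props(2)[OF that]] by blast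
  show ?thesis
  proof (cases "\<sigma> = {}")
    case False
    then obtain A B where "(A, B) \<in> \<sigma>" by auto
    then have "(\<Inter>p\<in>\<sigma>. snd p) \<subseteq> V" using BV[of A B] INT_lower[of "(A, B)" \<sigma> snd] by auto
    then show ?thesis using False unfolding bag_def by auto
  qed (simp add: bag_def)
qed

lemma finite_bag: "finite Z"
  unfolding bag_eq using graphD(1)[OF graph] by simp

lemma bag_family: "Z = family_bag V oriented"
proof -
  have "x \<in> B" if h: "(A, B) \<in> oriented" "\<forall>(A, B)\<in>\<sigma>. x \<in> B" for x A B
  proof -
    obtain C D where "(C, D) \<in> \<sigma>" "D \<subseteq> B" using oriented_le[OF h(1)] by metis
    then show ?thesis using h(2) by blast
  qed
  then have "(\<forall>(A, B)\<in>oriented. x \<in> B) \<longleftrightarrow> (\<forall>(A, B)\<in>\<sigma>. x \<in> B)" for x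
    using star_oriented by blast
  then show ?thesis unfolding bag_eq family_bag_def by simp
qed

lemma bag_inter: "(A, B) \<in> \<sigma> \<Longrightarrow> A \<inter> Z \<subseteq> A \<inter> B"
  unfolding bag_eq by blast

lemma separator_bag:
  assumes ab: "(A, B) \<in> \<sigma>"
  shows "A \<inter> B \<subseteq> Z"
proof -
  have "A \<inter> B \<subseteq> D" if "(C, D) \<in> \<sigma>" for C D
    using star_far[OF ab that] by (cases "(A, B) = (C, D)") auto
  then show ?thesis unfolding bag_eq using is_sep_subset[OF star_props(2)[OF ab]] by blast
qed

lemma torso_family: "H = family_torso V E oriented"
proof (intro ext)
  fix x y
  have "(\<exists>(A, B)\<in>\<sigma>. x \<in> A \<inter> B \<and> y \<in> A \<inter> B) \<longleftrightarrow> (\<exists>(A, B)\<in>oriented. x \<in> A \<and> y \<in> A)"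
    if xy: "x \<in> Z" "y \<in> Z"
  proof
    assume "\<exists>(A, B)\<in>\<sigma>. x \<in> A \<inter> B \<and> y \<in> A \<inter> B"
    then show "\<exists>(A, B)\<in>oriented. x \<in> A \<and> y \<in> A" using star_oriented by blast
  next
    assume "\<exists>(A, B)\<in>oriented. x \<in> A \<and> y \<in> A"
    then obtain A B where "(A, B) \<in> oriented" "x \<in> A" "y \<in> A" by blast
    then obtain C D where "(C, D) \<in> \<sigma>" "x \<in> C" "y \<in> C" using oriented_le by (metis subsetD)
    then show "\<exists>(A, B)\<in>\<sigma>. x \<in> A \<inter> B \<and> y \<in> A \<inter> B" using bag_inter xy by blast
  qed
  then show "H x y = family_torso V E oriented x y"
    unfolding torso_def family_torso_def bag_family[symmetric] by blast
qed

lemma oriented_compatible: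
  assumes q: "q \<in> oriented" "r \<in> oriented"
  shows "compatible q r"
proof -
  obtain A B C D where qr: "q = (A, B)" "r = (C, D)" by (cases q, cases r)
  have t: "(A, B) \<in> \<tau>" "(C, D) \<in> \<tau>" using oriented_props(1) q unfolding qr by blast+
  have "nested {A, B} {C, D}"
    using max_chop q unfolding qr max_chop3_def chop3_def oriented_def by blast
  then obtain p p' where pp: "p \<in> orientations {A, B}" "p' \<in> orientations {C, D}" "sep_le p p' \<or> sep_le p' p"
    unfolding nested_def by blast
  have "p = (A, B) \<or> p = (B, A)" "p' = (C, D) \<or> p' = (D, C)"
    using pp unfolding orientations_def by (auto simp: doubleton_eq_iff)
  then show ?thesis
    using pp(3) no_cover[OF t] no_cover[OF t(2,1)] unfolding qr compatible_def sep_le_def by auto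
qed

text \<open>The claw-freeing enumeration is the order of the chops. A claw-free member has cycles on
  both sides, hence on its small side whichever that is.\<close>

lemma chops_to_torso: "\<exists>\<rho>. chops_to V E \<tau> Z H \<rho> \<and> represents V \<tau> oriented \<rho>"
proof -
  obtain ss where ss: "set ss = N"
    "\<And>i. i < length ss \<Longrightarrow> claw_free V E (ss ! i) \<or>
       (\<exists>j<i. card (separator (ss ! i) \<inter> separator (ss ! j)) \<ge> 2)"
    using max_chop unfolding max_chop3_def chop3_def claw_freeable_def by blast
  have "\<forall>s\<in>N. \<exists>q. q \<in> oriented \<and> s = {fst q, snd q}"
    using oriented_exists by (metis fst_conv snd_conv)
  then obtain f where f: "\<And>s. s \<in> N \<Longrightarrow> f s \<in> oriented \<and> s = {fst (f s), snd (f s)}" by metis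
  let ?qs = "map f ss"
  \<comment> \<open>No separation in \<open>N\<close> has both orientations in
    \<open>\<tau>\<close>, so the choice \<open>f\<close> misses none of
    \<open>oriented\<close>.\<close>
  have "q \<in> f ` N" if "q \<in> oriented" for q
  proof -
    obtain A B where q: "q = (A, B)" by (cases q)
    let ?s = "{A, B}"
    have s: "?s \<in> N" using that q unfolding oriented_def by blast
    obtain A' B' where f': "f ?s = (A', B')" by (cases "f ?s")
    have "(A', B') \<in> oriented" "{A, B} = {A', B'}" using f[OF s] f' by auto
    then have "f ?s = q"
      using f' that profile4_antisym[OF profile] unfolding q by (auto simp: doubleton_eq_iff dest!: oriented_props(1))
    then show ?thesis using s by blast
  qed
  then have set: "set ?qs = oriented" using f ss(1) by auto
  have "\<exists>\<rho>. chops_to V E \<tau> (family_bag V (set ?qs)) (family_torso V E (set ?qs)) \<rho>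
    \<and> represents V \<tau> (set ?qs) \<rho>"
  proof (rule chop_family[OF k3 profile])
    show "set ?qs \<subseteq> \<tau>" unfolding set using oriented_props(1) by auto
    show "(A, B) \<in> set ?qs \<Longrightarrow> card (A \<inter> B) = 3" for A B unfolding set by (rule oriented_props(3))
    show "(A, B) \<in> set ?qs \<Longrightarrow> A - B \<noteq> {}" for A B unfolding set by (rule oriented_props(4))
    show "q \<in> set ?qs \<Longrightarrow> r \<in> set ?qs \<Longrightarrow> compatible q r" for q r unfolding set by (rule oriented_compatible)
    fix i assume "i < length ?qs"
    then have i: "i < length ss" by simp
    have F: "?qs ! j = f (ss ! j)" "ss ! j = {fst (f (ss ! j)), snd (f (ss ! j))}"
      "separator (ss ! j) = fst (?qs ! j) \<inter> snd (?qs ! j)" if "j < length ss" for j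
    proof -
      have "ss ! j \<in> N" using that ss(1) by auto
      from f[OF this] show fs: "ss ! j = {fst (f (ss ! j)), snd (f (ss ! j))}" by blast
      show qj: "?qs ! j = f (ss ! j)" using that by simp
      show "separator (ss ! j) = fst (?qs ! j) \<inter> snd (?qs ! j)"
        unfolding separator_def qj by (subst fs) simp
    qed
    from ss(2)[OF i] show "has_cycle E (fst (?qs ! i)) \<or>
      (\<exists>j<i. 2 \<le> card ((fst (?qs ! i) \<inter> snd (?qs ! i)) \<inter> (fst (?qs ! j) \<inter> snd (?qs ! j))))"
    proof
      assume "claw_free V E (ss ! i)"
      then obtain A B where ab: "ss ! i = {A, B}" "has_cycle E A" "has_cycle E B"
        unfolding claw_free_def by blast
      have "{A, B} = {fst (f (ss ! i)), snd (f (ss ! i))}" using F(2)[OF i] ab(1) by simp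
      then have "fst (f (ss ! i)) \<in> {A, B}" by blast
      then show ?thesis using ab F(1)[OF i] by auto
    next
      assume "\<exists>j<i. card (separator (ss ! i) \<inter> separator (ss ! j)) \<ge> 2"
      then obtain j where j: "j < i" "card (separator (ss ! i) \<inter> separator (ss ! j)) \<ge> 2" by blast
      then have "j < length ss" using i by simp
      then show ?thesis using j F(3)[OF i] F(3)[of j] by auto
    qed
  qed
  then show ?thesis unfolding set bag_family torso_family .
qed

lemma k_connected_torso: "k_connected Z H 3"
  using chops_to_torso chops_to_state k3 profile by blast

lemma outside_bag:
  assumes "x \<in> V" "x \<notin> Z"
  obtains A B where "(A, B) \<in> \<sigma>" "x \<in> A - B"
proof -
  obtain A B where ab: "(A, B) \<in> \<sigma>" "x \<notin> B" using assms unfolding bag_eq by blast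
  then have "x \<in> A" using is_sep_Un[OF star_props(2)[OF ab(1)]] assms(1) by blast
  then show thesis using that ab by blast
qed

lemma finite_star: "finite \<sigma>"
proof -
  have "\<sigma> \<subseteq> Pow V \<times> Pow V" using is_sep_subset[OF star_props(2)] by auto
  then show ?thesis using graphD(1)[OF graph] by (meson finite_Pow_iff finite_SigmaI finite_subset)
qed

subsection \<open>The bag has more than four vertices\<close>

text \<open>Merging star sides whose separators lie in \<open>R\<close> never leads to a separator
  outside \<open>R\<close>, so the merged side stays small.\<close>

lemma union_small:
  assumes R: "R \<subseteq> Z" "card R < 4" and F: "F \<subseteq> \<sigma>" "\<And>A B. (A, B) \<in> F \<Longrightarrow> A \<inter> B \<subseteq> R"
  shows "(R \<union> \<Union> (fst ` F), {x \<in> V. \<forall>(A, B)\<in>F. x \<in> B}) \<in> \<tau>"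
proof -
  have "finite F" using F(1) finite_star finite_subset by blast
  then show ?thesis using F
  proof induction
    case empty
    have "R \<subseteq> V" using R(1) unfolding bag_eq by blast
    then show ?case using profile4_small[OF profile _ R(2)] by simp
  next
    case (insert q F)
    obtain A B where q: "q = (A, B)" by (cases q)
    have ab: "(A, B) \<in> \<sigma>" "A \<inter> B \<subseteq> R" using insert.prems q by auto
    have BV: "B \<subseteq> V" using is_sep_subset[OF star_props(2)[OF ab(1)]] by blast
    let ?A = "R \<union> \<Union> (fst ` F)" and ?B = "{x \<in> V. \<forall>(A, B)\<in>F. x \<in> B}"
    have IH: "(?A, ?B) \<in> \<tau>" using insert.IH insert.prems by auto
    have "(?A \<union> A) \<inter> (?B \<inter> B) \<subseteq> R"
    proof
      fix x assume x: "x \<in> (?A \<union> A) \<inter> (?B \<inter> B)"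
      then consider "x \<in> R" | "x \<in> A" "x \<in> B" | C D where "(C, D) \<in> F" "x \<in> C" by auto
      then show "x \<in> R"
      proof cases
        case 3
        then have "x \<in> D" using x by auto
        then show ?thesis using 3 insert.prems(2)[of C D] by auto
      qed (use ab in blast)+
    qed
    then have "card ((?A \<union> A) \<inter> (?B \<inter> B)) \<le> card R"
      by (rule card_mono[OF finite_subset[OF R(1) finite_bag]])
    then have "card ((?A \<union> A) \<inter> (?B \<inter> B)) < 4" using R(2) by linarith
    then have "(?A \<union> A, ?B \<inter> B) \<in> \<tau>"
      by (rule profile4_union[OF profile graph IH star_props(1)[OF ab(1)]])
    moreover have "?A \<union> A = R \<union> \<Union> (fst ` insert q F)" using q by auto
    moreover have "?B \<inter> B = {x \<in> V. \<forall>(A, B)\<in>insert q F. x \<in> B}" using q BV by auto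
    ultimately show ?case by simp
  qed
qed

lemma neighbour_outside:
  assumes e: "E x y" and x: "(A, B) \<in> \<sigma>" "x \<in> A - B"
  shows "y \<in> A"
  using is_sep_edge[OF graph star_props(2)[OF x(1)] e] x(2) by blast

text \<open>The component stays in \<open>A - B\<close> and can attach only to
  \<open>A \<inter> B\<close>; 3-connectivity forces it to attach to all three vertices, because the
  bag has a fourth one beyond them.\<close>

lemma nbh_component:
  assumes Z: "card Z = 4" and ab: "(A, B) \<in> \<sigma>" and x: "x \<in> A - B"
  shows "nbh V E {y \<in> V - Z. (restr E (V - Z))\<^sup>*\<^sup>* x y} = A \<inter> B"
proof -
  let ?C = "{y \<in> V - Z. (restr E (V - Z))\<^sup>*\<^sup>* x y}"
  have ZV: "Z \<subseteq> V" unfolding bag_eq by blast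
  have xV: "x \<in> V - Z" using ab x is_sep_subset[OF star_props(2)[OF ab]] unfolding bag_eq by blast
  have CA: "?C \<subseteq> A - B"
  proof clarify
    fix y assume "(restr E (V - Z))\<^sup>*\<^sup>* x y"
    then show "y \<in> A - B"
    proof induction
      case base
      show ?case using x by blast
    next
      case (step y z)
      then have "z \<in> A" "z \<notin> Z" using neighbour_outside[OF _ ab] unfolding restr_def by blast+
      then show ?case using separator_bag[OF ab] by blast
    qed
  qed
  have sub: "nbh V E ?C \<subseteq> A \<inter> B"
  proof
    fix v assume "v \<in> nbh V E ?C"
    then obtain u where u: "u \<in> ?C" "E u v" "v \<in> V - ?C" unfolding nbh_def by blast
    have "v \<in> A" using neighbour_outside[OF u(2) ab] u(1) CA by blast
    moreover have "v \<in> Z"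
    proof (rule ccontr)
      assume "v \<notin> Z"
      then have "restr E (V - Z) u v" using u unfolding restr_def by blast
      then have "(restr E (V - Z))\<^sup>*\<^sup>* x v" using u(1) by (auto intro: rtranclp.rtrancl_into_rtrancl)
      then show False using u(3) \<open>v \<notin> Z\<close> by blast
    qed
    ultimately show "v \<in> A \<inter> B" using bag_inter[OF ab] by blast
  qed
  have "is_sep V E (?C \<union> nbh V E ?C) (V - ?C)"
    unfolding is_sep_def nbh_def by blast
  moreover have "(?C \<union> nbh V E ?C) \<inter> (V - ?C) = nbh V E ?C" unfolding nbh_def by blast
  ultimately have "?C \<union> nbh V E ?C \<subseteq> V - ?C \<or> V - ?C \<subseteq> ?C \<union> nbh V E ?C"
    if "card (nbh V E ?C) < 3"
    using k_connectedD[OF k3, of "?C \<union> nbh V E ?C" "V - ?C"] that by simp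
  moreover have "x \<in> ?C" using xV by blast
  moreover have "\<not> V - ?C \<subseteq> ?C \<union> nbh V E ?C"
  proof
    assume "V - ?C \<subseteq> ?C \<union> nbh V E ?C"
    then have "Z \<subseteq> A \<inter> B" using ZV sub by blast
    then have "card Z \<le> card (A \<inter> B)"
      using is_sep_subset[OF star_props(2)[OF ab]] graphD(1)[OF graph]
      by (intro card_mono) (auto intro: finite_subset)
    then show False using Z star_props(3)[OF ab] by simp
  qed
  ultimately have "\<not> card (nbh V E ?C) < 3" by blast
  moreover have "finite (A \<inter> B)" using star_props(3)[OF ab] by (metis card.infinite zero_neq_numeral)
  ultimately show ?thesis using sub star_props(3)[OF ab] by (metis card_seteq not_less)
qed

lemma cubic_if_all_triples:
  assumes Z: "card Z = 4"
    and all: "\<And>Y. Y \<subseteq> Z \<Longrightarrow> card Y = 3 \<Longrightarrow> \<exists>A B. (A, B) \<in> \<sigma> \<and> A \<inter> B = Y"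
  shows "cubic_tangle V E \<tau>"
proof -
  let ?comp = "\<lambda>x. {y \<in> V - Z. (restr E (V - Z))\<^sup>*\<^sup>* x y}"
  have comps: "components E (V - Z) = ?comp ` (V - Z)" unfolding components_def by blast
  have "nbh V E ` components E (V - Z) = {Y. Y \<subseteq> Z \<and> card Y = 3}"
  proof (intro equalityI subsetI)
    fix Y assume "Y \<in> nbh V E ` components E (V - Z)"
    then obtain x where x: "x \<in> V - Z" "Y = nbh V E (?comp x)" unfolding comps by blast
    then obtain A B where ab: "(A, B) \<in> \<sigma>" "x \<in> A - B" using outside_bag by blast
    then show "Y \<in> {Y. Y \<subseteq> Z \<and> card Y = 3}"
      using nbh_component[OF Z ab] x(2) separator_bag star_props(3) by auto
  next
    fix Y assume "Y \<in> {Y. Y \<subseteq> Z \<and> card Y = 3}"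
    then obtain A B where ab: "(A, B) \<in> \<sigma>" "A \<inter> B = Y" using all by blast
    obtain x where x: "x \<in> A - B" using star_props(4)[OF ab(1)] by blast
    then have "x \<in> V - Z" using ab(1) is_sep_subset[OF star_props(2)[OF ab(1)]] unfolding bag_eq by blast
    then show "Y \<in> nbh V E ` components E (V - Z)"
      using nbh_component[OF Z ab(1) x] ab(2) unfolding comps by blast
  qed
  then have "cubic_set V E Z" unfolding cubic_set_def using Z bag_eq by auto
  moreover have "star \<sigma>" using splitting unfolding splitting_star_def by blast
  moreover have "\<forall>(A, B)\<in>\<sigma>. card (A \<inter> B) = 3" using star_props(3) by blast
  ultimately show ?thesis unfolding cubic_tangle_def using star_tangle by blast
qed

text \<open>If the bag had four vertices, some triple \<open>Y\<close> of them would be no separator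
  of the star, as the tangle is non-cubic. All star separators then contain the fourth vertex
  \<open>z\<close>, and the three triples through \<open>z\<close>, with the star sides attached to
  them, cover \<open>G\<close>.\<close>

lemma card_bag:
  assumes "\<not> cubic_tangle V E \<tau>"
  shows "4 < card Z"
proof (rule ccontr)
  assume n: "\<not> 4 < card Z"
  note fZ = finite_bag
  have "card Z > 3" using k_connected_card[OF k_connected_torso] by simp
  then have Z4: "card Z = 4" using n by simp
  then obtain Y where Y: "Y \<subseteq> Z" "card Y = 3" "\<And>A B. (A, B) \<in> \<sigma> \<Longrightarrow> A \<inter> B \<noteq> Y"
    using cubic_if_all_triples assms by blast
  obtain a b c where abc: "Y = {a, b, c}" "a \<noteq> b" "b \<noteq> c" "a \<noteq> c" using Y(2) by (auto simp: card_3_iff)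
  have "card (Z - Y) = 1" using card_Diff_subset[OF finite_subset[OF Y(1) fZ] Y(1)] Z4 Y(2) by simp
  then obtain z where z: "Z - Y = {z}" by (rule card_1_singletonE)
  then have Zz: "Z = {z, a, b, c}" "z \<notin> Y" using Y(1) abc(1) by blast+
  \<comment> \<open>A triple together with all star sides attached exactly along it; small by
    \<open>union_small\<close>.\<close>
  define U where "U = (\<lambda>R. R \<union> \<Union> (fst ` {(A, B) \<in> \<sigma>. A \<inter> B = R}))"
  have U: "\<exists>B. (U R, B) \<in> \<tau>" if "R \<subseteq> Z" "card R < 4" for R
    unfolding U_def using union_small[OF that, of "{(A, B) \<in> \<sigma>. A \<inter> B = R}"] by blast
  let ?R1 = "{z, a, b}" and ?R2 = "{z, a, c}" and ?R3 = "{z, b, c}"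
  have c4: "card {u, v, w} < 4" for u v w :: 'a by (simp add: card_insert_if)
  obtain B1 B2 B3 where B: "(U ?R1, B1) \<in> \<tau>" "(U ?R2, B2) \<in> \<tau>" "(U ?R3, B3) \<in> \<tau>"
    using U[of ?R1] U[of ?R2] U[of ?R3] Zz(1) c4 by auto
  have inU: "A \<subseteq> U ?R1 \<or> A \<subseteq> U ?R2 \<or> A \<subseteq> U ?R3" if ab: "(A, B) \<in> \<sigma>" for A B
  proof -
    have T: "A \<inter> B \<subseteq> Z" "card (A \<inter> B) = 3" "A \<inter> B \<noteq> Y"
      using separator_bag[OF ab] star_props(3)[OF ab] Y(3)[OF ab] by auto
    have "z \<in> A \<inter> B"
    proof (rule ccontr)
      assume "z \<notin> A \<inter> B"
      then have "A \<inter> B \<subseteq> Y" using T(1) z by auto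
      then show False using T(2,3) Y(2) finite_subset[OF Y(1) fZ] card_subset_eq by metis
    qed
    have "card (Z - A \<inter> B) = 1"
      using card_Diff_subset[OF finite_subset[OF T(1) fZ] T(1)] Z4 T(2) by simp
    then obtain w where "Z - A \<inter> B = {w}" by (rule card_1_singletonE)
    then have "A \<inter> B = Z - {w}" "w \<in> Z" "w \<noteq> z" using T(1) \<open>z \<in> A \<inter> B\<close> by blast+
    then have "A \<inter> B = ?R1 \<or> A \<inter> B = ?R2 \<or> A \<inter> B = ?R3" using Zz abc by auto
    moreover have "A \<subseteq> U (A \<inter> B)" unfolding U_def using ab by force
    ultimately show ?thesis by metis
  qed
  show False
  proof (rule tangle_no_cover[OF tangle B])
    show "V \<subseteq> U ?R1 \<union> U ?R2 \<union> U ?R3"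
    proof
      fix x assume "x \<in> V"
      show "x \<in> U ?R1 \<union> U ?R2 \<union> U ?R3"
      proof (cases "x \<in> Z")
        case True
        then show ?thesis unfolding Zz U_def by blast
      next
        case False
        then show ?thesis using outside_bag[OF \<open>x \<in> V\<close>] inU by blast
      qed
    qed
    fix x y assume e: "E x y"
    have V: "x \<in> V" "y \<in> V" and e': "E y x" using graphD[OF graph] e by blast+
    consider "x \<in> Z" "y \<in> Z" | "x \<notin> Z" | "y \<notin> Z" by blast
    then show "x \<in> U ?R1 \<and> y \<in> U ?R1 \<or> x \<in> U ?R2 \<and> y \<in> U ?R2 \<or> x \<in> U ?R3 \<and> y \<in> U ?R3"
    proof cases
      case 1
      have "R \<subseteq> U R" for R unfolding U_def by blast
      moreover have "x \<in> ?R1 \<and> y \<in> ?R1 \<or> x \<in> ?R2 \<and> y \<in> ?R2 \<or> x \<in> ?R3 \<and> y \<in> ?R3"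
        using 1 unfolding Zz by auto
      ultimately show ?thesis by (meson subsetD)
    next
      case 2
      then obtain A B where ab: "(A, B) \<in> \<sigma>" "x \<in> A - B" using outside_bag[OF V(1)] by blast
      then show ?thesis using neighbour_outside[OF e ab] inU[OF ab(1)] by blast
    next
      case 3
      then obtain A B where ab: "(A, B) \<in> \<sigma>" "y \<in> A - B" using outside_bag[OF V(2)] by blast
      then show ?thesis using neighbour_outside[OF e' ab] inU[OF ab(1)] by blast
    qed
  qed
qed

subsection \<open>The torso is internally 4-connected\<close>

text \<open>Each star separator is a clique of the torso and so lies in \<open>X\<close> or in
  \<open>Y\<close>; its side is added there. Ties go to \<open>X\<close>, so no star side is added
  twice and the separator does not grow.\<close>

lemma lift_torso_sep:
  assumes s: "is_sep Z H X Y"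
  obtains X' Y' where "is_sep V E X' Y'" "X' \<inter> Y' = X \<inter> Y" "X' \<inter> Z = X" "Y' \<inter> Z = Y"
    "\<And>A B. (A, B) \<in> \<sigma> \<Longrightarrow> A \<subseteq> X' \<and> Y' \<subseteq> B \<or> A \<subseteq> Y' \<and> X' \<subseteq> B"
proof -
  have gH: "graph Z H" by (rule k_connected_graph[OF k_connected_torso])
  define X' where "X' = X \<union> \<Union> {A. \<exists>B. (A, B) \<in> \<sigma> \<and> A \<inter> B \<subseteq> X}"
  define Y' where "Y' = Y \<union> \<Union> {A. \<exists>B. (A, B) \<in> \<sigma> \<and> \<not> A \<inter> B \<subseteq> X}"
  have XYZ: "X \<union> Y = Z" by (rule is_sep_Un[OF s])
  have ZV: "Z \<subseteq> V" unfolding bag_eq by blast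
  have cl: "A \<inter> B \<subseteq> X \<or> A \<inter> B \<subseteq> Y" if ab: "(A, B) \<in> \<sigma>" for A B
  proof (rule ccontr)
    assume "\<not> ?thesis"
    then obtain x y where xy: "x \<in> A \<inter> B" "x \<notin> X" "y \<in> A \<inter> B" "y \<notin> Y" by blast
    then have "x \<in> Y - X" "y \<in> X - Y" using separator_bag[OF ab] XYZ by blast+
    moreover from this have "H y x" unfolding torso_def using xy ab separator_bag[OF ab] by blast
    ultimately show False using s unfolding is_sep_def by blast
  qed
  have in1: "A \<subseteq> X'" if "(A, B) \<in> \<sigma>" "A \<inter> B \<subseteq> X" for A B using that unfolding X'_def by blast
  have in2: "A \<subseteq> Y'" if "(A, B) \<in> \<sigma>" "\<not> A \<inter> B \<subseteq> X" for A B using that unfolding Y'_def by blast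
  have in12: "A \<subseteq> X' \<or> A \<subseteq> Y'" if "(A, B) \<in> \<sigma>" for A B using in1 in2 that by blast
  have sub: "X \<subseteq> X'" "Y \<subseteq> Y'" unfolding X'_def Y'_def by blast+
  have AV: "A \<subseteq> V" if "(A, B) \<in> \<sigma>" for A B using is_sep_subset[OF star_props(2)[OF that]] by blast
  have bags: "X' \<inter> Z = X" "Y' \<inter> Z = Y"
  proof -
    have "A \<inter> Z \<subseteq> X" if "(A, B) \<in> \<sigma>" "A \<inter> B \<subseteq> X" for A B using bag_inter[OF that(1)] that(2) by blast
    then show "X' \<inter> Z = X" unfolding X'_def using XYZ by blast
    have "A \<inter> Z \<subseteq> Y" if "(A, B) \<in> \<sigma>" "\<not> A \<inter> B \<subseteq> X" for A B
      using bag_inter[OF that(1)] cl[OF that(1)] that(2) by blast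
    then show "Y' \<inter> Z = Y" unfolding Y'_def using XYZ by blast
  qed
  have sep: "is_sep V E X' Y'"
  proof (rule is_sepI[OF graph])
    show "X' \<union> Y' = V"
    proof
      show "X' \<union> Y' \<subseteq> V" unfolding X'_def Y'_def using AV XYZ ZV by blast
      show "V \<subseteq> X' \<union> Y'"
      proof
        fix x assume x: "x \<in> V"
        show "x \<in> X' \<union> Y'"
        proof (cases "x \<in> Z")
          case True
          then show ?thesis using XYZ sub by blast
        next
          case False
          then show ?thesis using outside_bag[OF x] in12 by blast
        qed
      qed
    qed
    fix x y assume e: "E x y"
    have V: "x \<in> V" "y \<in> V" "x \<noteq> y" and e': "E y x" using graphD[OF graph] e by blast+
    consider "x \<in> Z" "y \<in> Z" | "x \<notin> Z" | "y \<notin> Z" by blast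
    then show "x \<in> X' \<and> y \<in> X' \<or> x \<in> Y' \<and> y \<in> Y'"
    proof cases
      case 1
      then have "H x y" using e V unfolding torso_def by blast
      then show ?thesis using is_sep_edge[OF gH s] sub by blast
    next
      case 2
      then obtain A B where ab: "(A, B) \<in> \<sigma>" "x \<in> A - B" using outside_bag[OF V(1)] by blast
      then show ?thesis using neighbour_outside[OF e ab] in12[OF ab(1)] by blast
    next
      case 3
      then obtain A B where ab: "(A, B) \<in> \<sigma>" "y \<in> A - B" using outside_bag[OF V(2)] by blast
      then show ?thesis using neighbour_outside[OF e' ab] in12[OF ab(1)] by blast
    qed
  qed
  have side: "A \<subseteq> X' \<and> Y' \<subseteq> B \<or> A \<subseteq> Y' \<and> X' \<subseteq> B" if ab: "(A, B) \<in> \<sigma>" for A B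
  proof -
    have ZB: "Z \<subseteq> B" using ab unfolding bag_eq by blast
    show ?thesis
    proof (cases "A \<inter> B \<subseteq> X")
      case True
      have "C \<subseteq> B" if "(C, D) \<in> \<sigma>" "\<not> C \<inter> D \<subseteq> X" for C D
        using star_far[OF ab that(1)] that(2) True by blast
      then have "Y' \<subseteq> B" unfolding Y'_def using ZB XYZ by blast
      then show ?thesis using in1[OF ab True] by blast
    next
      case False
      have "C \<subseteq> B" if "(C, D) \<in> \<sigma>" "C \<inter> D \<subseteq> X" for C D
        using star_far[OF ab that(1)] that(2) False by blast
      then have "X' \<subseteq> B" unfolding X'_def using ZB XYZ by blast
      then show ?thesis using in2[OF ab False] by blast
    qed
  qed
  have "X' \<inter> Y' \<subseteq> Z"
  proof
    fix x assume x: "x \<in> X' \<inter> Y'"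
    have "x \<in> B" if "(A, B) \<in> \<sigma>" for A B using side[OF that] x by blast
    then show "x \<in> Z" unfolding bag_eq using x is_sep_subset[OF sep] by blast
  qed
  then have "X' \<inter> Y' = X \<inter> Y" using bags by blast
  then show thesis using that sep bags side by blast
qed

text \<open>Here maximality is used: a new separation nested with all of \<open>N\<close> that
  satisfied the enumeration condition could be appended to the claw-freeing enumeration of
  \<open>N\<close>.\<close>

lemma lifted_sep_maximal:
  assumes s: "is_sep V E X' Y'" "card (X' \<inter> Y') = 3"
    and ne: "X' \<inter> Z - Y' \<noteq> {}" "Y' \<inter> Z - X' \<noteq> {}"
    and side: "\<And>A B. (A, B) \<in> \<sigma> \<Longrightarrow> A \<subseteq> X' \<and> Y' \<subseteq> B \<or> A \<subseteq> Y' \<and> X' \<subseteq> B"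
  shows "\<not> claw_free V E {X', Y'}"
    and "\<And>t. t \<in> N \<Longrightarrow> card (separator {X', Y'} \<inter> separator t) < 2"
proof -
  let ?s = "{X', Y'}"
  have p3: "proper3 V E ?s" unfolding proper3_def proper_sep_def using s ne by blast
  have ZB: "Z \<subseteq> B" if "(A, B) \<in> oriented" for A B using that unfolding bag_family family_bag_def by blast
  \<comment> \<open>A member of \<open>N\<close> has the whole bag on one side, but
    \<open>X'\<close> and \<open>Y'\<close> both miss part of it.\<close>
  have notN: "?s \<notin> N"
  proof
    assume "?s \<in> N"
    then obtain A B where ab: "?s = {A, B}" "(A, B) \<in> oriented" using oriented_exists by blast
    then have "B = X' \<or> B = Y'" by (auto simp: doubleton_eq_iff)
    then show False using ZB[OF ab(2)] ne by blast
  qed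
  have nest: "nested t ?s" if t: "t \<in> N" for t
  proof -
    obtain A B where ab: "t = {A, B}" "(A, B) \<in> oriented" using oriented_exists[OF t] by blast
    then obtain C D where cd: "(C, D) \<in> \<sigma>" "A \<subseteq> C" "D \<subseteq> B" using oriented_le by blast
    from side[OF cd(1)] have "sep_le (A, B) (X', Y') \<or> sep_le (A, B) (Y', X')"
      using cd unfolding sep_le_def by auto
    moreover have "(A, B) \<in> orientations t" "(X', Y') \<in> orientations ?s" "(Y', X') \<in> orientations ?s"
      using ab unfolding orientations_def by auto
    ultimately show ?thesis unfolding nested_def by blast
  qed
  have chopN: "chop3 V E N" using max_chop unfolding max_chop3_def by blast
  have "\<not> chop3 V E (insert ?s N)" using max_chop notN unfolding max_chop3_def by blast
  moreover have "\<forall>t\<in>insert ?s N. proper3 V E t" using proper p3 by blast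
  moreover have "\<forall>t\<in>insert ?s N. \<forall>u\<in>insert ?s N. nested t u"
    using nest nested_sym nested_refl chopN unfolding chop3_def by blast
  ultimately have ncf: "\<not> claw_freeable V E (insert ?s N)" unfolding chop3_def by blast
  obtain ss where ss: "distinct ss" "set ss = N"
    "\<forall>i < length ss. claw_free V E (ss ! i) \<or>
           (\<exists>j < i. card (separator (ss ! i) \<inter> separator (ss ! j)) \<ge> 2)"
    using chopN unfolding chop3_def claw_freeable_def by blast
  have bad: "\<not> (claw_free V E ?s \<or> (\<exists>t\<in>N. card (separator ?s \<inter> separator t) \<ge> 2))"
  proof
    assume ok: "claw_free V E ?s \<or> (\<exists>t\<in>N. card (separator ?s \<inter> separator t) \<ge> 2)"
    let ?ss = "ss @ [?s]"
    have "claw_free V E (?ss ! i) \<or> (\<exists>j < i. card (separator (?ss ! i) \<inter> separator (?ss ! j)) \<ge> 2)"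
      if i: "i < length ?ss" for i
    proof (cases "i < length ss")
      case True
      have nth: "?ss ! j = ss ! j" if "j \<le> i" for j using that True by (simp add: nth_append)
      then show ?thesis using ss(3)[rule_format, OF True] by (metis less_imp_le order_refl)
    next
      case False
      then have i': "i = length ss" using i by simp
      from ok show ?thesis
      proof
        assume "\<exists>t\<in>N. card (separator ?s \<inter> separator t) \<ge> 2"
        then obtain j where "j < length ss" "card (separator ?s \<inter> separator (ss ! j)) \<ge> 2"
          using ss(2) by (metis in_set_conv_nth)
        then show ?thesis unfolding i' by (auto simp: nth_append)
      qed (simp add: i')
    qed
    moreover have "distinct ?ss" "set ?ss = insert ?s N" using ss notN by auto
    ultimately have "claw_freeable V E (insert ?s N)"
      unfolding claw_freeable_def using proper p3 by blast
    then show False using ncf by blast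
  qed
  then show "\<not> claw_free V E ?s" by blast
  show "card (separator ?s \<inter> separator t) < 2" if "t \<in> N" for t using bad that by force
qed

text \<open>The lifted separation is not claw-free, so one side is acyclic and therefore a claw; its
  inner vertex is all that can remain on that side of the torso.\<close>

lemma torso_sep_structure:
  assumes s: "is_sep Z H X Y" and c: "card (X \<inter> Y) = 3" and p: "proper_sep X Y"
  shows "(\<forall>x\<in>X \<inter> Y. \<forall>y\<in>X \<inter> Y. \<not> H x y) \<and> (card (X - Y) = 1 \<or> card (Y - X) = 1)"
proof -
  obtain X' Y' where l: "is_sep V E X' Y'" "X' \<inter> Y' = X \<inter> Y" "X' \<inter> Z = X" "Y' \<inter> Z = Y"
    "\<And>A B. (A, B) \<in> \<sigma> \<Longrightarrow> A \<subseteq> X' \<and> Y' \<subseteq> B \<or> A \<subseteq> Y' \<and> X' \<subseteq> B"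
    using lift_torso_sep[OF s] by metis
  have c': "card (X' \<inter> Y') = 3" using c l(2) by simp
  have ne: "X' \<inter> Z - Y' \<noteq> {}" "Y' \<inter> Z - X' \<noteq> {}" using p l(2-4) unfolding proper_sep_def by blast+
  have m1: "\<not> claw_free V E {X', Y'}" by (rule lifted_sep_maximal(1)[OF l(1) c' ne]) (rule l(5))
  have m2: "card (separator {X', Y'} \<inter> separator t) < 2" if "t \<in> N" for t
    by (rule lifted_sep_maximal(2)[OF l(1) c' ne _ that]) (rule l(5))
  have ps: "X' - Y' \<noteq> {}" "Y' - X' \<noteq> {}" using ne by blast+
  have fin: "finite (X \<inter> Y)" using c by (metis card.infinite zero_neq_numeral)
  \<comment> \<open>A torso edge that is no edge of \<open>G\<close> comes from a star separator,
    which would share two vertices with the lifted one.\<close>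
  have indep: "\<not> H x y" if xy: "x \<in> X \<inter> Y" "y \<in> X \<inter> Y" and e: "\<not> E x y" for x y
  proof
    assume h: "H x y"
    then obtain A B where ab: "(A, B) \<in> \<sigma>" "x \<in> A \<inter> B" "y \<in> A \<inter> B" "x \<noteq> y"
      using e unfolding torso_def by blast
    have "{A, B} \<in> N" using star_oriented ab(1) unfolding oriented_def by blast
    from m2[OF this] have "card (X' \<inter> Y' \<inter> (A \<inter> B)) < 2" unfolding separator_def by simp
    moreover have "card {x, y} \<le> card (X' \<inter> Y' \<inter> (A \<inter> B))"
      by (rule card_mono) (use xy ab l(2) fin in auto)
    ultimately show False using ab(4) by simp
  qed
  have "\<not> has_cycle E X' \<or> \<not> has_cycle E Y'"
    using m1 l(1) c' ps unfolding claw_free_def proper_sep_def by blast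
  then show ?thesis
  proof
    assume "\<not> has_cycle E X'"
    then obtain v where v: "X' - Y' = {v}" "\<And>x y. x \<in> X' \<inter> Y' \<Longrightarrow> y \<in> X' \<inter> Y' \<Longrightarrow> \<not> E x y"
      using acyclic_side_claw[OF k3 l(1) c' ps] by metis
    have "X - Y \<subseteq> X' - Y'" using l(3,4) by blast
    then have "X - Y = {v}" using v(1) p unfolding proper_sep_def by auto
    then show ?thesis using indep v(2) l(2) by auto
  next
    assume nc: "\<not> has_cycle E Y'"
    have "card (Y' \<inter> X') = 3" using c' by (simp add: Int_commute)
    then obtain v where v: "Y' - X' = {v}" "\<And>x y. x \<in> Y' \<inter> X' \<Longrightarrow> y \<in> Y' \<inter> X' \<Longrightarrow> \<not> E x y"
      using acyclic_side_claw[OF k3 is_sep_sym[OF graph l(1)] _ ps(2,1) nc] by metis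
    have "Y' \<inter> X' = X \<inter> Y" using l(2) by blast
    moreover have "Y - X \<subseteq> Y' - X'" using l(3,4) by blast
    then have "Y - X = {v}" using v(1) p unfolding proper_sep_def by auto
    ultimately show ?thesis using indep v(2) by auto
  qed
qed

lemma int4_connected_torso:
  assumes "\<not> cubic_tangle V E \<tau>"
  shows "int4_connected Z H"
  unfolding int4_connected_def
  using k_connected_torso card_bag[OF assms] torso_sep_structure by blast

section \<open>Normality of the torso\<close>

text \<open>A choppable separation of the torso has a side with one inner vertex. If this is the
  small side, that side is a claw and acyclic; if it is the big side, the tangle decides.\<close>

lemma normal_torso:
  assumes rho: "chops_to V E \<tau> Z H \<rho>" "represents V \<tau> oriented \<rho>"
  shows "normal H \<rho>"
  unfolding normal_def
proof (rule notI, elim exE)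
  fix X Y assume r: "choppable H \<rho> X Y"
  have xy: "(X, Y) \<in> \<rho>" "card (X \<inter> Y) = 3" "X - Y \<noteq> {}" "has_cycle H X"
    using r unfolding choppable_def by auto
  have pH: "profile4 Z H \<rho>" using chops_to_state[OF rho(1) k3 profile] by blast
  have gH: "graph Z H" by (rule k_connected_graph[OF k_connected_torso])
  have s: "is_sep Z H X Y" by (rule profile4D(1)[OF pH xy(1)])
  have ne: "Y - X \<noteq> {}" by (rule profile4_big_side[OF pH xy(1)])
  have str: "\<And>x y. x \<in> X \<inter> Y \<Longrightarrow> y \<in> X \<inter> Y \<Longrightarrow> \<not> H x y" "card (X - Y) = 1 \<or> card (Y - X) = 1"
    using torso_sep_structure[OF s xy(2)] xy(3) ne unfolding proper_sep_def by blast+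
  from str(2) show False
  proof
    assume "card (X - Y) = 1"
    then obtain v where v: "X - Y = {v}" by (rule card_1_singletonE)
    obtain xs where xs: "length xs \<ge> 3" "distinct xs" "set xs \<subseteq> X"
      "\<forall>i < length xs. H (xs ! i) (xs ! ((i + 1) mod length xs))"
      using xy(4) unfolding has_cycle_def by blast
    \<comment> \<open>The separator is independent, so a cycle vertex on it would need two
      neighbours, both equal to \<open>v\<close>.\<close>
    have only: "y = v" if "x \<in> X \<inter> Y" "y \<in> X" "H x y" for x y
      using that str(1) v by blast
    have "set xs \<subseteq> {v}"
    proof
      fix x assume x: "x \<in> set xs"
      obtain y z where yz: "y \<in> set xs" "z \<in> set xs" "y \<noteq> z" "H x y" "H x z"
        using has_cycle_neighbours[OF xs(1,2,4) graphD(5)[OF gH] x] by blast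
      show "x \<in> {v}"
      proof (rule ccontr)
        assume "x \<notin> {v}"
        then have "x \<in> X \<inter> Y" using x xs(3) v by blast
        then show False using only yz xs(3) by (metis subsetD)
      qed
    qed
    then have "card (set xs) \<le> 1" using card_mono[of "{v}" "set xs"] by simp
    then show False using xs(1,2) by (simp add: distinct_card)
  next
    assume "card (Y - X) = 1"
    then obtain v where v: "Y - X = {v}" by (rule card_1_singletonE)
    obtain a b c where abc: "X \<inter> Y = {a, b, c}" using xy(2) by (auto simp: card_3_iff)
    have XYZ: "X \<union> Y = Z" by (rule is_sep_Un[OF s])
    have ZV: "Z \<subseteq> V" unfolding bag_eq by blast
    have vZ: "v \<in> Z" "v \<in> V" using v XYZ ZV by blast+
    have nbv: "y \<in> Y" if "H v y" for y using is_sep_edge[OF gH s that] v by blast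
    \<comment> \<open>A star separator through \<open>v\<close> would put two adjacent vertices into
      the independent set \<open>X \<inter> Y\<close>.\<close>
    have vA: "v \<notin> A" if ab: "(A, B) \<in> \<sigma>" for A B
    proof
      assume "v \<in> A"
      then have vT: "v \<in> A \<inter> B" using bag_inter[OF ab] vZ by blast
      have T: "H x y" if "x \<in> A \<inter> B" "y \<in> A \<inter> B" "x \<noteq> y" for x y
        using that ab separator_bag[OF ab] unfolding torso_def by blast
      have "A \<inter> B - {v} \<subseteq> X \<inter> Y" using nbv T[OF vT] v by blast
      moreover have "card (A \<inter> B - {v}) = 2" using vT star_props(3)[OF ab] by simp
      then obtain x y where "x \<in> A \<inter> B - {v}" "y \<in> A \<inter> B - {v}" "x \<noteq> y"
        by (metis card_2_iff insertI1 insert_commute)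
      ultimately show False using T str(1) by blast
    qed
    have nbE: "y \<in> {a, b, c}" if e: "E v y" for y
    proof -
      have y: "y \<in> V" "y \<noteq> v" "E y v" using graphD[OF graph] e by blast+
      have "y \<in> Z"
      proof (rule ccontr)
        assume "y \<notin> Z"
        then obtain A B where ab: "(A, B) \<in> \<sigma>" "y \<in> A - B" using outside_bag[OF y(1)] by blast
        then show False using neighbour_outside[OF y(3) ab] vA by blast
      qed
      then have "H v y" using e vZ y unfolding torso_def by blast
      then show ?thesis using nbv v y abc by blast
    qed
    have YV: "Y \<subseteq> V" "(V - {v}) \<inter> Y = X \<inter> Y" using XYZ ZV v by blast+
    have sY: "is_sep V E (V - {v}) Y"
    proof (rule is_sepI[OF graph])
      show "V - {v} \<union> Y = V" using YV v by blast
      show "x \<in> V - {v} \<and> y \<in> V - {v} \<or> x \<in> Y \<and> y \<in> Y" if "E x y" for x y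
        using that nbE[of x] nbE[of y] abc graphD(2,3,5)[OF graph that] v by (cases "x = v"; cases "y = v") auto
    qed
    have cY: "card ((V - {v}) \<inter> Y) < 4" using YV(2) xy(2) by simp
    from profile4D(3)[OF profile sY cY] show False
    proof
      assume m: "(V - {v}, Y) \<in> \<tau>"
      have "{v, a, b} \<subseteq> V" "{v, c} \<subseteq> V" using abc XYZ ZV vZ by auto
      moreover have "card {v, a, b} < 4" "card {v, c} < 4" by (simp_all add: card_insert_if)
      \<comment> \<open>The claw at \<open>v\<close> is covered by two sets of at most three
        vertices; with \<open>V - {v}\<close> they would be three small sides covering
        \<open>G\<close>.\<close>
      ultimately have sm: "({v, a, b}, V) \<in> \<tau>" "({v, c}, V) \<in> \<tau>"
        using profile4_small[OF profile] by blast+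
      show False
      proof (rule tangle_no_cover[OF tangle m sm])
        show "V \<subseteq> V - {v} \<union> {v, a, b} \<union> {v, c}" by blast
        show "x \<in> V - {v} \<and> y \<in> V - {v} \<or> x \<in> {v, a, b} \<and> y \<in> {v, a, b} \<or> x \<in> {v, c} \<and> y \<in> {v, c}"
          if "E x y" for x y
          using that nbE[of x] nbE[of y] graphD(2,3,5)[OF graph that] by (cases "x = v"; cases "y = v") auto
      qed
    next
      assume m: "(Y, V - {v}) \<in> \<tau>"
      \<comment> \<open>No star side contains \<open>v\<close> and the bag lies in every big side,
        so the separation is nested with all of \<open>oriented\<close>. It restricts to
        \<open>(Y, X)\<close>, against \<open>(X, Y) \<in> \<rho>\<close>.\<close>
      have "compatible (Y, V - {v}) q" if q: "q \<in> oriented" for q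
      proof -
        obtain A B where ab: "q = (A, B)" by (cases q)
        obtain C D where cd: "(C, D) \<in> \<sigma>" "A \<subseteq> C" using oriented_le q unfolding ab by metis
        have "A \<subseteq> V - {v}" using cd vA is_sep_subset[OF star_props(2)[OF cd(1)]] by blast
        moreover have "Y \<subseteq> B" using q XYZ unfolding ab bag_family family_bag_def by blast
        ultimately show ?thesis unfolding compatible_def ab by auto
      qed
      then have "(Y \<inter> Z, (V - {v}) \<inter> Z) \<in> \<rho>"
        using rho(2) m unfolding represents_def bag_family by blast
      moreover have "Y \<inter> Z = Y" "(V - {v}) \<inter> Z = X" using XYZ ZV v by blast+
      ultimately show False using profile4_antisym[OF pH xy(1)] by simp
    qed
  qed
qed

end

theorem mainTheorem13:
  fixes V :: "'a set" and E :: "'a \<Rightarrow> 'a \<Rightarrow> bool"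
    and \<tau> \<sigma>1 \<sigma>2 :: "('a set \<times> 'a set) set" and N1 N2 :: "'a set set set"
  assumes "k_connected V E 3"
    and "tangle V E 4 \<tau>"
    and "\<not> cubic_tangle V E \<tau>"
    and "max_chop3 V E N1" and "max_chop3 V E N2"
    and "splitting_star N1 \<sigma>1" and "\<sigma>1 \<subseteq> \<tau>"
    and "splitting_star N2 \<sigma>2" and "\<sigma>2 \<subseteq> \<tau>"
  shows "int4_connected (bag V \<sigma>1) (torso V E \<sigma>1) \<and>
         int4_connected (bag V \<sigma>2) (torso V E \<sigma>2) \<and>
         graph_iso (bag V \<sigma>1) (torso V E \<sigma>1) (bag V \<sigma>2) (torso V E \<sigma>2)"
proof -
  interpret c1: chop_star V E \<tau> \<sigma>1 N1 using assms by unfold_locales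
  interpret c2: chop_star V E \<tau> \<sigma>2 N2 using assms by unfold_locales
  obtain \<rho>1 where 1: "chops_to V E \<tau> (bag V \<sigma>1) (torso V E \<sigma>1) \<rho>1" "normal (torso V E \<sigma>1) \<rho>1"
    using c1.chops_to_torso c1.normal_torso by blast
  obtain \<rho>2 where 2: "chops_to V E \<tau> (bag V \<sigma>2) (torso V E \<sigma>2) \<rho>2" "normal (torso V E \<sigma>2) \<rho>2"
    using c2.chops_to_torso c2.normal_torso by blast
  show ?thesis
    using c1.int4_connected_torso c2.int4_connected_torso assms(3)
      chops_to_normal_unique[OF assms(1) c1.profile 1 2] by blast
qed

end
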